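(* Let $U\subset\mathbb{R}\times\mathbb{R}^n$ be open and let $f(t,x;\tau,\xi)$ be a polynomial of degree $2$ in $(\tau,\xi)\in\mathbb{R}\times\mathbb{R}^n$ whose coefficients are analytic functions of $(t,x)\in U$. Write $f=f_2+f_1+f_0$, where $f_l$ is the part of $f$ that is homogeneous of degree $l$ in $(\tau,\xi)$. Let $\psi(x)$ be an analytic function and let $\Sigma=\{(t,x)\in U;\ t=\psi(x)\}$. Assume that there is a nonzero constant $a$ such that $$0\neq 1-|\nabla\psi(x)|^2=a\, f_2\bigl(\psi(x),x;-1,\nabla\psi(x)\bigr)$$ for all $x$ with $(\psi(x),x)\in U$. Then for any analytic function $v_0$ on $\Sigma$ there exists an analytic function $v(t,x)$ in an open neighborhood $\Omega$ of $\Sigma$ such that: (i) $u(t,x)=-a\log\bigl(t-\psi(x)\bigr)+v(t,x)$ is a solution of $$u_{tt}-\Delta u=f(t,x;\partial_t u,\nabla u)$$ in $\Omega\cap\{t>\psi(x)\}$; (ii) the restriction of $v$ to $\Sigma$ coincides with $v_0$. Such a function $v$ is unique in a neighborhood of $\Sigma$, i.e. any two functions with these properties coincide in some neighborhood of $\Sigma$.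
   Context: Points of $\mathbb{R}\times\mathbb{R}^n$ are written $(t,x)$ with $x=(x_1,\dots,x_n)$. $\nabla$ and $\Delta$ denote the gradient and the Laplacian with respect to $x$. All functions are real-valued, "analytic" means real-analytic, and constants are real. The function $\psi$ is analytic on an open subset of $\mathbb{R}^n$ over which the hypersurface $\Sigma$ is a graph, and the neighborhood $\Omega\subset U$ of $\Sigma$ is taken to lie over the domain of $\psi$. *)

theory Defs
  imports "HOL-Analysis.Analysis"
begin

section \<open>Multi-indices and real-analytic functions\<close>

text \<open>
  Multi-indices on a Euclidean space are indexed by its canonical basis and vanish off the
  basis, so that distinct multi-indices are distinct functions.
\<close>

definition multi_indices :: "('a::euclidean_space \<Rightarrow> nat) set" where
  "multi_indices = {\<alpha>. \<forall>b. b \<notin> Basis \<longrightarrow> \<alpha> b = 0}"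

definition mdegree :: "('a::euclidean_space \<Rightarrow> nat) \<Rightarrow> nat" where
  "mdegree \<alpha> = (\<Sum>b\<in>Basis. \<alpha> b)"

definition monomial :: "('a::euclidean_space \<Rightarrow> nat) \<Rightarrow> 'a \<Rightarrow> real" where
  "monomial \<alpha> x = (\<Prod>b\<in>Basis. (x \<bullet> b) ^ \<alpha> b)"

text \<open>
  Local representation by a convergent multiple power series. As for \<open>analytic_on\<close> in the
  complex case, the function is required to be analytic on a neighbourhood of each point; below
  this is only used on open sets.
\<close>

definition real_analytic_at :: "('a::euclidean_space \<Rightarrow> real) \<Rightarrow> 'a \<Rightarrow> bool" where
  "real_analytic_at f p \<longleftrightarrow>
     (\<exists>c r. r > 0 \<and>
        (\<forall>x\<in>ball p r. ((\<lambda>\<alpha>. c \<alpha> * monomial \<alpha> (x - p)) has_sum f x) multi_indices))"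

definition real_analytic_on :: "('a::euclidean_space \<Rightarrow> real) \<Rightarrow> 'a set \<Rightarrow> bool"
    (infixl "real'_analytic'_on" 50) where
  "f real_analytic_on S \<longleftrightarrow> (\<forall>p\<in>S. real_analytic_at f p)"

section \<open>Forms with analytic coefficients\<close>

text \<open>
  \<open>g p \<zeta>\<close> is, for \<open>p \<in> U\<close>, a homogeneous polynomial of degree \<open>l\<close> in \<open>\<zeta>\<close>
  (possibly zero) whose coefficients are analytic functions of \<open>p \<in> U\<close>.
\<close>

definition analytic_form_on ::
    "'a::euclidean_space set \<Rightarrow> nat \<Rightarrow> ('a \<Rightarrow> 'b::euclidean_space \<Rightarrow> real) \<Rightarrow> bool" where
  "analytic_form_on U l g \<longleftrightarrow>
     (\<exists>c. (\<forall>\<alpha>\<in>{\<alpha>\<in>multi_indices. mdegree \<alpha> = l}. c \<alpha> real_analytic_on U) \<and>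
          (\<forall>p\<in>U. \<forall>\<zeta>. g p \<zeta> = (\<Sum>\<alpha>\<in>{\<alpha>\<in>multi_indices. mdegree \<alpha> = l}. c \<alpha> p * monomial \<alpha> \<zeta>)))"

section \<open>Differential operators\<close>

text \<open>
  The derivatives below are total functions with unspecified values where the derivative does
  not exist; they are only applied to functions that are analytic near the point considered.
\<close>

definition partial_x :: "'n::finite \<Rightarrow> (real ^ 'n \<Rightarrow> real) \<Rightarrow> real ^ 'n \<Rightarrow> real" where
  "partial_x i g x = deriv (\<lambda>s. g (x + s *\<^sub>R axis i 1)) 0"

definition grad :: "(real ^ 'n \<Rightarrow> real) \<Rightarrow> real ^ 'n \<Rightarrow> real ^ 'n::finite" where
  "grad g x = (\<chi> i. partial_x i g x)"

definition laplacian :: "(real ^ 'n::finite \<Rightarrow> real) \<Rightarrow> real ^ 'n \<Rightarrow> real" where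
  "laplacian g x = (\<Sum>i\<in>UNIV. partial_x i (partial_x i g) x)"

definition partial_t :: "(real \<times> 'a \<Rightarrow> real) \<Rightarrow> real \<times> 'a \<Rightarrow> real" where
  "partial_t u p = deriv (\<lambda>s. u (s, snd p)) (fst p)"

definition solves_wave_at ::
    "(real \<times> (real ^ 'n) \<Rightarrow> real \<times> (real ^ 'n) \<Rightarrow> real) \<Rightarrow> (real \<times> (real ^ 'n::finite) \<Rightarrow> real)
      \<Rightarrow> real \<Rightarrow> real ^ 'n \<Rightarrow> bool" where
  "solves_wave_at f u t x \<longleftrightarrow>
     partial_t (partial_t u) (t, x) - laplacian (\<lambda>y. u (t, y)) x
       = f (t, x) (partial_t u (t, x), grad (\<lambda>y. u (t, y)) x)"

section \<open>The hypersurface and the singular solutions\<close>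

text \<open>
  \<open>D\<close> is the domain of \<open>\<psi>\<close>; points of \<open>U\<close> not lying over \<open>D\<close> are irrelevant.
\<close>

definition hypersurface ::
    "(real \<times> 'a) set \<Rightarrow> 'a set \<Rightarrow> ('a \<Rightarrow> real) \<Rightarrow> (real \<times> 'a) set" where
  "hypersurface U D \<psi> = {(t, x). (t, x) \<in> U \<and> x \<in> D \<and> t = \<psi> x}"

text \<open>
  Analyticity of a function on the hypersurface, seen as an analytic manifold with the global
  chart \<open>(t, x) \<mapsto> x\<close>.
\<close>

definition analytic_on_hypersurface ::
    "(real \<times> 'a::euclidean_space) set \<Rightarrow> 'a set \<Rightarrow> ('a \<Rightarrow> real) \<Rightarrow> (real \<times> 'a \<Rightarrow> real) \<Rightarrow> bool" where
  "analytic_on_hypersurface U D \<psi> w \<longleftrightarrow>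
     (\<lambda>x. w (\<psi> x, x)) real_analytic_on {x\<in>D. (\<psi> x, x) \<in> U}"

definition regular_part ::
    "(real \<times> (real ^ 'n)) set \<Rightarrow> (real ^ 'n) set \<Rightarrow> (real \<times> (real ^ 'n) \<Rightarrow> real \<times> (real ^ 'n) \<Rightarrow> real)
      \<Rightarrow> (real ^ 'n \<Rightarrow> real) \<Rightarrow> real \<Rightarrow> (real \<times> (real ^ 'n::finite) \<Rightarrow> real)
      \<Rightarrow> (real \<times> (real ^ 'n)) set \<Rightarrow> (real \<times> (real ^ 'n) \<Rightarrow> real) \<Rightarrow> bool" where
  "regular_part U D f \<psi> a v0 \<Omega> v \<longleftrightarrow>
     open \<Omega> \<and> hypersurface U D \<psi> \<subseteq> \<Omega> \<and> \<Omega> \<subseteq> U \<inter> (UNIV \<times> D) \<and>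
     v real_analytic_on \<Omega> \<and>
     (\<forall>(t, x)\<in>\<Omega>. t > \<psi> x \<longrightarrow>
        solves_wave_at f (\<lambda>(t, x). - a * ln (t - \<psi> x) + v (t, x)) t x) \<and>
     (\<forall>p\<in>hypersurface U D \<psi>. v p = v0 p)"

end

theory Submission
  imports Defs "HOL-Library.Function_Algebras"
begin

text \<open>
  Put \<open>s = t - \<psi>(x)\<close>, \<open>w(s, x) = v(s + \<psi>(x), x)\<close> and \<open>q = 1 - |\<nabla>\<psi>|\<^sup>2\<close>. The gradient of
  \<open>u = - a log s + w\<close> is \<open>(a/s) (-1, \<nabla>\<psi>)\<close> plus a term linear in the derivatives of \<open>w\<close>, so both
  sides of the wave equation have a pole of order 2 at \<open>s = 0\<close>. The coefficients of \<open>1/s\<^sup>2\<close> are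
  \<open>a q\<close> and \<open>a\<^sup>2 f2(-1, \<nabla>\<psi>)\<close>, and the hypothesis on \<open>\<psi>\<close> says that they agree on the hypersurface.
  Polarising \<open>f2\<close>, the same hypothesis turns the singular cross term into \<open>-2 q w\<^sub>s / s\<close> up to
  regular terms and terms with \<open>x\<close>-derivatives only.
  After multiplication by \<open>s/q\<close> the equation therefore reads
  \<open>s w\<^sub>s\<^sub>s + 2 w\<^sub>s = \<Psi>(w)\<close>, where \<open>\<Psi>\<close> is a polynomial of degree 2 in the derivatives of \<open>w\<close>
  with analytic coefficients, and every term that contains \<open>w\<close> either has a factor \<open>s\<close> or is
  linear in the first derivatives with respect to \<open>x\<close>
  (lemma \<open>solves_wave_at_iff_fuchs\<close>).

  On the left the coefficient of \<open>s\<^sup>k\<close> in \<open>w\<close> is multiplied by \<open>k (k + 1)\<close>, which vanishes for no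
  \<open>k \<ge> 1\<close>. Hence \<open>w = w(0, \<cdot>) + J z\<close> where \<open>z = s w\<^sub>s\<^sub>s + 2 w\<^sub>s\<close> and \<open>J\<close> raises the
  degree in \<open>s\<close> by one and divides the resulting coefficient of \<open>s\<^sup>k\<close> by \<open>k (k + 1)\<close>, and the problem with \<open>w(0, \<cdot>) = v0\<close> prescribed is the fixed point equation
  \<open>z = \<Psi>(v0 + J z)\<close>.

  It is solved by contraction in a weighted \<open>l\<^sup>1\<close> space of Taylor coefficients, with the weight
  \<open>\<tau>\<^sup>k \<rho>\<^sup>m / binom(k + m, k)\<close> on a monomial of degree \<open>k\<close> in \<open>s\<close> and total degree \<open>m\<close> in \<open>x\<close>. This norm is
  submultiplicative by Vandermonde's identity, and it is squeezed between two geometric weights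
  because the binomial coefficient is at most \<open>2\<^sup>k\<^sup>+\<^sup>m\<close>, so finite norm still means convergence on
  a box. Its virtue is that an integration in \<open>s\<close> followed by a derivative in \<open>x\<close> has norm at most \<open>\<tau>/\<rho>\<close>
  (lemma \<open>wbound_trade\<close>): in this norm nothing is lost by the \<open>x\<close>-derivatives in \<open>\<Psi>\<close>, and for
  \<open>\<tau>\<close> small \<open>z \<mapsto> \<Psi>(v0 + J z)\<close> has a Lipschitz constant below 1 on any given ball. The same
  estimate yields existence (\<open>fuchs_existence\<close>) and uniqueness (\<open>fuchs_uniqueness\<close>) near each point of the
  hypersurface. Local solutions over small balls agree on overlaps by the identity theorem,
  because in the coordinates \<open>(s, x)\<close> the overlaps are convex and meet \<open>s = 0\<close>; hence they glue
  (\<open>tube_overlap\<close>, \<open>global_existence\<close>).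
\<close>

section \<open>Multi-indices\<close>

abbreviation MI :: "('a::euclidean_space \<Rightarrow> nat) set" where
  "MI \<equiv> multi_indices"

definition unit_index :: "'a \<Rightarrow> 'a \<Rightarrow> nat" where
  "unit_index b = (\<lambda>x. if x = b then 1 else 0)"

lemma unit_index_simps [simp]: "unit_index b b = 1" "x \<noteq> b \<Longrightarrow> unit_index b x = 0"
  by (auto simp: unit_index_def)

lemma zero_in_MI [simp]: "0 \<in> MI"
  by (auto simp: multi_indices_def)

lemma unit_index_in_MI [simp]: "b \<in> Basis \<Longrightarrow> unit_index b \<in> MI"
  by (auto simp: multi_indices_def unit_index_def)

lemma add_in_MI_iff [simp]: "\<alpha> + \<beta> \<in> MI \<longleftrightarrow> \<alpha> \<in> MI \<and> \<beta> \<in> MI"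
  by (auto simp: multi_indices_def)

lemma diff_in_MI [simp]: "\<alpha> \<in> MI \<Longrightarrow> \<alpha> - \<beta> \<in> MI"
  by (auto simp: multi_indices_def)

lemma mdegree_zero [simp]: "mdegree 0 = 0"
  by (simp add: mdegree_def)

lemma mdegree_add: "mdegree (\<alpha> + \<beta>) = mdegree \<alpha> + mdegree \<beta>"
  by (simp add: mdegree_def sum.distrib)

lemma mdegree_unit_index [simp]: "b \<in> Basis \<Longrightarrow> mdegree (unit_index b) = 1"
  by (simp add: mdegree_def unit_index_def)

lemma le_mdegree: "b \<in> Basis \<Longrightarrow> \<alpha> b \<le> mdegree \<alpha>"
  unfolding mdegree_def by (rule member_le_sum) auto

lemma mdegree_eq_0_iff: "\<alpha> \<in> MI \<Longrightarrow> mdegree \<alpha> = 0 \<longleftrightarrow> \<alpha> = 0"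
  by (auto simp: mdegree_def multi_indices_def fun_eq_iff)

lemma monomial_zero [simp]: "monomial 0 h = 1"
  by (simp add: monomial_def)

lemma monomial_add: "monomial (\<alpha> + \<beta>) h = monomial \<alpha> h * monomial \<beta> h"
  by (simp add: monomial_def power_add prod.distrib)

lemma monomial_unit_index [simp]: 
  assumes "b \<in> Basis" shows "monomial (unit_index b) h = h \<bullet> b"
proof -
  have "monomial (unit_index b) h = (\<Prod>x\<in>Basis. if x = b then h \<bullet> b else 1)"
    unfolding monomial_def unit_index_def by (intro prod.cong) auto
  then show ?thesis using assms by simp
qed

lemma index_eq_add_unit:
  assumes "\<alpha> b > 0" shows "\<alpha> = (\<alpha> - unit_index b) + unit_index b"
  using assms by (auto simp: fun_eq_iff unit_index_def)

lemma index_degree_SucE: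
  assumes "mdegree \<alpha> = Suc n"
  obtains b \<beta> where "b \<in> Basis" "\<alpha> = \<beta> + unit_index b" "mdegree \<beta> = n"
proof -
  have "\<exists>b\<in>Basis. \<alpha> b \<noteq> 0" using assms unfolding mdegree_def by (metis nat.distinct(1) sum.neutral)
  then obtain b where b: "b \<in> Basis" "\<alpha> b > 0" by blast
  have eq: "\<alpha> = (\<alpha> - unit_index b) + unit_index b" by (rule index_eq_add_unit[where \<alpha> = \<alpha>, OF b(2)])
  then have "mdegree \<alpha> = mdegree (\<alpha> - unit_index b) + 1" using b(1) by (metis mdegree_add mdegree_unit_index)
  then show ?thesis using that[OF b(1) eq] assms by simp
qed

lemma finite_atMost_MI: 
  assumes "\<gamma> \<in> MI" shows "finite {..\<gamma>}"
proof (rule finite_subset)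
  show "{..\<gamma>} \<subseteq> {f. \<forall>x. (x \<in> Basis \<longrightarrow> f x \<in> {..mdegree \<gamma>}) \<and> (x \<notin> Basis \<longrightarrow> f x = 0)}"
  proof (intro subsetI CollectI allI conjI impI)
    fix f :: "'a \<Rightarrow> nat" and x assume f: "f \<in> {..\<gamma>}"
    show "f x \<in> {..mdegree \<gamma>}" if "x \<in> Basis"
      using f le_mdegree[OF that, of \<gamma>] by (auto simp: le_fun_def intro: order_trans)
    show "f x = 0" if "x \<notin> Basis"
      using f assms that by (auto simp: le_fun_def multi_indices_def) (metis le_zero_eq)
  qed
  show "finite {f :: 'a \<Rightarrow> nat. \<forall>x. (x \<in> Basis \<longrightarrow> f x \<in> {..mdegree \<gamma>}) \<and> (x \<notin> Basis \<longrightarrow> f x = 0)}"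
    by (rule finite_set_of_finite_funs) auto
qed

lemma finite_MI_mdegree: "finite {\<alpha> \<in> MI. mdegree \<alpha> = n}"
proof (rule finite_subset)
  show "{\<alpha> \<in> MI. mdegree \<alpha> = n} \<subseteq> {f. \<forall>x. (x \<in> Basis \<longrightarrow> f x \<in> {..n}) \<and> (x \<notin> Basis \<longrightarrow> f x = 0)}"
    using le_mdegree by (auto simp: multi_indices_def)
  show "finite {f :: 'a \<Rightarrow> nat. \<forall>x. (x \<in> Basis \<longrightarrow> f x \<in> {..n}) \<and> (x \<notin> Basis \<longrightarrow> f x = 0)}"
    by (rule finite_set_of_finite_funs) auto
qed

lemma atMost_MI: "\<gamma> \<in> MI \<Longrightarrow> \<alpha> \<in> {..\<gamma>} \<Longrightarrow> \<alpha> \<in> MI"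
  by (auto simp: multi_indices_def le_fun_def) (metis le_zero_eq)

lemma le_index_add_diff: "(\<alpha>::'a \<Rightarrow> nat) \<le> \<gamma> \<Longrightarrow> \<alpha> + (\<gamma> - \<alpha>) = \<gamma>"
  by (auto simp: fun_eq_iff le_fun_def)

section \<open>Weighted absolutely summable coefficient families\<close>

text \<open>
  The weighted \<open>l\<^sup>1\<close> norm of \<open>c\<close> is at most \<open>M\<close>. Only values at multi-indices matter; finite partial
  sums avoid any summability side condition.
\<close>

definition wbound :: "(('a::euclidean_space \<Rightarrow> nat) \<Rightarrow> real) \<Rightarrow> (('a \<Rightarrow> nat) \<Rightarrow> real) \<Rightarrow> real \<Rightarrow> bool" where
  "wbound wt c M \<longleftrightarrow> (\<forall>F. finite F \<longrightarrow> F \<subseteq> MI \<longrightarrow> (\<Sum>\<alpha>\<in>F. \<bar>c \<alpha>\<bar> * wt \<alpha>) \<le> M)"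

text \<open>
  The Cauchy product. At a \<open>\<gamma>\<close> that is not a multi-index the range of summation may be infinite
  and the value is then \<open>0\<close>, so that bilinearity holds at every \<open>\<gamma>\<close>.
\<close>

definition conv :: "(('a \<Rightarrow> nat) \<Rightarrow> real) \<Rightarrow> (('a \<Rightarrow> nat) \<Rightarrow> real) \<Rightarrow> ('a \<Rightarrow> nat) \<Rightarrow> real" where
  "conv c d \<gamma> = (\<Sum>\<alpha>\<in>{..\<gamma>}. c \<alpha> * d (\<gamma> - \<alpha>))"

lemma conv_diff_left: "conv (c - c') d = conv c d - conv c' d"
  by (auto simp: conv_def fun_eq_iff left_diff_distrib sum_subtractf)

lemma conv_diff_right: "conv c (d - d') = conv c d - conv c d'"
  by (auto simp: conv_def fun_eq_iff right_diff_distrib sum_subtractf)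

lemma wboundD: "wbound wt c M \<Longrightarrow> finite F \<Longrightarrow> F \<subseteq> MI \<Longrightarrow> (\<Sum>\<alpha>\<in>F. \<bar>c \<alpha>\<bar> * wt \<alpha>) \<le> M"
  by (auto simp: wbound_def)

lemma wbound_nonneg: "wbound wt c M \<Longrightarrow> 0 \<le> M"
  using wboundD[of wt c M "{}"] by simp

lemma wbound_mono: "wbound wt c M \<Longrightarrow> M \<le> N \<Longrightarrow> wbound wt c N"
  by (auto simp: wbound_def intro: order_trans)

lemma wbound_term: "wbound wt c M \<Longrightarrow> \<alpha> \<in> MI \<Longrightarrow> \<bar>c \<alpha>\<bar> * wt \<alpha> \<le> M"
  using wboundD[of wt c M "{\<alpha>}"] by simp

lemma wbound_weight_mono:
  assumes "wbound wt c M" "\<And>\<alpha>. \<alpha> \<in> MI \<Longrightarrow> wt' \<alpha> \<le> wt \<alpha>"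
  shows "wbound wt' c M"
  unfolding wbound_def
proof (intro allI impI)
  fix F :: "('a \<Rightarrow> nat) set" assume F: "finite F" "F \<subseteq> MI"
  have "(\<Sum>\<alpha>\<in>F. \<bar>c \<alpha>\<bar> * wt' \<alpha>) \<le> (\<Sum>\<alpha>\<in>F. \<bar>c \<alpha>\<bar> * wt \<alpha>)"
    using F assms(2) by (intro sum_mono mult_left_mono) auto
  with wboundD[OF assms(1) F] show "(\<Sum>\<alpha>\<in>F. \<bar>c \<alpha>\<bar> * wt' \<alpha>) \<le> M" by simp
qed

lemma wbound_cong: "wbound wt c M \<Longrightarrow> (\<And>\<alpha>. \<alpha> \<in> MI \<Longrightarrow> c' \<alpha> = c \<alpha>) \<Longrightarrow> wbound wt c' M"
  unfolding wbound_def by (auto simp: subset_iff cong: sum.cong)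

lemma wbound_dominated:
  assumes "wbound wt d M" "\<And>\<alpha>. \<alpha> \<in> MI \<Longrightarrow> \<bar>c \<alpha>\<bar> \<le> \<bar>d \<alpha>\<bar>" "\<And>\<alpha>. \<alpha> \<in> MI \<Longrightarrow> 0 \<le> wt \<alpha>"
  shows "wbound wt c M"
  unfolding wbound_def
proof (intro allI impI)
  fix F :: "('a \<Rightarrow> nat) set" assume F: "finite F" "F \<subseteq> MI"
  have "(\<Sum>\<alpha>\<in>F. \<bar>c \<alpha>\<bar> * wt \<alpha>) \<le> (\<Sum>\<alpha>\<in>F. \<bar>d \<alpha>\<bar> * wt \<alpha>)"
    using F assms(2,3) by (intro sum_mono mult_right_mono) auto
  with wboundD[OF assms(1) F] show "(\<Sum>\<alpha>\<in>F. \<bar>c \<alpha>\<bar> * wt \<alpha>) \<le> M" by simp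
qed

lemma wbound_zero [simp]: "wbound wt 0 0"
  by (simp add: wbound_def)

lemma wbound_add:
  assumes "wbound wt c M" "wbound wt d N" "\<And>\<alpha>. \<alpha> \<in> MI \<Longrightarrow> 0 \<le> wt \<alpha>"
  shows "wbound wt (c + d) (M + N)"
  unfolding wbound_def
proof (intro allI impI)
  fix F :: "('a \<Rightarrow> nat) set" assume F: "finite F" "F \<subseteq> MI"
  have "(\<Sum>\<alpha>\<in>F. \<bar>(c + d) \<alpha>\<bar> * wt \<alpha>) \<le> (\<Sum>\<alpha>\<in>F. \<bar>c \<alpha>\<bar> * wt \<alpha> + \<bar>d \<alpha>\<bar> * wt \<alpha>)"
  proof (rule sum_mono)
    fix \<alpha> assume "\<alpha> \<in> F"
    then have "\<bar>c \<alpha> + d \<alpha>\<bar> * wt \<alpha> \<le> (\<bar>c \<alpha>\<bar> + \<bar>d \<alpha>\<bar>) * wt \<alpha>"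
      using F assms(3) by (intro mult_right_mono) auto
    then show "\<bar>(c + d) \<alpha>\<bar> * wt \<alpha> \<le> \<bar>c \<alpha>\<bar> * wt \<alpha> + \<bar>d \<alpha>\<bar> * wt \<alpha>"
      by (simp add: distrib_right)
  qed
  then show "(\<Sum>\<alpha>\<in>F. \<bar>(c + d) \<alpha>\<bar> * wt \<alpha>) \<le> M + N"
    using wboundD[OF assms(1) F] wboundD[OF assms(2) F] by (simp add: sum.distrib)
qed

lemma wbound_uminus: "wbound wt c M \<Longrightarrow> wbound wt (- c) M"
  by (simp add: wbound_def)

lemma wbound_diff:
  assumes "wbound wt c M" "wbound wt d N" "\<And>\<alpha>. \<alpha> \<in> MI \<Longrightarrow> 0 \<le> wt \<alpha>"
  shows "wbound wt (c - d) (M + N)"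
  using wbound_add[OF assms(1) wbound_uminus[OF assms(2)] assms(3)] by simp

lemma wbound_zero_imp:
  assumes "wbound wt c 0" "\<alpha> \<in> MI" "wt \<alpha> > 0" shows "c \<alpha> = 0"
  using wbound_term[OF assms(1,2)] assms(3) by (simp add: mult_le_0_iff)

lemma wbound_scale:
  assumes "wbound wt c M" shows "wbound wt (\<lambda>\<alpha>. k * c \<alpha>) (\<bar>k\<bar> * M)"
  unfolding wbound_def
proof (intro allI impI)
  fix F :: "('a \<Rightarrow> nat) set" assume F: "finite F" "F \<subseteq> MI"
  have "(\<Sum>\<alpha>\<in>F. \<bar>k * c \<alpha>\<bar> * wt \<alpha>) = \<bar>k\<bar> * (\<Sum>\<alpha>\<in>F. \<bar>c \<alpha>\<bar> * wt \<alpha>)"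
    by (simp add: abs_mult sum_distrib_left mult.assoc)
  also have "\<dots> \<le> \<bar>k\<bar> * M" using wboundD[OF assms F] by (intro mult_left_mono) auto
  finally show "(\<Sum>\<alpha>\<in>F. \<bar>k * c \<alpha>\<bar> * wt \<alpha>) \<le> \<bar>k\<bar> * M" .
qed

text \<open>
  Differentiation, multiplication by a coordinate and integration all send the coefficient at
  \<open>\<sigma> \<alpha>\<close> to a multiple of itself at \<open>\<alpha>\<close>. Their boundedness is a comparison of weights.
\<close>

lemma wbound_reindex:
  fixes g :: "('a::euclidean_space \<Rightarrow> nat) \<Rightarrow> real" and \<sigma> :: "('a \<Rightarrow> nat) \<Rightarrow> 'a \<Rightarrow> nat"
  assumes c: "wbound wt c M" and C: "0 \<le> C" and wt': "\<And>\<alpha>. \<alpha> \<in> MI \<Longrightarrow> 0 \<le> wt \<alpha>"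
    and \<sigma>: "\<And>\<alpha>. \<alpha> \<in> MI \<Longrightarrow> g \<alpha> \<noteq> 0 \<Longrightarrow> \<sigma> \<alpha> \<in> MI \<and> \<bar>g \<alpha>\<bar> * wt' \<alpha> \<le> C * wt (\<sigma> \<alpha>)"
    and inj: "inj_on \<sigma> {\<alpha> \<in> MI. g \<alpha> \<noteq> 0}"
  shows "wbound wt' (\<lambda>\<alpha>. g \<alpha> * c (\<sigma> \<alpha>)) (C * M)"
  unfolding wbound_def
proof (intro allI impI)
  fix F :: "('a \<Rightarrow> nat) set" assume F: "finite F" "F \<subseteq> MI"
  let ?G = "{\<alpha> \<in> F. g \<alpha> \<noteq> 0}"
  have G: "finite ?G" "\<sigma> ` ?G \<subseteq> MI" "inj_on \<sigma> ?G"
    using F \<sigma> by (auto intro: inj_on_subset[OF inj])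
  have "(\<Sum>\<alpha>\<in>F. \<bar>g \<alpha> * c (\<sigma> \<alpha>)\<bar> * wt' \<alpha>) = (\<Sum>\<alpha>\<in>?G. \<bar>g \<alpha> * c (\<sigma> \<alpha>)\<bar> * wt' \<alpha>)"
    using F by (intro sum.mono_neutral_right) auto
  also have "\<dots> \<le> (\<Sum>\<alpha>\<in>?G. C * (\<bar>c (\<sigma> \<alpha>)\<bar> * wt (\<sigma> \<alpha>)))"
  proof (rule sum_mono)
    fix \<alpha> assume "\<alpha> \<in> ?G"
    then have "\<bar>g \<alpha>\<bar> * wt' \<alpha> * \<bar>c (\<sigma> \<alpha>)\<bar> \<le> C * wt (\<sigma> \<alpha>) * \<bar>c (\<sigma> \<alpha>)\<bar>"
      using F \<sigma> by (intro mult_right_mono) auto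
    then show "\<bar>g \<alpha> * c (\<sigma> \<alpha>)\<bar> * wt' \<alpha> \<le> C * (\<bar>c (\<sigma> \<alpha>)\<bar> * wt (\<sigma> \<alpha>))"
      by (simp add: abs_mult mult_ac)
  qed
  also have "\<dots> = C * (\<Sum>\<alpha>\<in>\<sigma> ` ?G. \<bar>c \<alpha>\<bar> * wt \<alpha>)"
    using G(3) by (simp add: sum.reindex sum_distrib_left)
  also have "\<dots> \<le> C * M" using wboundD[OF c _ G(2)] G(1) C by (intro mult_left_mono) auto
  finally show "(\<Sum>\<alpha>\<in>F. \<bar>g \<alpha> * c (\<sigma> \<alpha>)\<bar> * wt' \<alpha>) \<le> C * M" .
qed

text \<open>
  Pairs \<open>(\<gamma>, \<alpha>)\<close> with \<open>\<alpha> \<le> \<gamma>\<close> are sent injectively to \<open>(\<alpha>, \<gamma> - \<alpha>)\<close>, so a partial sum of the norm of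
  the product is part of a product of two partial sums.
\<close>

lemma wbound_conv:
  assumes c: "wbound wt c M" and d: "wbound wt d N" and pos: "\<And>\<alpha>. \<alpha> \<in> MI \<Longrightarrow> 0 \<le> wt \<alpha>"
    and sub: "\<And>\<alpha> \<beta>. \<alpha> \<in> MI \<Longrightarrow> \<beta> \<in> MI \<Longrightarrow> wt (\<alpha> + \<beta>) \<le> wt \<alpha> * wt \<beta>"
  shows "wbound wt (conv c d) (M * N)"
  unfolding wbound_def
proof (intro allI impI)
  fix F :: "('a \<Rightarrow> nat) set" assume F: "finite F" "F \<subseteq> MI"
  define S where "S = Sigma F (\<lambda>\<gamma>. {..\<gamma>})"
  define A where "A = fst ` (\<lambda>(\<gamma>, \<alpha>). (\<alpha>, \<gamma> - \<alpha>)) ` S"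
  define B where "B = snd ` (\<lambda>(\<gamma>, \<alpha>). (\<alpha>, \<gamma> - \<alpha>)) ` S"
  let ?f = "\<lambda>(\<alpha>, \<beta>). (\<bar>c \<alpha>\<bar> * wt \<alpha>) * (\<bar>d \<beta>\<bar> * wt \<beta>)"
  have S: "finite S" unfolding S_def using F finite_atMost_MI by (intro finite_SigmaI) auto
  have AB: "finite A" "finite B" "A \<subseteq> MI" "B \<subseteq> MI" 
    using S F by (auto simp: A_def B_def S_def) (metis atMost_MI atMost_iff subsetD)
  have inj: "inj_on (\<lambda>(\<gamma>, \<alpha>). (\<alpha>, \<gamma> - \<alpha>)) S"
    unfolding inj_on_def S_def by clarsimp (metis le_index_add_diff)
  have "(\<Sum>\<gamma>\<in>F. \<bar>conv c d \<gamma>\<bar> * wt \<gamma>) \<le> (\<Sum>\<gamma>\<in>F. \<Sum>\<alpha>\<in>{..\<gamma>}. ?f (\<alpha>, \<gamma> - \<alpha>))"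
  proof (rule sum_mono)
    fix \<gamma> assume \<gamma>: "\<gamma> \<in> F"
    have "\<bar>conv c d \<gamma>\<bar> * wt \<gamma> \<le> (\<Sum>\<alpha>\<in>{..\<gamma>}. \<bar>c \<alpha> * d (\<gamma> - \<alpha>)\<bar>) * wt \<gamma>"
      unfolding conv_def using \<gamma> F pos by (intro mult_right_mono sum_abs) auto
    also have "\<dots> = (\<Sum>\<alpha>\<in>{..\<gamma>}. (\<bar>c \<alpha>\<bar> * \<bar>d (\<gamma> - \<alpha>)\<bar>) * wt \<gamma>)"
      by (simp add: sum_distrib_right abs_mult)
    also have "\<dots> \<le> (\<Sum>\<alpha>\<in>{..\<gamma>}. (\<bar>c \<alpha>\<bar> * \<bar>d (\<gamma> - \<alpha>)\<bar>) * (wt \<alpha> * wt (\<gamma> - \<alpha>)))"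
    proof (intro sum_mono mult_left_mono)
      fix \<alpha> assume "\<alpha> \<in> {..\<gamma>}"
      then show "wt \<gamma> \<le> wt \<alpha> * wt (\<gamma> - \<alpha>)"
        using sub[of \<alpha> "\<gamma> - \<alpha>"] le_index_add_diff[of \<alpha> \<gamma>] atMost_MI[of \<gamma> \<alpha>] \<gamma> F by auto
    qed auto
    finally show "\<bar>conv c d \<gamma>\<bar> * wt \<gamma> \<le> (\<Sum>\<alpha>\<in>{..\<gamma>}. ?f (\<alpha>, \<gamma> - \<alpha>))"
      by (simp add: mult_ac)
  qed
  also have "\<dots> = sum ?f ((\<lambda>(\<gamma>, \<alpha>). (\<alpha>, \<gamma> - \<alpha>)) ` S)"
  proof -
    have "(\<Sum>\<gamma>\<in>F. \<Sum>\<alpha>\<in>{..\<gamma>}. ?f (\<alpha>, \<gamma> - \<alpha>)) = (\<Sum>(\<gamma>, \<alpha>)\<in>S. ?f (\<alpha>, \<gamma> - \<alpha>))"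
      unfolding S_def using F finite_atMost_MI by (subst sum.Sigma) auto
    also have "\<dots> = sum ?f ((\<lambda>(\<gamma>, \<alpha>). (\<alpha>, \<gamma> - \<alpha>)) ` S)"
      by (subst sum.reindex[OF inj]) (auto intro!: sum.cong)
    finally show ?thesis .
  qed
  also have "\<dots> \<le> sum ?f (A \<times> B)"
  proof (rule sum_mono2)
    show "(\<lambda>(\<gamma>, \<alpha>). (\<alpha>, \<gamma> - \<alpha>)) ` S \<subseteq> A \<times> B"
      unfolding A_def B_def by (rule subset_fst_snd)
    show "0 \<le> ?f p" if "p \<in> A \<times> B - (\<lambda>(\<gamma>, \<alpha>). (\<alpha>, \<gamma> - \<alpha>)) ` S" for p
      using that AB pos by (auto intro!: mult_nonneg_nonneg)
  qed (use AB in auto)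
  also have "\<dots> = (\<Sum>\<alpha>\<in>A. \<bar>c \<alpha>\<bar> * wt \<alpha>) * (\<Sum>\<beta>\<in>B. \<bar>d \<beta>\<bar> * wt \<beta>)"
    by (simp add: sum_product sum.cartesian_product)
  also have "\<dots> \<le> M * N"
    using wboundD[OF c AB(1,3)] wboundD[OF d AB(2,4)] AB pos wbound_nonneg[OF c]
    by (intro mult_mono) (auto intro!: sum_nonneg mult_nonneg_nonneg)
  finally show "(\<Sum>\<alpha>\<in>F. \<bar>conv c d \<alpha>\<bar> * wt \<alpha>) \<le> M * N" .
qed

section \<open>Convergent power series on a box\<close>

abbreviation pw :: "real \<Rightarrow> ('a::euclidean_space \<Rightarrow> nat) \<Rightarrow> real" where
  "pw r \<equiv> (\<lambda>\<alpha>. r ^ mdegree \<alpha>)"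

definition inbox :: "real \<Rightarrow> 'a::euclidean_space \<Rightarrow> bool" where
  "inbox r h \<longleftrightarrow> (\<forall>b\<in>Basis. \<bar>h \<bullet> b\<bar> \<le> r)"

definition psum :: "(('a::euclidean_space \<Rightarrow> nat) \<Rightarrow> real) \<Rightarrow> 'a \<Rightarrow> real" where
  "psum c h = (\<Sum>\<^sub>\<infinity>\<alpha>\<in>MI. c \<alpha> * monomial \<alpha> h)"

lemma abs_monomial_le: "inbox r h \<Longrightarrow> \<bar>monomial \<alpha> h\<bar> \<le> r ^ mdegree \<alpha>"
  unfolding monomial_def mdegree_def inbox_def
  by (auto simp: abs_prod power_abs power_sum intro!: prod_mono power_mono)

lemma wbound_summable:
  assumes "wbound wt c M" "\<And>\<alpha>. \<alpha> \<in> MI \<Longrightarrow> 0 \<le> wt \<alpha>"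
  shows "(\<lambda>\<alpha>. \<bar>c \<alpha>\<bar> * wt \<alpha>) summable_on MI"
  using assms by (intro nonneg_bdd_above_summable_on) (auto simp: wbound_def bdd_above_def)

lemma summable_wbound:
  assumes "(\<lambda>\<alpha>. \<bar>c \<alpha>\<bar> * wt \<alpha>) summable_on MI" "\<And>\<alpha>. \<alpha> \<in> MI \<Longrightarrow> 0 \<le> wt \<alpha>"
  shows "wbound wt c (\<Sum>\<^sub>\<infinity>\<alpha>\<in>MI. \<bar>c \<alpha>\<bar> * wt \<alpha>)"
  unfolding wbound_def using assms by (auto intro!: finite_sum_le_infsum)

lemma psum_abs_summable:
  assumes "wbound (pw r) c M" "inbox r h" "0 \<le> r"
  shows "(\<lambda>\<alpha>. \<bar>c \<alpha> * monomial \<alpha> h\<bar>) summable_on MI"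
proof -
  have "(\<lambda>\<alpha>. norm (c \<alpha> * monomial \<alpha> h)) summable_on MI"
    by (rule Infinite_Sum.abs_summable_on_comparison_test'[where g = "\<lambda>\<alpha>. \<bar>c \<alpha>\<bar> * r ^ mdegree \<alpha>"])
       (use wbound_summable[OF assms(1)] assms(3) abs_monomial_le[OF assms(2)] 
         in \<open>auto simp: abs_mult intro!: mult_left_mono\<close>)
  then show ?thesis by simp
qed

lemma psum_summable:
  assumes "wbound (pw r) c M" "inbox r h" "0 \<le> r"
  shows "(\<lambda>\<alpha>. c \<alpha> * monomial \<alpha> h) summable_on MI"
  using psum_abs_summable[OF assms] summable_on_iff_abs_summable_on_real by fastforce

lemma psum_has_sum:
  assumes "wbound (pw r) c M" "inbox r h" "0 \<le> r"
  shows "((\<lambda>\<alpha>. c \<alpha> * monomial \<alpha> h) has_sum psum c h) MI"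
  unfolding psum_def using psum_summable[OF assms] by simp

lemma psum_cong: "(\<And>\<alpha>. \<alpha> \<in> MI \<Longrightarrow> c \<alpha> = d \<alpha>) \<Longrightarrow> psum c h = psum d h"
  unfolding psum_def by (intro infsum_cong) auto

lemma psum_add:
  assumes "wbound (pw r) c M" "wbound (pw r) d N" "inbox r h" "0 \<le> r"
  shows "psum (c + d) h = psum c h + psum d h"
  unfolding psum_def using psum_summable[OF assms(1,3,4)] psum_summable[OF assms(2,3,4)]
  by (simp add: distrib_right infsum_add)

lemma psum_scale: "psum (\<lambda>\<alpha>. k * c \<alpha>) h = k * psum c h"
  unfolding psum_def by (simp add: mult.assoc infsum_cmult_right')

lemma psum_uminus: "psum (- c) h = - psum c h"
  using psum_scale[of "-1" c h] by (simp add: fun_Compl_def)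

lemma pw_sub: "pw r (\<alpha> + \<beta>) \<le> pw r \<alpha> * pw r \<beta>"
  by (simp add: mdegree_add power_add)

lemma abs_psum_le:
  assumes "wbound (pw r) c M" "inbox r h" "0 \<le> r"
  shows "\<bar>psum c h\<bar> \<le> M"
proof -
  have "norm (psum c h) \<le> (\<Sum>\<^sub>\<infinity>\<alpha>\<in>MI. norm (c \<alpha> * monomial \<alpha> h))"
    unfolding psum_def using psum_abs_summable[OF assms] by (intro norm_infsum_bound) simp
  also have "\<dots> \<le> M"
  proof (rule infsum_le_finite_sums)
    show "(\<lambda>\<alpha>. norm (c \<alpha> * monomial \<alpha> h)) summable_on MI" using psum_abs_summable[OF assms] by simp
    fix F :: "('a \<Rightarrow> nat) set" assume F: "finite F" "F \<subseteq> MI"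
    have "(\<Sum>\<alpha>\<in>F. norm (c \<alpha> * monomial \<alpha> h)) \<le> (\<Sum>\<alpha>\<in>F. \<bar>c \<alpha>\<bar> * r ^ mdegree \<alpha>)"
      using abs_monomial_le[OF assms(2)] by (intro sum_mono) (auto simp: abs_mult intro!: mult_left_mono)
    then show "(\<Sum>\<alpha>\<in>F. norm (c \<alpha> * monomial \<alpha> h)) \<le> M" using wboundD[OF assms(1) F] by simp
  qed
  finally show ?thesis by simp
qed

text \<open>
  Absolute convergence allows the double series to be summed along \<open>\<alpha> + \<beta> = \<gamma>\<close>.
\<close>

lemma psum_conv:
  assumes c: "wbound (pw r) c M" and d: "wbound (pw r) d N" and h: "inbox r h" "0 \<le> r"
  shows "psum (conv c d) h = psum c h * psum d h"
proof -
  let ?u = "\<lambda>\<alpha>. c \<alpha> * monomial \<alpha> h" and ?v = "\<lambda>\<alpha>. d \<alpha> * monomial \<alpha> h"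
  let ?S = "Sigma MI (\<lambda>\<gamma>. {..\<gamma>})"
  have u: "(?u has_sum psum c h) MI" and v: "(?v has_sum psum d h) MI"
    using psum_has_sum[OF c h] psum_has_sum[OF d h] .
  have abs: "(\<lambda>p. norm (case p of (\<alpha>, \<beta>) \<Rightarrow> ?u \<alpha> * ?v \<beta>)) summable_on (MI \<times> MI)"
  proof (subst Infinite_Sum.abs_summable_on_Sigma_iff, intro conjI ballI)
    fix \<alpha> :: "'a \<Rightarrow> nat"
    show "(\<lambda>\<beta>. norm (case (\<alpha>, \<beta>) of (\<alpha>, \<beta>) \<Rightarrow> ?u \<alpha> * ?v \<beta>)) summable_on MI"
      using summable_on_cmult_right[OF psum_abs_summable[OF d h], of "\<bar>?u \<alpha>\<bar>"] by (simp add: abs_mult)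
    have "(\<lambda>\<alpha>. \<bar>?u \<alpha>\<bar> * (\<Sum>\<^sub>\<infinity>\<beta>\<in>MI. \<bar>?v \<beta>\<bar>)) summable_on MI"
      by (rule summable_on_cmult_left[OF psum_abs_summable[OF c h]])
    moreover have "(\<Sum>\<^sub>\<infinity>\<beta>\<in>MI. norm (case (\<alpha>, \<beta>) of (\<alpha>, \<beta>) \<Rightarrow> ?u \<alpha> * ?v \<beta>)) = \<bar>?u \<alpha>\<bar> * (\<Sum>\<^sub>\<infinity>\<beta>\<in>MI. \<bar>?v \<beta>\<bar>)" for \<alpha>
      by (simp add: abs_mult[of "?u \<alpha>"] infsum_cmult_right' del: abs_mult)
    ultimately show "(\<lambda>\<alpha>. norm (\<Sum>\<^sub>\<infinity>\<beta>\<in>MI. norm (case (\<alpha>, \<beta>) of (\<alpha>, \<beta>) \<Rightarrow> ?u \<alpha> * ?v \<beta>))) summable_on MI"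
      using infsum_nonneg[of MI "\<lambda>\<beta>. \<bar>?v \<beta>\<bar>"] by simp
  qed
  have "((\<lambda>(\<alpha>, \<beta>). ?u \<alpha> * ?v \<beta>) has_sum (psum c h * psum d h)) (MI \<times> MI)"
  proof (rule has_sum_SigmaI)
    show "((\<lambda>\<beta>. case (\<alpha>, \<beta>) of (\<alpha>, \<beta>) \<Rightarrow> ?u \<alpha> * ?v \<beta>) has_sum (?u \<alpha> * psum d h)) MI" for \<alpha>
      using has_sum_cmult_right[OF v, of "?u \<alpha>"] by simp
    show "((\<lambda>\<alpha>. ?u \<alpha> * psum d h) has_sum psum c h * psum d h) MI"
      using has_sum_cmult_left[OF u, of "psum d h"] by simp
    show "(\<lambda>(\<alpha>, \<beta>). ?u \<alpha> * ?v \<beta>) summable_on (MI \<times> MI)"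
      using abs summable_on_iff_abs_summable_on_real by blast
  qed
  moreover have "bij_betw (\<lambda>(\<gamma>, \<alpha>). (\<alpha>, \<gamma> - \<alpha>)) ?S (MI \<times> MI)"
    by (rule bij_betw_byWitness[where f' = "\<lambda>(\<alpha>, \<beta>). (\<alpha> + \<beta>, \<alpha>)"])
       (auto simp: le_index_add_diff atMost_MI fun_eq_iff le_fun_def)
  ultimately have "((\<lambda>(\<gamma>, \<alpha>). ?u \<alpha> * ?v (\<gamma> - \<alpha>)) has_sum (psum c h * psum d h)) ?S"
    unfolding case_prod_unfold
    by (subst (asm) has_sum_reindex_bij_betw[symmetric, where A = ?S and g = "\<lambda>p. (snd p, fst p - snd p)"]) simp_all
  then have "((\<lambda>\<gamma>. conv c d \<gamma> * monomial \<gamma> h) has_sum (psum c h * psum d h)) MI"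
  proof (rule has_sum_SigmaD)
    fix \<gamma> :: "'a \<Rightarrow> nat" assume \<gamma>: "\<gamma> \<in> MI"
    have "(\<Sum>\<alpha>\<in>{..\<gamma>}. ?u \<alpha> * ?v (\<gamma> - \<alpha>)) = conv c d \<gamma> * monomial \<gamma> h"
      unfolding conv_def sum_distrib_right
    proof (rule sum.cong)
      fix \<alpha> assume "\<alpha> \<in> {..\<gamma>}"
      then have "monomial \<gamma> h = monomial \<alpha> h * monomial (\<gamma> - \<alpha>) h"
        using le_index_add_diff[of \<alpha> \<gamma>] monomial_add[of \<alpha> "\<gamma> - \<alpha>" h] by auto
      then show "?u \<alpha> * ?v (\<gamma> - \<alpha>) = c \<alpha> * d (\<gamma> - \<alpha>) * monomial \<gamma> h" by simp
    qed auto
    then show "((\<lambda>\<alpha>. case (\<gamma>, \<alpha>) of (\<gamma>, \<alpha>) \<Rightarrow> ?u \<alpha> * ?v (\<gamma> - \<alpha>)) has_sum (conv c d \<gamma> * monomial \<gamma> h)) {..\<gamma>}"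
      using finite_atMost_MI[OF \<gamma>] by (intro has_sum_finiteI) auto
  qed
  then show ?thesis unfolding psum_def using infsumI by blast
qed

section \<open>Termwise differentiation\<close>

text \<open>
  Coefficients of the derivative of a power series in the basis direction \<open>b\<close>.
\<close>

definition pderiv :: "'a \<Rightarrow> (('a \<Rightarrow> nat) \<Rightarrow> real) \<Rightarrow> ('a \<Rightarrow> nat) \<Rightarrow> real" where
  "pderiv b c \<alpha> = real (\<alpha> b + 1) * c (\<alpha> + unit_index b)"

text \<open>
  Coefficients of the product of a power series with the coordinate \<open>h \<bullet> b\<close>.
\<close>

definition shift :: "'a \<Rightarrow> (('a \<Rightarrow> nat) \<Rightarrow> real) \<Rightarrow> ('a \<Rightarrow> nat) \<Rightarrow> real" where
  "shift b c \<alpha> = (if \<alpha> b = 0 then 0 else c (\<alpha> - unit_index b))"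

lemma pderiv_commute: "pderiv b (pderiv b' c) = pderiv b' (pderiv b c)"
proof (cases "b = b'")
  case False
  then show ?thesis by (auto simp: pderiv_def fun_eq_iff add_ac unit_index_def)
qed auto

lemma power_bernoulli:
  assumes "0 \<le> r'" "r' \<le> (r::real)" 
  shows "r' ^ (n+1) + real (n+1) * r' ^ n * (r - r') \<le> r ^ (n+1)"
proof (induction n)
  case (Suc n)
  have "r' ^ (Suc n+1) + real (Suc n+1) * r' ^ Suc n * (r - r') + (n+1) * r' ^ n * (r - r')^2
     = r * (r' ^ (n+1) + real (n+1) * r' ^ n * (r - r'))"
    by (simp add: algebra_simps power2_eq_square)
  also have "\<dots> \<le> r * r ^ (n+1)" using Suc assms by (intro mult_left_mono) auto
  finally have "r' ^ (Suc n+1) + real (Suc n+1) * r' ^ Suc n * (r - r') + (n+1) * r' ^ n * (r - r')^2 \<le> r ^ (Suc n + 1)"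
    by simp
  moreover have "0 \<le> (n+1) * r' ^ n * (r - r')^2" using assms by simp
  ultimately show ?case by linarith
qed simp

text \<open>
  A Cauchy estimate: one derivative costs the factor \<open>1 / (r - r')\<close> on a smaller box.
\<close>

lemma wbound_pderiv:
  fixes b :: "'a::euclidean_space"
  assumes c: "wbound (pw r) c M" and r: "0 \<le> r'" "r' < r" and b: "b \<in> Basis"
  shows "wbound (pw r') (pderiv b c) (1 / (r - r') * M)"
  unfolding pderiv_def[abs_def]
proof (rule wbound_reindex[OF c, where \<sigma> = "\<lambda>\<alpha>. \<alpha> + unit_index b"])
  fix \<alpha> :: "'a \<Rightarrow> nat" assume \<alpha>: "\<alpha> \<in> MI"
  have "real (\<alpha> b + 1) * r' ^ mdegree \<alpha> \<le> real (mdegree \<alpha> + 1) * r' ^ mdegree \<alpha>"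
    using le_mdegree[OF b, of \<alpha>] r by (intro mult_right_mono) auto
  moreover have "real (mdegree \<alpha> + 1) * r' ^ mdegree \<alpha> * (r - r') \<le> r ^ (mdegree \<alpha> + 1)"
    using power_bernoulli[of r' r "mdegree \<alpha>"] r zero_le_power[of r' "mdegree \<alpha> + 1"] by linarith
  ultimately have "real (\<alpha> b + 1) * r' ^ mdegree \<alpha> \<le> r ^ (mdegree \<alpha> + 1) / (r - r')"
    using r by (simp add: pos_le_divide_eq) (meson mult_right_mono order_trans less_imp_le diff_ge_0_iff_ge)
  then show "\<alpha> + unit_index b \<in> MI \<and> \<bar>real (\<alpha> b + 1)\<bar> * r' ^ mdegree \<alpha> \<le> 1 / (r - r') * r ^ mdegree (\<alpha> + unit_index b)"
    using \<alpha> b by (simp add: mdegree_add)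
qed (use r in \<open>auto simp: inj_on_def\<close>)

lemma monomial_has_derivative:
  "(monomial \<alpha> has_derivative
      (\<lambda>k. \<Sum>b\<in>Basis. (k \<bullet> b) * (real (\<alpha> b) * monomial (\<alpha> - unit_index b) h))) (at h within S)"
proof -
  have "((\<lambda>x. \<Prod>b\<in>Basis. (x \<bullet> b) ^ \<alpha> b) has_derivative
      (\<lambda>k. \<Sum>b\<in>Basis. (real (\<alpha> b) * (k \<bullet> b) * (h \<bullet> b) ^ (\<alpha> b - 1)) * (\<Prod>j\<in>Basis - {b}. (h \<bullet> j) ^ \<alpha> j))) (at h within S)"
    by (rule has_derivative_prod) (auto intro!: derivative_eq_intros simp: fun_eq_iff)
  moreover have "(h \<bullet> b) ^ (\<alpha> b - 1) * (\<Prod>j\<in>Basis - {b}. (h \<bullet> j) ^ \<alpha> j) = monomial (\<alpha> - unit_index b) h"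
    if b: "b \<in> Basis" for b
  proof -
    have "monomial (\<alpha> - unit_index b) h 
        = (h \<bullet> b) ^ (\<alpha> b - 1) * (\<Prod>j\<in>Basis - {b}. (h \<bullet> j) ^ (\<alpha> - unit_index b) j)"
      unfolding monomial_def using b by (subst prod.remove[of _ b]) auto
    also have "(\<Prod>j\<in>Basis - {b}. (h \<bullet> j) ^ (\<alpha> - unit_index b) j) = (\<Prod>j\<in>Basis - {b}. (h \<bullet> j) ^ \<alpha> j)"
      by (intro prod.cong) (auto simp: unit_index_def)
    finally show ?thesis by (rule sym)
  qed
  ultimately show ?thesis
    unfolding monomial_def[abs_def] 
    by (elim has_derivative_eq_rhs) (auto simp: fun_eq_iff mult_ac intro!: sum.cong)
qed

lemma has_sum_MI_sums_mdegree:
  fixes g :: "('a::euclidean_space \<Rightarrow> nat) \<Rightarrow> real"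
  assumes "(g has_sum S) MI"
  shows "(\<lambda>n. \<Sum>\<alpha>\<in>{\<alpha>\<in>MI. mdegree \<alpha> = n}. g \<alpha>) sums S"
proof -
  let ?D = "\<lambda>n. {\<alpha>::'a \<Rightarrow> nat. \<alpha> \<in> MI \<and> mdegree \<alpha> = n}"
  have "bij_betw snd (Sigma UNIV ?D) MI"
    by (rule bij_betw_byWitness[where f' = "\<lambda>\<alpha>. (mdegree \<alpha>, \<alpha>)"]) auto
  then have "((\<lambda>p. g (snd p)) has_sum S) (Sigma UNIV ?D)"
    using assms has_sum_reindex_bij_betw[of snd _ MI g S] by blast
  then have "((\<lambda>n. \<Sum>\<alpha>\<in>?D n. g \<alpha>) has_sum S) UNIV"
    by (rule has_sum_SigmaD) (auto intro!: has_sum_finiteI finite_MI_mdegree)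
  then show ?thesis by (rule has_sum_imp_sums)
qed

lemma sum_monomial_derivatives:
  fixes b :: "'a::euclidean_space"
  assumes b: "b \<in> Basis"
  shows "(\<Sum>\<alpha>\<in>{\<alpha>\<in>MI. mdegree \<alpha> = Suc n}. c \<alpha> * (real (\<alpha> b) * monomial (\<alpha> - unit_index b) h))
       = (\<Sum>\<beta>\<in>{\<beta>\<in>MI. mdegree \<beta> = n}. pderiv b c \<beta> * monomial \<beta> h)"
proof -
  let ?D = "\<lambda>n. {\<alpha>::'a \<Rightarrow> nat. \<alpha> \<in> MI \<and> mdegree \<alpha> = n}"
  have "(\<Sum>\<alpha>\<in>?D (Suc n). c \<alpha> * (real (\<alpha> b) * monomial (\<alpha> - unit_index b) h))
      = (\<Sum>\<alpha>\<in>{\<alpha> \<in> ?D (Suc n). \<alpha> b > 0}. c \<alpha> * (real (\<alpha> b) * monomial (\<alpha> - unit_index b) h))"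
    using finite_MI_mdegree[of "Suc n"] by (intro sum.mono_neutral_right) auto
  also have "\<dots> = (\<Sum>\<beta>\<in>?D n. pderiv b c \<beta> * monomial \<beta> h)"
  proof (rule sum.reindex_bij_witness[where i = "\<lambda>\<beta>. \<beta> + unit_index b" and j = "\<lambda>\<alpha>. \<alpha> - unit_index b"])
    fix \<alpha> assume \<alpha>: "\<alpha> \<in> {\<alpha> \<in> ?D (Suc n). \<alpha> b > 0}"
    then show eq: "\<alpha> - unit_index b + unit_index b = \<alpha>" using index_eq_add_unit[of \<alpha> b] by simp
    have "mdegree \<alpha> = mdegree (\<alpha> - unit_index b) + 1"
      using b arg_cong[OF eq, of mdegree] by (simp add: mdegree_add)
    then show "\<alpha> - unit_index b \<in> ?D n" using \<alpha> by auto
    have "Suc (\<alpha> b - Suc 0) = \<alpha> b" using \<alpha> by simp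
    then show "pderiv b c (\<alpha> - unit_index b) * monomial (\<alpha> - unit_index b) h =
         c \<alpha> * (real (\<alpha> b) * monomial (\<alpha> - unit_index b) h)"
      unfolding pderiv_def eq by simp
  next
    fix \<beta> assume "\<beta> \<in> ?D n"
    then show "\<beta> + unit_index b \<in> {\<alpha> \<in> ?D (Suc n). \<alpha> b > 0}"
      using b by (auto simp: mdegree_add)
  qed (auto simp: fun_eq_iff)
  finally show ?thesis .
qed

lemma open_strict_box: "open {h::'a::euclidean_space. \<forall>b\<in>Basis. \<bar>h \<bullet> b\<bar> < r}"
proof -
  have "{h::'a. \<forall>b\<in>Basis. \<bar>h \<bullet> b\<bar> < r} = (\<Inter>b\<in>Basis. {h. \<bar>h \<bullet> b\<bar> < r})" by auto
  also have "open \<dots>" by (intro open_INT finite_Basis ballI open_Collect_less continuous_intros)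
  finally show ?thesis .
qed

lemma convex_strict_box: "convex {h::'a::euclidean_space. \<forall>b\<in>Basis. \<bar>h \<bullet> b\<bar> < r}"
proof -
  have "{h::'a. \<forall>b\<in>Basis. \<bar>h \<bullet> b\<bar> < r} = (\<Inter>b\<in>Basis. {h. b \<bullet> h < r} \<inter> {h. b \<bullet> h > - r})"
    by (auto simp: abs_less_iff inner_commute minus_less_iff)
  also have "convex \<dots>" by (intro convex_INT convex_Int convex_halfspace_lt convex_halfspace_gt)
  finally show ?thesis .
qed

text \<open>
  Grouping the series by total degree makes it a sequence of polynomials whose derivatives
  converge uniformly, by the Weierstrass test, on a smaller box that still contains \<open>h\<close>.
\<close>

lemma psum_has_derivative:
  fixes h :: "'a::euclidean_space"
  assumes c: "wbound (pw r) c M" and h: "\<forall>b\<in>Basis. \<bar>h \<bullet> b\<bar> < r"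
  shows "(psum c has_derivative (\<lambda>k. \<Sum>b\<in>Basis. (k \<bullet> b) * psum (pderiv b c) h)) (at h)"
proof -
  let ?D = "\<lambda>n. {\<alpha>::'a \<Rightarrow> nat. \<alpha> \<in> MI \<and> mdegree \<alpha> = n}"
  obtain b0 :: 'a where b0: "b0 \<in> Basis" using nonempty_Basis by blast
  (* the box of radius r' lies strictly between h and the box of radius r *)
  define m where "m = Max ((\<lambda>b. \<bar>h \<bullet> b\<bar>) ` Basis)"
  have m: "\<bar>h \<bullet> b\<bar> \<le> m" if "b \<in> Basis" for b unfolding m_def using that by auto
  have "m < r" unfolding m_def using h by (subst Max_less_iff) auto
  moreover have "0 \<le> m" using m[OF b0] by linarith
  ultimately obtain r' where r': "m < r'" "r' < r" "0 < r'" using dense by (metis le_less_trans)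
  define S where "S = {h::'a. \<forall>b\<in>Basis. \<bar>h \<bullet> b\<bar> < r'}"
  have hS: "h \<in> S" using m r' by (force simp: S_def)
  have box: "inbox r' x" if "x \<in> S" for x using that by (auto simp: S_def inbox_def less_imp_le)
  define f where "f n x = (\<Sum>\<alpha>\<in>?D n. c \<alpha> * monomial \<alpha> x)" for n x
  define Q where "Q b n x = (\<Sum>\<alpha>\<in>?D n. c \<alpha> * (real (\<alpha> b) * monomial (\<alpha> - unit_index b) x))" for b n x
  have c': "wbound (pw r') (pderiv b c) (1 / (r - r') * M)" if "b \<in> Basis" for b
    using wbound_pderiv[OF c _ r'(2) that] r' by simp
  have cr': "wbound (pw r') c M"
    by (rule wbound_weight_mono[OF c]) (use r' in \<open>auto intro: power_mono\<close>)
  have f_sums: "(\<lambda>n. f n x) sums psum c x" if "x \<in> S" for x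
    unfolding f_def by (rule has_sum_MI_sums_mdegree[OF psum_has_sum[OF cr' box[OF that]]]) (use r' in auto)
  have Q0: "Q b 0 x = 0" if "b \<in> Basis" for b x
  proof -
    have "\<alpha> b = 0" if "\<alpha> \<in> ?D 0" for \<alpha> using that by (auto simp: mdegree_eq_0_iff)
    then show ?thesis by (auto simp: Q_def intro!: sum.neutral)
  qed
  have QSuc: "Q b (Suc n) x = (\<Sum>\<beta>\<in>?D n. pderiv b c \<beta> * monomial \<beta> x)" if "b \<in> Basis" for b n x
    unfolding Q_def using sum_monomial_derivatives[OF that] by simp
  have Q_sums: "(\<lambda>n. Q b n x) sums psum (pderiv b c) x" if "x \<in> S" "b \<in> Basis" for b x
  proof -
    have "(\<lambda>n. Q b (Suc n) x) sums psum (pderiv b c) x"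
      unfolding QSuc[OF that(2)] 
      by (rule has_sum_MI_sums_mdegree[OF psum_has_sum[OF c'[OF that(2)] box[OF that(1)]]]) (use r' in auto)
    then show ?thesis using sums_Suc_iff[of "\<lambda>n. Q b n x"] Q0[OF that(2)] by simp
  qed
  have unif: "uniform_limit S (\<lambda>n x. \<Sum>i<n. Q b i x) (psum (pderiv b c)) sequentially" 
    if b: "b \<in> Basis" for b
  proof -
    let ?m = "\<lambda>n. case n of 0 \<Rightarrow> 0 | Suc n \<Rightarrow> (\<Sum>\<beta>\<in>?D n. \<bar>pderiv b c \<beta>\<bar> * r' ^ mdegree \<beta>)"
    have "summable (\<lambda>n. \<Sum>\<beta>\<in>?D n. \<bar>pderiv b c \<beta>\<bar> * r' ^ mdegree \<beta>)"
      using has_sum_MI_sums_mdegree[OF has_sum_infsum[OF wbound_summable[OF c'[OF b]]]] r' 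
      by (auto simp: sums_iff)
    then have sm: "summable ?m" by (subst summable_Suc_iff[symmetric]) simp
    have "uniform_limit S (\<lambda>n x. \<Sum>i<n. Q b i x) (\<lambda>x. suminf (\<lambda>i. Q b i x)) sequentially"
    proof (rule Weierstrass_m_test[OF _ sm])
      fix n x assume x: "x \<in> S"
      show "norm (Q b n x) \<le> ?m n"
      proof (cases n)
        case (Suc k)
        have "\<bar>\<Sum>\<beta>\<in>?D k. pderiv b c \<beta> * monomial \<beta> x\<bar> \<le> (\<Sum>\<beta>\<in>?D k. \<bar>pderiv b c \<beta>\<bar> * r' ^ mdegree \<beta>)"
          using abs_monomial_le[OF box[OF x]] 
          by (intro order_trans[OF sum_abs] sum_mono) (auto simp: abs_mult intro!: mult_left_mono)
        then show ?thesis by (simp only: Suc QSuc[OF b] nat.case real_norm_def)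
      qed (simp add: Q0[OF b])
    qed
    moreover have "suminf (\<lambda>i. Q b i x) = psum (pderiv b c) x" if "x \<in> S" for x
      using Q_sums[OF that b] by (simp add: sums_iff)
    ultimately show ?thesis using uniform_limit_cong'[of S "\<lambda>n x. \<Sum>i<n. Q b i x" "\<lambda>n x. \<Sum>i<n. Q b i x"
        "\<lambda>x. suminf (\<lambda>i. Q b i x)" "psum (pderiv b c)"] by simp
  qed
  have "\<exists>g. \<forall>x\<in>S. (\<lambda>n. f n x) sums g x \<and>
      (g has_derivative (\<lambda>k. \<Sum>b\<in>Basis. (k \<bullet> b) * psum (pderiv b c) x)) (at x within S)"
  proof (rule has_derivative_series[where f' = "\<lambda>n x k. \<Sum>b\<in>Basis. (k \<bullet> b) * Q b n x"])
    show "convex S" unfolding S_def by (rule convex_strict_box)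
    show "h \<in> S" by (rule hS)
    show "(\<lambda>n. f n h) sums psum c h" by (rule f_sums[OF hS])
    fix n x assume "x \<in> S"
    show "(f n has_derivative (\<lambda>k. \<Sum>b\<in>Basis. (k \<bullet> b) * Q b n x)) (at x within S)"
      unfolding f_def
    proof (rule has_derivative_eq_rhs[OF has_derivative_sum[OF has_derivative_mult_right[OF monomial_has_derivative]]])
      show "(\<lambda>k. \<Sum>\<alpha>\<in>?D n. c \<alpha> * (\<Sum>b\<in>Basis. (k \<bullet> b) * (real (\<alpha> b) * monomial (\<alpha> - unit_index b) x))) =
        (\<lambda>k. \<Sum>b\<in>Basis. (k \<bullet> b) * Q b n x)"
        unfolding Q_def sum_distrib_left by (subst sum.swap) (simp add: mult_ac)
    qed
  next
    fix e :: real assume e: "e > 0"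
    define e' where "e' = e / DIM('a)"
    have e': "e' > 0" unfolding e'_def using e by simp
    have "\<forall>\<^sub>F n in sequentially. \<forall>b\<in>Basis. \<forall>x\<in>S. dist (\<Sum>i<n. Q b i x) (psum (pderiv b c) x) < e'"
      using unif e' by (intro eventually_ball_finite) (auto simp: uniform_limit_iff)
    then show "\<forall>\<^sub>F n in sequentially. \<forall>x\<in>S. \<forall>k. norm ((\<Sum>i<n. \<Sum>b\<in>Basis. (k \<bullet> b) * Q b i x) -
        (\<Sum>b\<in>Basis. (k \<bullet> b) * psum (pderiv b c) x)) \<le> e * norm k"
    proof (rule eventually_mono, intro ballI allI)
      fix n x k assume *: "\<forall>b\<in>Basis. \<forall>x\<in>S. dist (\<Sum>i<n. Q b i x) (psum (pderiv b c) x) < e'" and x: "x \<in> S"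
      have "(\<Sum>i<n. \<Sum>b\<in>Basis. (k \<bullet> b) * Q b i x) - (\<Sum>b\<in>Basis. (k \<bullet> b) * psum (pderiv b c) x)
        = (\<Sum>b\<in>Basis. (k \<bullet> b) * ((\<Sum>i<n. Q b i x) - psum (pderiv b c) x))"
        by (subst sum.swap) (simp add: sum_distrib_left sum_subtractf right_diff_distrib)
      also have "norm \<dots> \<le> (\<Sum>b\<in>(Basis::'a set). norm k * e')"
      proof (rule order_trans[OF norm_sum], rule sum_mono)
        fix b :: 'a assume b: "b \<in> Basis"
        have "\<bar>k \<bullet> b\<bar> \<le> norm k" using Basis_le_norm[OF b] .
        moreover have "\<bar>(\<Sum>i<n. Q b i x) - psum (pderiv b c) x\<bar> \<le> e'"
          using * b x by (auto simp: dist_real_def less_imp_le)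
        ultimately show "norm ((k \<bullet> b) * ((\<Sum>i<n. Q b i x) - psum (pderiv b c) x)) \<le> norm k * e'"
          by (auto simp: abs_mult intro!: mult_mono)
      qed
      also have "\<dots> = e * norm k" by (simp add: e'_def)
      finally show "norm ((\<Sum>i<n. \<Sum>b\<in>Basis. (k \<bullet> b) * Q b i x) -
        (\<Sum>b\<in>Basis. (k \<bullet> b) * psum (pderiv b c) x)) \<le> e * norm k" .
    qed
  qed
  then obtain g where g: "\<And>x. x \<in> S \<Longrightarrow> (\<lambda>n. f n x) sums g x"
    "\<And>x. x \<in> S \<Longrightarrow> (g has_derivative (\<lambda>k. \<Sum>b\<in>Basis. (k \<bullet> b) * psum (pderiv b c) x)) (at x within S)"
    by blast
  have S: "open S" unfolding S_def by (rule open_strict_box)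
  have "g x = psum c x" if "x \<in> S" for x using sums_unique2[OF g(1) f_sums] that by blast
  with g(2)[OF hS] show ?thesis
    using S hS by (metis (no_types, lifting) at_within_open has_derivative_transform_within_open)
qed

section \<open>Functions with a power series expansion\<close>

text \<open>
  Boxes rather than balls are used because \<open>|h\<^sup>\<alpha>| \<le> r\<^bsup>|\<alpha>|\<^esup>\<close> there, so that the norm of
  the coefficients with weight \<open>r\<^bsup>|\<alpha>|\<^esup>\<close> controls the series on the whole box.
\<close>

definition hasps :: "('a::euclidean_space \<Rightarrow> real) \<Rightarrow> 'a \<Rightarrow> real \<Rightarrow> (('a \<Rightarrow> nat) \<Rightarrow> real) \<Rightarrow> bool" where
  "hasps f p r c \<longleftrightarrow> 0 < r \<and> (\<exists>M. wbound (pw r) c M) \<and> (\<forall>x. inbox r (x - p) \<longrightarrow> f x = psum c (x - p))"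

text \<open>
  The derivative in direction \<open>b\<close>. On products of the line with a Euclidean space it coincides
  with \<open>partial_t\<close> and \<open>partial_x\<close>, and it treats both kinds of variables alike.
\<close>

definition dd :: "'a::real_normed_vector \<Rightarrow> ('a \<Rightarrow> real) \<Rightarrow> 'a \<Rightarrow> real" where
  "dd b f x = deriv (\<lambda>s. f (x + s *\<^sub>R b)) 0"

lemma inbox_mono: "inbox r h \<Longrightarrow> r \<le> r' \<Longrightarrow> inbox r' h"
  by (force simp: inbox_def)

lemma wbound_pw_mono: "wbound (pw r) c M \<Longrightarrow> 0 \<le> r' \<Longrightarrow> r' \<le> r \<Longrightarrow> wbound (pw r') c M"
  by (erule wbound_weight_mono) (auto intro: power_mono)

lemma hasps_pos: "hasps f p r c \<Longrightarrow> 0 < r"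
  by (simp add: hasps_def)

lemma hasps_mono: 
  assumes "hasps f p r c" "0 < r'" "r' \<le> r" shows "hasps f p r' c"
proof -
  obtain M where "wbound (pw r) c M" using assms by (auto simp: hasps_def)
  then have "wbound (pw r') c M" using wbound_pw_mono assms by (metis less_imp_le)
  then show ?thesis using assms inbox_mono[of r' _ r] by (auto simp: hasps_def)
qed

lemma hasps_min1: "hasps f p r c \<Longrightarrow> 0 < r' \<Longrightarrow> hasps f p (min r r') c"
  by (rule hasps_mono) (auto simp: hasps_def)

lemma hasps_min2: "hasps f p r c \<Longrightarrow> 0 < r' \<Longrightarrow> hasps f p (min r' r) c"
  by (rule hasps_mono) (auto simp: hasps_def)

lemma inbox_imp_norm_le:
  assumes "inbox r (h::'a::euclidean_space)" shows "norm h \<le> real DIM('a) * r"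
proof -
  have "norm h \<le> (\<Sum>b\<in>Basis. \<bar>h \<bullet> b\<bar>)" by (rule norm_le_l1)
  also have "\<dots> \<le> (\<Sum>b\<in>(Basis::'a set). r)" using assms by (intro sum_mono) (auto simp: inbox_def)
  finally show ?thesis by simp
qed

lemma eventually_strict_box:
  fixes p :: "'a::euclidean_space"
  assumes "0 < r" shows "\<forall>\<^sub>F x in nhds p. \<forall>b\<in>Basis. \<bar>(x - p) \<bullet> b\<bar> < r"
proof -
  have "\<forall>\<^sub>F x in nhds p. x \<in> ball p r" using assms by (intro eventually_nhds_in_open) auto
  then show ?thesis
    by eventually_elim (metis Basis_le_norm dist_commute dist_norm le_less_trans mem_ball)
qed

lemma eventually_inbox: "0 < r \<Longrightarrow> \<forall>\<^sub>F x in nhds p. inbox r (x - p)"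
  using eventually_strict_box[of r p] by (auto simp: inbox_def less_imp_le elim: eventually_mono)

lemma eventually_nhds_box:
  assumes "\<forall>\<^sub>F x in nhds p. P (x::'a::euclidean_space)"
  obtains r where "r > 0" "\<And>x. inbox r (x - p) \<Longrightarrow> P x"
proof -
  obtain e where e: "e > 0" "\<And>x. dist x p < e \<Longrightarrow> P x"
    using assms by (auto simp: eventually_nhds_metric)
  have "P x" if "inbox (e / (2 * DIM('a))) (x - p)" for x
    using inbox_imp_norm_le[OF that] e by (auto simp: dist_norm field_simps)
  then show ?thesis using that[of "e / (2 * DIM('a))"] e(1) by auto
qed

lemma hasps_imp_eventually: "hasps f p r c \<Longrightarrow> \<forall>\<^sub>F x in nhds p. f x = psum c (x - p)"
  unfolding hasps_def using eventually_inbox[of r p] by (auto elim: eventually_mono)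

lemma hasps_cong_ev:
  assumes "hasps f p r c" "\<forall>\<^sub>F x in nhds p. f x = g x"
  shows "\<exists>r'>0. r' \<le> r \<and> hasps g p r' c"
proof -
  obtain e where e: "e > 0" "\<And>x. inbox e (x - p) \<Longrightarrow> f x = g x" 
    using eventually_nhds_box[OF assms(2)] by metis
  have "hasps f p (min e r) c" using hasps_min2[OF assms(1) e(1)] .
  then have "hasps g p (min e r) c"
    unfolding hasps_def using e(2) inbox_mono[of "min e r" _ e] by (metis min.cobounded1)
  then show ?thesis by (intro exI[of _ "min e r"]) (auto simp: hasps_def)
qed

lemma hasps_cong_coeff: "hasps f p r c \<Longrightarrow> (\<And>\<alpha>. \<alpha> \<in> MI \<Longrightarrow> d \<alpha> = c \<alpha>) \<Longrightarrow> hasps f p r d"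
  unfolding hasps_def using psum_cong[of d c] wbound_cong[of "pw r" c _ d] by metis

text \<open>
  Convergence at a corner of a box is absolute, and at the corner all coordinates have the same
  size. This is the bound on the coefficients that \<open>hasps\<close> asks for.
\<close>

lemma real_analytic_at_iff_hasps: "real_analytic_at f p \<longleftrightarrow> (\<exists>r c. hasps f p r c)"
proof
  assume "real_analytic_at f p"
  then obtain c r where r: "r > 0" 
    and f: "\<And>x. x \<in> ball p r \<Longrightarrow> ((\<lambda>\<alpha>. c \<alpha> * monomial \<alpha> (x - p)) has_sum f x) MI"
    unfolding real_analytic_at_def by blast
  have "\<forall>\<^sub>F x in nhds p. x \<in> ball p r" using r by (intro eventually_nhds_in_open) auto
  then obtain e where e: "e > 0" "\<And>x. inbox e (x - p) \<Longrightarrow> x \<in> ball p r"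
    by (rule eventually_nhds_box) blast
  (* the corner of the box *)
  define h :: 'a where "h = (\<Sum>b\<in>Basis. e *\<^sub>R b)"
  have h: "h \<bullet> b = e" if "b \<in> Basis" for b unfolding h_def using that by simp
  have mh: "monomial \<alpha> h = e ^ mdegree \<alpha>" for \<alpha>
    by (simp add: monomial_def mdegree_def h power_sum)
  have "((\<lambda>\<alpha>. c \<alpha> * monomial \<alpha> h) has_sum f (p + h)) MI"
    using f[OF e(2), of "p + h"] h e(1) by (simp add: inbox_def)
  then have "(\<lambda>\<alpha>. norm (c \<alpha> * e ^ mdegree \<alpha>)) summable_on MI"
    unfolding mh by (metis summable_on_iff_abs_summable_on_real has_sum_imp_summable)
  then have "(\<lambda>\<alpha>. \<bar>c \<alpha>\<bar> * e ^ mdegree \<alpha>) summable_on MI"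
    using e(1) by (simp add: abs_mult power_abs)
  from summable_wbound[OF this] have "\<exists>M. wbound (pw e) c M" using e(1) by auto
  moreover have "f x = psum c (x - p)" if "inbox e (x - p)" for x
    unfolding psum_def using f[OF e(2)[OF that]] infsumI by metis
  ultimately have "hasps f p e c" using e(1) by (auto simp: hasps_def)
  then show "\<exists>r c. hasps f p r c" by blast
next
  assume "\<exists>r c. hasps f p r c"
  then obtain r c M where r: "0 < r" and M: "wbound (pw r) c M" 
    and f: "\<And>x. inbox r (x - p) \<Longrightarrow> f x = psum c (x - p)"
    by (auto simp: hasps_def)
  have "((\<lambda>\<alpha>. c \<alpha> * monomial \<alpha> (x - p)) has_sum f x) MI" if "x \<in> ball p r" for x
  proof -
    have "inbox r (x - p)"
      unfolding inbox_def using that 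
      by (metis Basis_le_norm dist_commute dist_norm le_less_trans mem_ball less_imp_le)
    then show ?thesis using psum_has_sum[OF M _ less_imp_le[OF r]] f by metis
  qed
  then show "real_analytic_at f p" unfolding real_analytic_at_def using r by blast
qed

lemma hasps_analytic: "hasps f p r c \<Longrightarrow> real_analytic_at f p"
  using real_analytic_at_iff_hasps by blast

lemma hasps_add:
  assumes "hasps f p r c" "hasps g p r' d"
  shows "hasps (\<lambda>x. f x + g x) p (min r r') (c + d)"
proof -
  have 1: "hasps f p (min r r') c" "hasps g p (min r r') d" 
    using hasps_min1[OF assms(1)] hasps_min2[OF assms(2)] hasps_pos[OF assms(1)] hasps_pos[OF assms(2)] by blast+
  then obtain M N where "wbound (pw (min r r')) c M" "wbound (pw (min r r')) d N" by (auto simp: hasps_def)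
  moreover have "0 < min r r'" using assms by (auto simp: hasps_def)
  ultimately show ?thesis using 1 wbound_add[of "pw (min r r')" c M d N]
    unfolding hasps_def by (auto simp: psum_add less_imp_le)
qed

lemma hasps_uminus: "hasps f p r c \<Longrightarrow> hasps (\<lambda>x. - f x) p r (- c)"
  unfolding hasps_def using wbound_uminus psum_uminus by metis

lemma hasps_diff:
  assumes "hasps f p r c" "hasps g p r' d"
  shows "hasps (\<lambda>x. f x - g x) p (min r r') (c - d)"
  using hasps_add[OF assms(1) hasps_uminus[OF assms(2)]] by simp

lemma hasps_scale: "hasps f p r c \<Longrightarrow> hasps (\<lambda>x. k * f x) p r (\<lambda>\<alpha>. k * c \<alpha>)"
  unfolding hasps_def using wbound_scale psum_scale by metis

lemma hasps_mult:
  assumes "hasps f p r c" "hasps g p r' d"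
  shows "hasps (\<lambda>x. f x * g x) p (min r r') (conv c d)"
proof -
  have 1: "hasps f p (min r r') c" "hasps g p (min r r') d" 
    using hasps_min1[OF assms(1)] hasps_min2[OF assms(2)] hasps_pos[OF assms(1)] hasps_pos[OF assms(2)] by blast+
  then obtain M N where "wbound (pw (min r r')) c M" "wbound (pw (min r r')) d N" by (auto simp: hasps_def)
  moreover have "0 < min r r'" using assms by (auto simp: hasps_def)
  ultimately show ?thesis using 1 wbound_conv[of "pw (min r r')" c M d N] pw_sub
    unfolding hasps_def by (auto simp: psum_conv less_imp_le)
qed

definition const_coeff :: "real \<Rightarrow> ('a \<Rightarrow> nat) \<Rightarrow> real" where
  "const_coeff k \<alpha> = (if \<alpha> = 0 then k else 0)"

lemma wbound_const_coeff: 
  assumes "wt 0 \<le> 1" shows "wbound wt (const_coeff k) \<bar>k\<bar>"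
  unfolding wbound_def
proof (intro allI impI)
  fix F :: "('a \<Rightarrow> nat) set" assume F: "finite F"
  have "(\<Sum>\<alpha>\<in>F. \<bar>const_coeff k \<alpha>\<bar> * wt \<alpha>) = (\<Sum>\<alpha>\<in>F. if \<alpha> = 0 then \<bar>k\<bar> * wt 0 else 0)"
    by (intro sum.cong) (auto simp: const_coeff_def)
  also have "\<dots> \<le> \<bar>k\<bar>" using F assms by (auto simp: mult_left_le)
  finally show "(\<Sum>\<alpha>\<in>F. \<bar>const_coeff k \<alpha>\<bar> * wt \<alpha>) \<le> \<bar>k\<bar>" .
qed

lemma has_sum_single: 
  fixes g :: "'b \<Rightarrow> real"
  assumes "a \<in> A" "\<And>x. x \<in> A \<Longrightarrow> x \<noteq> a \<Longrightarrow> g x = 0" shows "(g has_sum g a) A"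
  using has_sum_cong_neutral[of A "{a}" g g "g a"] assms has_sum_finiteI[of "{a}" "g a" g] by auto

lemma psum_const_coeff [simp]: "psum (const_coeff k) h = k"
  using has_sum_single[of 0 MI "\<lambda>\<alpha>. const_coeff k \<alpha> * monomial \<alpha> h"] 
  by (auto simp: psum_def const_coeff_def intro!: infsumI)

lemma hasps_const: "0 < r \<Longrightarrow> hasps (\<lambda>x. k) p r (const_coeff k)"
  unfolding hasps_def using wbound_const_coeff[of "pw r"] by auto

lemma psum_at_0: 
  fixes c :: "('a::euclidean_space \<Rightarrow> nat) \<Rightarrow> real"
  shows "psum c 0 = c 0"
proof -
  have "c \<alpha> * monomial \<alpha> 0 = 0" if \<alpha>: "\<alpha> \<in> MI" "\<alpha> \<noteq> 0" for \<alpha>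
  proof -
    obtain b where b: "\<alpha> b \<noteq> 0" using \<alpha>(2) by (auto simp: fun_eq_iff)
    then have "b \<in> Basis" using \<alpha> by (auto simp: multi_indices_def)
    then have "monomial \<alpha> 0 = 0" unfolding monomial_def using b by (auto intro!: prod_zero)
    then show ?thesis by simp
  qed
  then show ?thesis 
    using has_sum_single[of 0 MI "\<lambda>\<alpha>. c \<alpha> * monomial \<alpha> 0"] by (auto simp: psum_def intro!: infsumI)
qed

lemma hasps_at: "hasps f p r c \<Longrightarrow> f p = c 0"
  unfolding hasps_def using psum_at_0[of c] by (auto simp: inbox_def)

lemma wbound_shift_gen:
  assumes c: "wbound wt c M" and pos: "\<And>\<alpha>. \<alpha> \<in> MI \<Longrightarrow> 0 \<le> wt \<alpha>" and b: "b \<in> Basis"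
    and sub: "\<And>\<alpha> \<beta>. \<alpha> \<in> MI \<Longrightarrow> \<beta> \<in> MI \<Longrightarrow> wt (\<alpha> + \<beta>) \<le> wt \<alpha> * wt \<beta>"
  shows "wbound wt (shift b c) (wt (unit_index b) * M)"
proof -
  have "shift b c = (\<lambda>\<alpha>. (if \<alpha> b = 0 then 0 else 1) * c (\<alpha> - unit_index b))"
    by (auto simp: shift_def fun_eq_iff)
  moreover have "wbound wt (\<lambda>\<alpha>. (if \<alpha> b = 0 then 0 else 1) * c (\<alpha> - unit_index b)) (wt (unit_index b) * M)"
  proof (rule wbound_reindex[OF c])
    fix \<alpha> :: "'a \<Rightarrow> nat" assume \<alpha>: "\<alpha> \<in> MI" "(if \<alpha> b = 0 then 0 else 1) \<noteq> (0::real)"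
    then have "\<alpha> = unit_index b + (\<alpha> - unit_index b)" using index_eq_add_unit[of \<alpha> b] by (simp add: add.commute split: if_splits)
    then show "\<alpha> - unit_index b \<in> MI \<and> \<bar>if \<alpha> b = 0 then 0 else 1\<bar> * wt \<alpha> \<le> wt (unit_index b) * wt (\<alpha> - unit_index b)"
      using sub[of "unit_index b" "\<alpha> - unit_index b"] \<alpha> b by (auto split: if_splits)
  next
    show "inj_on (\<lambda>\<alpha>. \<alpha> - unit_index b) {\<alpha> \<in> MI. (if \<alpha> b = 0 then 0 else 1) \<noteq> (0::real)}"
      unfolding inj_on_def using index_eq_add_unit[of _ b] by (auto split: if_splits) (metis)
  qed (use pos b in auto)
  ultimately show ?thesis by simp
qed

lemma psum_shift:
  assumes c: "wbound (pw r) c M" and h: "inbox r h" "0 \<le> r" and b: "b \<in> Basis"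
  shows "psum (shift b c) h = (h \<bullet> b) * psum c h"
proof -
  have "((\<lambda>\<alpha>. shift b c (\<alpha> + unit_index b) * monomial (\<alpha> + unit_index b) h) has_sum ((h \<bullet> b) * psum c h)) MI"
  proof -
    have "shift b c (\<alpha> + unit_index b) * monomial (\<alpha> + unit_index b) h = (h \<bullet> b) * (c \<alpha> * monomial \<alpha> h)" for \<alpha>
      using b by (simp add: shift_def monomial_add)
    then show ?thesis using has_sum_cmult_right[OF psum_has_sum[OF c h], of "h \<bullet> b"] by simp
  qed
  moreover have "bij_betw (\<lambda>\<alpha>. \<alpha> + unit_index b) MI {\<alpha>\<in>MI. \<alpha> b > 0}"
    by (rule bij_betw_byWitness[where f' = "\<lambda>\<alpha>. \<alpha> - unit_index b"]) 
       (use b in \<open>auto simp: index_eq_add_unit[symmetric] fun_eq_iff\<close>)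
  ultimately have "((\<lambda>\<alpha>. shift b c \<alpha> * monomial \<alpha> h) has_sum ((h \<bullet> b) * psum c h)) {\<alpha>\<in>MI. \<alpha> b > 0}"
    using has_sum_reindex_bij_betw[of "\<lambda>\<alpha>. \<alpha> + unit_index b" MI "{\<alpha>\<in>MI. \<alpha> b > 0}" "\<lambda>\<alpha>. shift b c \<alpha> * monomial \<alpha> h"] by blast
  then have "((\<lambda>\<alpha>. shift b c \<alpha> * monomial \<alpha> h) has_sum ((h \<bullet> b) * psum c h)) MI"
    by (rule has_sum_cong_neutral[THEN iffD1, rotated -1]) (auto simp: shift_def)
  then show ?thesis unfolding psum_def by (rule infsumI)
qed

lemma hasps_shift:
  assumes "hasps f p r c" "b \<in> Basis"
  shows "hasps (\<lambda>x. ((x - p) \<bullet> b) * f x) p r (shift b c)"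
proof -
  from assms obtain M where r: "0 < r" "wbound (pw r) c M" by (auto simp: hasps_def)
  have "wbound (pw r) (shift b c) (r ^ mdegree (unit_index b) * M)"
    using wbound_shift_gen[OF r(2) _ assms(2)] r(1) pw_sub by auto
  then show ?thesis using assms r psum_shift[OF r(2)] by (auto simp: hasps_def)
qed

lemma hasps_coord: 
  assumes "b \<in> Basis" "0 < r" shows "hasps (\<lambda>x. (x - p) \<bullet> b) p r (shift b (const_coeff 1))"
  using hasps_shift[OF hasps_const[OF assms(2), of 1] assms(1)] by simp

lemma dd_eqI:
  assumes "(f has_derivative F) (at x)" shows "dd b f x = F b"
proof -
  interpret bounded_linear F by (rule has_derivative_bounded_linear[OF assms])
  have "((\<lambda>s. x + s *\<^sub>R b) has_derivative (\<lambda>s. s *\<^sub>R b)) (at 0)"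
    by (auto intro!: derivative_eq_intros)
  then have "((\<lambda>s. f (x + s *\<^sub>R b)) has_derivative (\<lambda>s. F (s *\<^sub>R b))) (at 0)"
    using has_derivative_compose[of "\<lambda>s. x + s *\<^sub>R b" _ 0 UNIV f F] assms by auto
  then have "((\<lambda>s. f (x + s *\<^sub>R b)) has_field_derivative F b) (at 0)"
    unfolding has_field_derivative_def by (elim has_derivative_eq_rhs) (simp add: scaleR fun_eq_iff)
  then show ?thesis unfolding dd_def by (rule DERIV_imp_deriv)
qed

lemma hasps_has_derivative:
  assumes f: "hasps f p r c" and x: "\<forall>b\<in>Basis. \<bar>(x - p) \<bullet> b\<bar> < r"
  shows "(f has_derivative (\<lambda>k. \<Sum>b\<in>Basis. (k \<bullet> b) * psum (pderiv b c) (x - p))) (at x)"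
proof -
  from f obtain M where M: "wbound (pw r) c M" by (auto simp: hasps_def)
  have "((\<lambda>x. x - p) has_derivative (\<lambda>k. k)) (at x)" by (auto intro!: derivative_eq_intros)
  from has_derivative_compose[OF this psum_has_derivative[OF M x]]
  have 1: "((\<lambda>x. psum c (x - p)) has_derivative (\<lambda>k. \<Sum>b\<in>Basis. (k \<bullet> b) * psum (pderiv b c) (x - p))) (at x)" .
  let ?S = "(\<lambda>y. y + p) ` {h. \<forall>b\<in>Basis. \<bar>h \<bullet> b\<bar> < r}"
  have "open ?S" using open_translation[OF open_strict_box, of p r] by (simp add: add.commute)
  moreover have "x \<in> ?S" using x by (auto simp: image_iff intro!: exI[of _ "x - p"])
  moreover have "psum c (y - p) = f y" if "y \<in> ?S" for y
    using f that by (auto simp: hasps_def inbox_def less_imp_le)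
  ultimately show ?thesis using has_derivative_transform_within_open[OF 1] by blast
qed

lemma hasps_dd:
  assumes f: "hasps f p r c" and b: "b \<in> Basis" and r': "0 < r'" "r' < r"
  shows "hasps (dd b f) p r' (pderiv b c)"
proof -
  from f obtain M where M: "wbound (pw r) c M" by (auto simp: hasps_def)
  have "dd b f x = psum (pderiv b c) (x - p)" if "inbox r' (x - p)" for x
  proof -
    have "\<forall>b\<in>Basis. \<bar>(x - p) \<bullet> b\<bar> < r" using that r' by (force simp: inbox_def)
    from dd_eqI[OF hasps_has_derivative[OF f this], of b] 
    have "dd b f x = (\<Sum>b'\<in>Basis. (b \<bullet> b') * psum (pderiv b' c) (x - p))" .
    also have "\<dots> = (\<Sum>b'\<in>Basis. if b' = b then psum (pderiv b' c) (x - p) else 0)"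
      using b by (intro sum.cong) (auto simp: inner_Basis)
    finally show ?thesis using b by simp
  qed
  moreover have "wbound (pw r') (pderiv b c) (1 / (r - r') * M)"
    using wbound_pderiv[OF M _ r'(2) b] r' by simp
  ultimately show ?thesis using r' by (auto simp: hasps_def)
qed

section \<open>Composition\<close>

lemma hasps_power_exists:
  assumes "wbound (pw r) G R" "0 < r" 
  shows "\<exists>E. wbound (pw r) E (R ^ n) \<and> (\<forall>h. inbox r h \<longrightarrow> psum G h ^ n = psum E h)"
proof (induction n)
  case 0
  show ?case using wbound_const_coeff[of "pw r" 1] by (intro exI[of _ "const_coeff 1"]) simp
next
  case (Suc n)
  then obtain E where E: "wbound (pw r) E (R ^ n)" "\<And>h. inbox r h \<Longrightarrow> psum G h ^ n = psum E h" by blast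
  have "wbound (pw r) (conv G E) (R * R ^ n)"
    using wbound_conv[OF assms(1) E(1)] pw_sub assms(2) by auto
  moreover have "psum G h ^ Suc n = psum (conv G E) h" if "inbox r h" for h
    using psum_conv[OF assms(1) E(1) that] E(2)[OF that] assms(2) by simp
  ultimately show ?case by (intro exI[of _ "conv G E"]) auto
qed

lemma hasps_monomial_exists:
  assumes "\<And>b. b \<in> S \<Longrightarrow> wbound (pw r) (G b) R" "0 < r" "finite S"
  shows "\<exists>E. wbound (pw r) E (\<Prod>b\<in>S. R ^ \<beta> b) \<and> (\<forall>h. inbox r h \<longrightarrow> (\<Prod>b\<in>S. psum (G b) h ^ \<beta> b) = psum E h)"
  using assms(3,1)
proof (induction S rule: finite_induct)
  case empty
  show ?case using wbound_const_coeff[of "pw r" 1] by (intro exI[of _ "const_coeff 1"]) simp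
next
  case (insert b S)
  then obtain E where E: "wbound (pw r) E (\<Prod>b\<in>S. R ^ \<beta> b)" 
    "\<And>h. inbox r h \<Longrightarrow> (\<Prod>b\<in>S. psum (G b) h ^ \<beta> b) = psum E h" by auto
  obtain E' where E': "wbound (pw r) E' (R ^ \<beta> b)" "\<And>h. inbox r h \<Longrightarrow> psum (G b) h ^ \<beta> b = psum E' h"
    using hasps_power_exists[OF insert.prems assms(2)] by blast
  have "wbound (pw r) (conv E' E) (R ^ \<beta> b * (\<Prod>b\<in>S. R ^ \<beta> b))"
    using wbound_conv[OF E'(1) E(1)] pw_sub assms(2) by auto
  moreover have "psum (G b) h ^ \<beta> b * (\<Prod>b\<in>S. psum (G b) h ^ \<beta> b) = psum (conv E' E) h" if "inbox r h" for h
    using psum_conv[OF E'(1) E(1) that] E(2)[OF that] E'(2)[OF that] assms(2) by simp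
  ultimately show ?case using insert.hyps by (intro exI[of _ "conv E' E"]) auto
qed

text \<open>
  The powers of \<open>g - q\<close> have norm at most \<open>R\<^bsup>|\<beta>|\<^esup>\<close>, hence the double series obtained by
  substitution converges absolutely and may be rearranged.
\<close>

lemma hasps_compose:
  fixes f :: "'b::euclidean_space \<Rightarrow> real" and g :: "'a::euclidean_space \<Rightarrow> 'b"
  assumes f: "hasps f q R d" and r: "0 < r"
    and G: "\<And>b. b \<in> Basis \<Longrightarrow> wbound (pw r) (G b) R"
    and g: "\<And>b x. b \<in> Basis \<Longrightarrow> inbox r (x - p) \<Longrightarrow> (g x - q) \<bullet> b = psum (G b) (x - p)"
  shows "\<exists>C. hasps (\<lambda>x. f (g x)) p r C"
proof -
  from f obtain M where R: "0 < R" and d: "wbound (pw R) d M" by (auto simp: hasps_def)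
  have "\<forall>\<beta>. \<exists>E. wbound (pw r) E (R ^ mdegree \<beta>) \<and> (\<forall>x. inbox r (x - p) \<longrightarrow> monomial \<beta> (g x - q) = psum E (x - p))"
  proof
    fix \<beta> :: "'b \<Rightarrow> nat"
    obtain E where "wbound (pw r) E (\<Prod>b\<in>Basis. R ^ \<beta> b)" 
      "\<And>h. inbox r h \<Longrightarrow> (\<Prod>b\<in>Basis. psum (G b) h ^ \<beta> b) = psum E h"
      using hasps_monomial_exists[where S = Basis and G = G and R = R and \<beta> = \<beta>, OF _ r finite_Basis] G by blast
    then show "\<exists>E. wbound (pw r) E (R ^ mdegree \<beta>) \<and> (\<forall>x. inbox r (x - p) \<longrightarrow> monomial \<beta> (g x - q) = psum E (x - p))"
      by (intro exI[of _ E]) (auto simp: mdegree_def power_sum monomial_def g)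
  qed
  then obtain E where E: "\<And>\<beta>. wbound (pw r) (E \<beta>) (R ^ mdegree \<beta>)"
    "\<And>\<beta> x. inbox r (x - p) \<Longrightarrow> monomial \<beta> (g x - q) = psum (E \<beta>) (x - p)" by metis
  define T where "T \<beta> \<alpha> = \<bar>d \<beta>\<bar> * (\<bar>E \<beta> \<alpha>\<bar> * r ^ mdegree \<alpha>)" for \<beta> \<alpha>
  have T0: "0 \<le> T \<beta> \<alpha>" for \<beta> \<alpha> using r by (simp add: T_def)
  have Tin: "T \<beta> summable_on MI" for \<beta>
    unfolding T_def using summable_on_cmult_right[OF wbound_summable[OF E(1)]] r by simp
  have T1: "0 \<le> infsum (T \<beta>) MI" for \<beta> using T0 by (intro infsum_nonneg)
  have Tle: "infsum (T \<beta>) MI \<le> \<bar>d \<beta>\<bar> * R ^ mdegree \<beta>" for \<beta>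
  proof (rule infsum_le_finite_sums[OF Tin])
    fix F :: "('a \<Rightarrow> nat) set" assume "finite F" "F \<subseteq> MI"
    then show "sum (T \<beta>) F \<le> \<bar>d \<beta>\<bar> * R ^ mdegree \<beta>"
      unfolding T_def sum_distrib_left[symmetric] using wboundD[OF E(1)] by (intro mult_left_mono) auto
  qed
  have T: "(\<lambda>(\<beta>, \<alpha>). T \<beta> \<alpha>) summable_on (MI \<times> MI)"
  proof -
    have "(\<lambda>p. norm (case p of (\<beta>, \<alpha>) \<Rightarrow> T \<beta> \<alpha>)) summable_on (MI \<times> MI)"
    proof (subst Infinite_Sum.abs_summable_on_Sigma_iff, intro conjI ballI)
      show "(\<lambda>\<alpha>. norm (case (\<beta>, \<alpha>) of (\<beta>, \<alpha>) \<Rightarrow> T \<beta> \<alpha>)) summable_on MI" for \<beta>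
        using Tin T0 by simp
      show "(\<lambda>\<beta>. norm (\<Sum>\<^sub>\<infinity>\<alpha>\<in>MI. norm (case (\<beta>, \<alpha>) of (\<beta>, \<alpha>) \<Rightarrow> T \<beta> \<alpha>))) summable_on MI"
        by (rule Infinite_Sum.abs_summable_on_comparison_test'[OF wbound_summable[OF d]])
           (use Tle T0 R in \<open>auto simp: abs_of_nonneg[OF T1]\<close>)
    qed
    then show ?thesis using T0 by (simp add: case_prod_unfold)
  qed
  then have T': "(\<lambda>(\<alpha>, \<beta>). T \<beta> \<alpha>) summable_on (MI \<times> MI)"
    by (rule summable_on_reindex_bij_witness[where i = prod.swap and j = prod.swap, THEN iffD2, rotated -1]) auto
  have TT: "(\<lambda>\<alpha>. \<Sum>\<^sub>\<infinity>\<beta>\<in>MI. T \<beta> \<alpha>) summable_on MI" 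
    using summable_on_Sigma_banach[OF T'] .
  have Tcol: "(\<lambda>\<beta>. T \<beta> \<alpha>) summable_on MI" if "\<alpha> \<in> MI" for \<alpha>
    using summable_on_SigmaD1[of "\<lambda>\<alpha> \<beta>. T \<beta> \<alpha>" MI "\<lambda>_. MI"] T' that by simp
  define C where "C \<alpha> = (\<Sum>\<^sub>\<infinity>\<beta>\<in>MI. d \<beta> * E \<beta> \<alpha>)" for \<alpha>
  have CT: "\<bar>C \<alpha>\<bar> * r ^ mdegree \<alpha> \<le> (\<Sum>\<^sub>\<infinity>\<beta>\<in>MI. T \<beta> \<alpha>)" if "\<alpha> \<in> MI" for \<alpha>
  proof -
    have "(\<lambda>\<beta>. T \<beta> \<alpha> * (1 / r ^ mdegree \<alpha>)) summable_on MI"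
      using summable_on_cmult_left[OF Tcol[OF that]] .
    then have s: "(\<lambda>\<beta>. norm (d \<beta> * E \<beta> \<alpha>)) summable_on MI"
      using r by (simp add: T_def abs_mult)
    have "\<bar>C \<alpha>\<bar> * r ^ mdegree \<alpha> \<le> (\<Sum>\<^sub>\<infinity>\<beta>\<in>MI. norm (d \<beta> * E \<beta> \<alpha>)) * r ^ mdegree \<alpha>"
      unfolding C_def using norm_infsum_bound[OF s] r by (intro mult_right_mono) auto
    also have "\<dots> = (\<Sum>\<^sub>\<infinity>\<beta>\<in>MI. T \<beta> \<alpha>)"
      by (simp add: infsum_cmult_left'[symmetric] T_def abs_mult mult.assoc)
    finally show ?thesis .
  qed
  have "(\<lambda>\<alpha>. norm (\<bar>C \<alpha>\<bar> * r ^ mdegree \<alpha>)) summable_on MI"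
    by (rule Infinite_Sum.abs_summable_on_comparison_test'[OF TT]) (use CT r in auto)
  then have "\<exists>M. wbound (pw r) C M"
    using summable_wbound[of C "pw r"] r by auto
  moreover have "f (g x) = psum C (x - p)" if x: "inbox r (x - p)" for x
  proof -
    have "inbox R (g x - q)" 
      unfolding inbox_def using g[OF _ x] abs_psum_le[OF G x] r by (simp add: less_imp_le)
    then have "f (g x) = psum d (g x - q)" using f by (auto simp: hasps_def)
    also have "\<dots> = (\<Sum>\<^sub>\<infinity>\<beta>\<in>MI. d \<beta> * psum (E \<beta>) (x - p))"
      unfolding psum_def[of d] using E(2)[OF x] by simp
    also have "\<dots> = (\<Sum>\<^sub>\<infinity>\<beta>\<in>MI. \<Sum>\<^sub>\<infinity>\<alpha>\<in>MI. d \<beta> * E \<beta> \<alpha> * monomial \<alpha> (x - p))"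
      unfolding psum_def by (simp add: infsum_cmult_right'[symmetric] mult.assoc)
    also have "\<dots> = (\<Sum>\<^sub>\<infinity>\<alpha>\<in>MI. \<Sum>\<^sub>\<infinity>\<beta>\<in>MI. d \<beta> * E \<beta> \<alpha> * monomial \<alpha> (x - p))"
    proof (rule infsum_swap_banach)
      have "(\<lambda>p'. norm (case p' of (\<beta>, \<alpha>) \<Rightarrow> d \<beta> * E \<beta> \<alpha> * monomial \<alpha> (x - p))) summable_on (MI \<times> MI)"
        by (rule Infinite_Sum.abs_summable_on_comparison_test'[OF T])
           (use abs_monomial_le[OF x] in \<open>auto simp: T_def abs_mult mult.assoc intro!: mult_left_mono\<close>)
      then show "(\<lambda>(\<beta>, \<alpha>). d \<beta> * E \<beta> \<alpha> * monomial \<alpha> (x - p)) summable_on MI \<times> MI"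
        using summable_on_iff_abs_summable_on_real by blast
    qed
    also have "\<dots> = psum C (x - p)"
      unfolding psum_def C_def by (simp add: infsum_cmult_left')
    finally show ?thesis .
  qed
  ultimately show ?thesis using r by (auto simp: hasps_def)
qed

section \<open>Calculus of real-analytic functions\<close>

lemma ra_cong: "real_analytic_at f p \<Longrightarrow> \<forall>\<^sub>F x in nhds p. f x = g x \<Longrightarrow> real_analytic_at g p"
  unfolding real_analytic_at_iff_hasps using hasps_cong_ev by metis

lemma ra_const [simp, intro]: "real_analytic_at (\<lambda>x. k) p"
  using hasps_analytic[OF hasps_const[of 1]] by simp

lemma ra_add [intro]: "real_analytic_at f p \<Longrightarrow> real_analytic_at g p \<Longrightarrow> real_analytic_at (\<lambda>x. f x + g x) p"
  unfolding real_analytic_at_iff_hasps using hasps_add by metis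

lemma ra_uminus [intro]: "real_analytic_at f p \<Longrightarrow> real_analytic_at (\<lambda>x. - f x) p"
  unfolding real_analytic_at_iff_hasps using hasps_uminus by metis

lemma ra_diff [intro]: "real_analytic_at f p \<Longrightarrow> real_analytic_at g p \<Longrightarrow> real_analytic_at (\<lambda>x. f x - g x) p"
  unfolding real_analytic_at_iff_hasps using hasps_diff by metis

lemma ra_mult [intro]: "real_analytic_at f p \<Longrightarrow> real_analytic_at g p \<Longrightarrow> real_analytic_at (\<lambda>x. f x * g x) p"
  unfolding real_analytic_at_iff_hasps using hasps_mult by metis

lemma ra_sum: "(\<And>i. i \<in> I \<Longrightarrow> real_analytic_at (f i) p) \<Longrightarrow> real_analytic_at (\<lambda>x. \<Sum>i\<in>I. f i x) p"
  by (induction I rule: infinite_finite_induct) auto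

lemma ra_coord: "b \<in> Basis \<Longrightarrow> real_analytic_at (\<lambda>x. x \<bullet> b) p"
  using ra_add[OF hasps_analytic[OF hasps_coord[of b 1 p]] ra_const[of "p \<bullet> b"]] 
  by (simp add: inner_diff_left)

lemma ra_dd: "real_analytic_at f p \<Longrightarrow> b \<in> Basis \<Longrightarrow> real_analytic_at (dd b f) p"
  unfolding real_analytic_at_iff_hasps by (metis hasps_dd hasps_pos dense)

lemma dd_commute:
  assumes "real_analytic_at f p" "b \<in> Basis" "b' \<in> Basis"
  shows "dd b (dd b' f) p = dd b' (dd b f) p"
proof -
  obtain r c where f: "hasps f p r c" using assms real_analytic_at_iff_hasps by blast
  obtain r1 where r1: "0 < r1" "r1 < r" using hasps_pos[OF f] dense by blast
  obtain r2 where r2: "0 < r2" "r2 < r1" using r1 dense by blast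
  have "hasps (dd b (dd b' f)) p r2 (pderiv b (pderiv b' c))" "hasps (dd b' (dd b f)) p r2 (pderiv b' (pderiv b c))"
    using hasps_dd[OF hasps_dd[OF f _ r1] _ r2] assms by blast+
  then show ?thesis using hasps_at pderiv_commute by metis
qed

lemma ra_has_derivative:
  assumes "real_analytic_at f p"
  shows "(f has_derivative (\<lambda>k. \<Sum>b\<in>Basis. (k \<bullet> b) * dd b f p)) (at p)"
proof -
  obtain r c where f: "hasps f p r c" using assms real_analytic_at_iff_hasps by blast
  obtain r1 where r1: "0 < r1" "r1 < r" using hasps_pos[OF f] dense by blast
  have "(f has_derivative (\<lambda>k. \<Sum>b\<in>Basis. (k \<bullet> b) * psum (pderiv b c) (p - p))) (at p)"
    by (rule hasps_has_derivative[OF f]) (use r1 in auto)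
  moreover have "psum (pderiv b c) (p - p) = dd b f p" if "b \<in> Basis" for b
    using hasps_at[OF hasps_dd[OF f that r1]] by (simp add: psum_at_0)
  ultimately show ?thesis by simp
qed

lemma ra_isCont: "real_analytic_at f p \<Longrightarrow> isCont f p"
  using ra_has_derivative has_derivative_continuous by blast

text \<open>
  Expanding about a nearby point is a composition with the identity map, seen as the sum of the
  constant \<open>x - p\<close> and the new variable.
\<close>

lemma ra_near:
  assumes "real_analytic_at f p" shows "\<forall>\<^sub>F x in nhds p. real_analytic_at f x"
proof -
  obtain R d where f: "hasps f p R d" using assms real_analytic_at_iff_hasps by blast
  have R: "0 < R / 2" using hasps_pos[OF f] by simp
  show ?thesis using eventually_inbox[OF R, of p]
  proof eventually_elim
    case (elim x)
    define G where "G b = const_coeff ((x - p) \<bullet> b) + shift b (const_coeff 1)" for b :: 'a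
    have w1: "wbound (pw (R/2)) (const_coeff ((x - p) \<bullet> b)) \<bar>(x - p) \<bullet> b\<bar>" for b
      by (rule wbound_const_coeff) simp
    have w2: "wbound (pw (R/2)) (shift b (const_coeff 1)) (R / 2)" if "b \<in> Basis" for b
      using wbound_shift_gen[where wt = "pw (R/2)", OF wbound_const_coeff _ that pw_sub, of 1] R that by simp
    have "\<exists>C. hasps (\<lambda>y. f y) x (R/2) C"
    proof (rule hasps_compose[OF f R])
      fix b :: 'a assume b: "b \<in> Basis"
      have "\<bar>(x - p) \<bullet> b\<bar> + R / 2 \<le> R" using elim b by (force simp: inbox_def)
      then show "wbound (pw (R / 2)) (G b) R"
        unfolding G_def using wbound_mono[OF wbound_add[OF w1 w2[OF b]]] R by simp
      fix y assume y: "inbox (R / 2) (y - x)"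
      have "psum (shift b (const_coeff 1)) (y - x) = (y - x) \<bullet> b"
        using psum_shift[OF wbound_const_coeff y] b R by simp
      then have "psum (G b) (y - x) = (x - p) \<bullet> b + (y - x) \<bullet> b"
        unfolding G_def using psum_add[OF w1 w2[OF b] y] R by simp
      then show "(y - p) \<bullet> b = psum (G b) (y - x)" by (simp add: inner_diff_left)
    qed
    then show "real_analytic_at f x" using real_analytic_at_iff_hasps by metis
  qed
qed

text \<open>
  Without a constant term, a smaller box gives a proportionally smaller norm.
\<close>

lemma wbound_shrink:
  assumes c: "wbound (pw r) c M" "c 0 = 0" and t: "0 \<le> t" "t \<le> 1" and r: "0 \<le> r"
  shows "wbound (pw (t * r)) c (t * M)"
  unfolding wbound_def
proof (intro allI impI)
  fix F :: "('a \<Rightarrow> nat) set" assume F: "finite F" "F \<subseteq> MI"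
  have "(\<Sum>\<alpha>\<in>F. \<bar>c \<alpha>\<bar> * (t * r) ^ mdegree \<alpha>) \<le> (\<Sum>\<alpha>\<in>F. t * (\<bar>c \<alpha>\<bar> * r ^ mdegree \<alpha>))"
  proof (rule sum_mono)
    fix \<alpha> assume "\<alpha> \<in> F"
    show "\<bar>c \<alpha>\<bar> * (t * r) ^ mdegree \<alpha> \<le> t * (\<bar>c \<alpha>\<bar> * r ^ mdegree \<alpha>)"
    proof (cases "\<alpha> = 0")
      case False
      then have "mdegree \<alpha> \<noteq> 0" using \<open>\<alpha> \<in> F\<close> F mdegree_eq_0_iff by blast
      then have "t ^ mdegree \<alpha> \<le> t ^ 1" using t by (intro power_decreasing) auto
      then have "t ^ mdegree \<alpha> * (\<bar>c \<alpha>\<bar> * r ^ mdegree \<alpha>) \<le> t * (\<bar>c \<alpha>\<bar> * r ^ mdegree \<alpha>)"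
        using r by (intro mult_right_mono) auto
      then show ?thesis by (simp add: power_mult_distrib mult_ac)
    qed (simp add: c)
  qed
  also have "\<dots> \<le> t * M" unfolding sum_distrib_left[symmetric] 
    using wboundD[OF c(1) F] t by (intro mult_left_mono) auto
  finally show "(\<Sum>\<alpha>\<in>F. \<bar>c \<alpha>\<bar> * (t * r) ^ mdegree \<alpha>) \<le> t * M" .
qed

text \<open>
  The components of \<open>g - g p\<close> have no constant term, so on a small box their norms are below the
  radius of convergence of \<open>f\<close>.
\<close>

lemma ra_compose:
  fixes f :: "'b::euclidean_space \<Rightarrow> real" and g :: "'a::euclidean_space \<Rightarrow> 'b"
  assumes f: "real_analytic_at f (g p)" and g: "\<And>b. b \<in> Basis \<Longrightarrow> real_analytic_at (\<lambda>x. g x \<bullet> b) p"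
  shows "real_analytic_at (\<lambda>x. f (g x)) p"
proof -
  obtain R d where f: "hasps f (g p) R d" using f real_analytic_at_iff_hasps by blast
  have R: "0 < R" using hasps_pos[OF f] .
  have "\<exists>r c M. hasps (\<lambda>x. (g x - g p) \<bullet> b) p r c \<and> wbound (pw r) c M" if b: "b \<in> Basis" for b
  proof -
    have "real_analytic_at (\<lambda>x. g x \<bullet> b - g p \<bullet> b) p" using g[OF b] by auto
    then obtain r c where "hasps (\<lambda>x. (g x - g p) \<bullet> b) p r c"
      unfolding real_analytic_at_iff_hasps by (auto simp: inner_diff_left)
    then show ?thesis by (auto simp: hasps_def)
  qed
  then obtain r c M where G: "\<And>b. b \<in> Basis \<Longrightarrow> hasps (\<lambda>x. (g x - g p) \<bullet> b) p (r b) (c b)"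
     and M: "\<And>b. b \<in> Basis \<Longrightarrow> wbound (pw (r b)) (c b) (M b)" by metis
  define r0 where "r0 = Min (r ` Basis)"
  define M0 where "M0 = sum M Basis"
  have r0: "0 < r0" "\<And>b. b \<in> Basis \<Longrightarrow> r0 \<le> r b" 
    unfolding r0_def using hasps_pos[OF G] by (auto simp: Min_gr_iff)
  have M0: "M b \<le> M0" if "b \<in> Basis" for b
    unfolding M0_def using that wbound_nonneg[OF M] by (intro member_le_sum) auto
  have M00: "0 \<le> M0" unfolding M0_def using wbound_nonneg[OF M] by (intro sum_nonneg) auto
  (* M0 + 1 rather than M0, which may be 0 *)
  define t where "t = min 1 (R / (M0 + 1))"
  have t: "0 < t" "t \<le> 1" "t \<le> R / (M0 + 1)" unfolding t_def using R M00 by auto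
  have "t * (M0 + 1) \<le> R" using t(3) M00 by (simp add: pos_le_divide_eq)
  then have tM: "t * M0 \<le> R" using t(1) by (simp add: distrib_left)
  have tr: "0 < t * r0" "t * r0 \<le> r0" using t r0(1) by auto
  have "\<exists>C. hasps (\<lambda>x. f (g x)) p (t * r0) C"
  proof (rule hasps_compose[OF f tr(1)])
    fix b :: 'b assume b: "b \<in> Basis"
    have "wbound (pw r0) (c b) (M0)" 
      using wbound_mono[OF wbound_pw_mono[OF M[OF b] _ r0(2)[OF b]] M0[OF b]] r0(1) by simp
    moreover have "c b 0 = 0" using hasps_at[OF G[OF b]] by simp
    ultimately show "wbound (pw (t * r0)) (c b) R"
      using wbound_mono[OF wbound_shrink _] tM t r0 by (metis less_imp_le)
    fix x assume "inbox (t * r0) (x - p)"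
    then have "inbox (r b) (x - p)" using tr r0(2)[OF b] by (meson inbox_mono)
    then show "(g x - g p) \<bullet> b = psum (c b) (x - p)" using G[OF b] by (auto simp: hasps_def)
  qed
  then show ?thesis using real_analytic_at_iff_hasps by blast
qed

lemma ra_inverse_real:
  fixes y :: real assumes y: "y \<noteq> 0" shows "real_analytic_at inverse y"
  unfolding real_analytic_at_def
proof (intro exI[of _ "\<lambda>\<alpha>. (-1) ^ (\<alpha> 1) * inverse y ^ (\<alpha> 1 + 1)"] exI[of _ "\<bar>y\<bar>"] conjI ballI)
  fix x assume x: "x \<in> ball y \<bar>y\<bar>"
  define q where "q = - (x - y) / y"
  have q: "\<bar>q\<bar> < 1" using x y by (simp add: q_def dist_real_def)
  have "x \<noteq> 0" using x by (auto simp: dist_real_def)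
  have "(\<lambda>n. inverse y * q ^ n) sums (inverse y * (1 / (1 - q)))"
    using q by (intro sums_mult geometric_sums) simp
  moreover have "inverse y * (1 / (1 - q)) = inverse x" using y \<open>x \<noteq> 0\<close> by (simp add: q_def field_simps)
  moreover have "summable (\<lambda>n. norm (inverse y * q ^ n))"
    unfolding norm_mult norm_power using q by (intro summable_mult summable_geometric) simp
  ultimately have "((\<lambda>n. inverse y * q ^ n) has_sum inverse x) UNIV"
    using norm_summable_imp_has_sum by metis
  moreover have "bij_betw (\<lambda>\<alpha>::real \<Rightarrow> nat. \<alpha> 1) MI UNIV"
    by (rule bij_betw_byWitness[where f' = "\<lambda>n x. if x = 1 then n else 0"]) (auto simp: multi_indices_def fun_eq_iff)
  ultimately have "((\<lambda>\<alpha>::real \<Rightarrow> nat. inverse y * q ^ \<alpha> 1) has_sum inverse x) MI"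
    using has_sum_reindex_bij_betw[of "\<lambda>\<alpha>::real \<Rightarrow> nat. \<alpha> 1" MI UNIV "\<lambda>n. inverse y * q ^ n"] by blast
  moreover have "inverse y * q ^ \<alpha> 1 = (-1) ^ (\<alpha> 1) * inverse y ^ (\<alpha> 1 + 1) * monomial \<alpha> (x - y)" for \<alpha> :: "real \<Rightarrow> nat"
  proof -
    have "q = (-1) * inverse y * (x - y)" by (simp add: q_def divide_inverse algebra_simps)
    then have "q ^ \<alpha> 1 = (-1) ^ \<alpha> 1 * inverse y ^ \<alpha> 1 * (x - y) ^ \<alpha> 1" by (simp only: power_mult_distrib)
    then show ?thesis by (simp add: monomial_def)
  qed
  ultimately show "((\<lambda>\<alpha>. (-1) ^ (\<alpha> 1) * inverse y ^ (\<alpha> 1 + 1) * monomial \<alpha> (x - y)) has_sum inverse x) MI"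
    by simp
qed (use y in auto)

lemma ra_divide:
  assumes "real_analytic_at f p" "real_analytic_at g p" "g p \<noteq> 0"
  shows "real_analytic_at (\<lambda>x. f x / g x) p"
proof -
  have "real_analytic_at (\<lambda>x. inverse (g x)) p"
    by (rule ra_compose[where f = inverse and g = g]) (use assms ra_inverse_real in auto)
  with assms(1) show ?thesis unfolding divide_inverse by (rule ra_mult)
qed

lemma dd_cong_ev: "\<forall>\<^sub>F x in nhds p. f x = g x \<Longrightarrow> dd b f p = dd b g p"
  unfolding dd_def
proof (rule deriv_cong_ev)
  assume *: "\<forall>\<^sub>F x in nhds p. f x = g x"
  have "((\<lambda>s. p + s *\<^sub>R b) \<longlongrightarrow> p + 0 *\<^sub>R b) (nhds 0)"
    by (intro tendsto_intros filterlim_ident)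
  then have "((\<lambda>s. p + s *\<^sub>R b) \<longlongrightarrow> p) (nhds 0)" by simp
  from filterlim_iff[THEN iffD1, OF this, rule_format, OF *] 
  show "\<forall>\<^sub>F s in nhds 0. f (p + s *\<^sub>R b) = g (p + s *\<^sub>R b)" .
qed simp

section \<open>The identity theorem\<close>

text \<open>
  By continuity the constant coefficient vanishes, and since \<open>S\<close> is open the derivatives of \<open>f\<close>
  vanish on \<open>S\<close> as well: induction on the degree.
\<close>

lemma hasps_vanishing_coeffs:
  fixes p :: "'a::euclidean_space"
  assumes S: "open S" "p \<in> closure S"
    and f: "hasps f p r c" and e: "0 < e" "\<And>x. x \<in> S \<Longrightarrow> dist x p < e \<Longrightarrow> f x = 0"
    and \<alpha>: "\<alpha> \<in> MI" "mdegree \<alpha> = n"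
  shows "c \<alpha> = 0"
  using f e \<alpha>
proof (induction n arbitrary: f r c \<alpha>)
  case 0
  then have "\<alpha> = 0" by (simp add: mdegree_eq_0_iff)
  have "f p = 0"
  proof (rule ccontr)
    assume "f p \<noteq> 0"
    then obtain d where d: "d > 0" "\<And>y. dist p y < d \<Longrightarrow> f y \<noteq> 0"
      using continuous_at_avoid[of p f 0] ra_isCont[OF hasps_analytic[OF "0.prems"(1)]] by auto
    obtain y where "y \<in> S" "dist y p < min d e"
      using S(2) d(1) "0.prems"(2) unfolding closure_approachable by (metis min_less_iff_conj)
    then show False using d(2)[of y] "0.prems"(3)[of y] by (auto simp: dist_commute)
  qed
  then show ?case using hasps_at[OF "0.prems"(1)] \<open>\<alpha> = 0\<close> by simp
next
  case (Suc n)
  obtain b \<beta> where b: "b \<in> Basis" and \<alpha>: "\<alpha> = \<beta> + unit_index b" and "mdegree \<beta> = n"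
    using index_degree_SucE[OF Suc.prems(5)] .
  moreover have "\<beta> \<in> MI" using Suc.prems(4) unfolding \<alpha> by (simp only: add_in_MI_iff)
  ultimately have \<beta>: "\<beta> \<in> MI" "mdegree \<beta> = n" by blast+
  obtain r1 where r1: "0 < r1" "r1 < r" using hasps_pos[OF Suc.prems(1)] dense by blast
  have "pderiv b c \<beta> = 0"
  proof (rule Suc.IH[OF hasps_dd[OF Suc.prems(1) b r1] Suc.prems(2) _ \<beta>])
    fix x assume x: "x \<in> S" "dist x p < e"
    have "\<forall>\<^sub>F y in nhds x. y \<in> S \<inter> ball p e"
      using x S(1) by (intro eventually_nhds_in_open) (auto simp: dist_commute)
    then have "\<forall>\<^sub>F y in nhds x. f y = 0"
      by eventually_elim (use Suc.prems(3) in \<open>auto simp: dist_commute\<close>)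
    then have "dd b f x = dd b (\<lambda>_. 0) x" by (rule dd_cong_ev)
    then show "dd b f x = 0" by (simp add: dd_def)
  qed
  then have "c (\<beta> + unit_index b) = 0" by (simp add: pderiv_def)
  then show ?case by (rule subst[OF \<alpha>[symmetric]])
qed

lemma ra_identity_local:
  assumes "real_analytic_at f p" "open S" "p \<in> closure S" "\<forall>\<^sub>F x in nhds p. x \<in> S \<longrightarrow> f x = 0"
  shows "\<forall>\<^sub>F x in nhds p. f x = 0"
proof -
  obtain r c where f: "hasps f p r c" using assms real_analytic_at_iff_hasps by blast
  obtain e where e: "e > 0" "\<And>x. dist x p < e \<Longrightarrow> x \<in> S \<longrightarrow> f x = 0"
    using assms(4) unfolding eventually_nhds_metric by blast
  have "c \<alpha> = 0" if "\<alpha> \<in> MI" for \<alpha>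
    using hasps_vanishing_coeffs[OF assms(2,3) f e(1) _ that refl] e(2) by blast
  then have "psum c h = psum 0 h" for h by (intro psum_cong) auto
  then have "psum c h = 0" for h by (simp add: psum_def)
  then show ?thesis using hasps_imp_eventually[OF f] by simp
qed

lemma ra_identity_connected:
  assumes C: "connected C" and f: "\<And>x. x \<in> C \<Longrightarrow> real_analytic_at f x"
    and p: "p \<in> C" "\<forall>\<^sub>F x in nhds p. f x = 0" and x: "x \<in> C"
  shows "f x = 0"
proof -
  define Z where "Z = {x. \<forall>\<^sub>F y in nhds x. f y = 0}"
  have Z: "open Z"
    unfolding Z_def open_subopen[of "Collect _"]
    by (auto simp: eventually_eventually eventually_nhds)
  have Z0: "f y = 0" if "y \<in> Z" for y
    using that eventually_nhds_x_imp_x unfolding Z_def by blast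
  have "Z \<inter> C = {} \<or> (- closure Z) \<inter> C = {}"
  proof (rule connectedD[OF C Z])
    show "Z \<inter> (- closure Z) \<inter> C = {}" using closure_subset by auto
    show "C \<subseteq> Z \<union> - closure Z"
    proof
      fix y assume y: "y \<in> C"
      have "y \<in> Z" if "y \<in> closure Z"
        using ra_identity_local[OF f[OF y] Z that always_eventually] Z0 unfolding Z_def by blast
      then show "y \<in> Z \<union> - closure Z" by blast
    qed
  qed (simp add: open_Compl)
  then have "x \<in> closure Z" using p x by (auto simp: Z_def)
  then have "\<forall>\<^sub>F y in nhds x. f y = 0"
    using ra_identity_local[OF f[OF x] Z _ always_eventually] Z0 by blast
  then show ?thesis by (rule eventually_nhds_x_imp_x)
qed

section \<open>Restriction to a coordinate hyperplane\<close>

text \<open>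
  Coefficients of the restriction to the hyperplane \<open>h \<bullet> b = 0\<close>, extended constantly along \<open>b\<close>.
\<close>

definition trunc :: "'a \<Rightarrow> (('a \<Rightarrow> nat) \<Rightarrow> real) \<Rightarrow> ('a \<Rightarrow> nat) \<Rightarrow> real" where
  "trunc b c \<alpha> = (if \<alpha> b = 0 then c \<alpha> else 0)"

lemma wbound_trunc: 
  assumes "wbound wt c M" "\<And>\<alpha>. \<alpha> \<in> MI \<Longrightarrow> 0 \<le> wt \<alpha>" shows "wbound wt (trunc b c) M"
  by (rule wbound_dominated[OF assms(1)]) (use assms(2) in \<open>auto simp: trunc_def\<close>)

lemma psum_trunc:
  assumes b: "b \<in> Basis"
  shows "psum (trunc b c) h = psum c (h - (h \<bullet> b) *\<^sub>R b)"
proof -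
  have "trunc b c \<alpha> * monomial \<alpha> h = c \<alpha> * monomial \<alpha> (h - (h \<bullet> b) *\<^sub>R b)" for \<alpha>
  proof (cases "\<alpha> b = 0")
    case True
    have "(h \<bullet> i) ^ \<alpha> i = ((h - (h \<bullet> b) *\<^sub>R b) \<bullet> i) ^ \<alpha> i" if "i \<in> Basis" for i
      using b that True by (cases "i = b") (auto simp: inner_diff_left inner_Basis)
    then show ?thesis using True by (simp add: trunc_def monomial_def)
  next
    case False
    then have "monomial \<alpha> (h - (h \<bullet> b) *\<^sub>R b) = 0"
      unfolding monomial_def using b by (auto intro!: prod_zero bexI[of _ b] simp: inner_diff_left)
    then show ?thesis using False by (simp add: trunc_def)
  qed
  then show ?thesis by (simp add: psum_def)
qed

lemma inbox_project: "b \<in> Basis \<Longrightarrow> inbox r h \<Longrightarrow> inbox r (h - (h \<bullet> b) *\<^sub>R b)"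
  unfolding inbox_def by (auto simp: inner_diff_left inner_Basis)

text \<open>
  The part of the series without the variable \<open>h \<bullet> b\<close> is the restriction to the hyperplane, so it
  vanishes, and the remaining terms share a factor.
\<close>

lemma ra_divide_coord:
  assumes f: "real_analytic_at f p" and b: "b \<in> Basis"
    and 0: "\<forall>\<^sub>F x in nhds p. (x - p) \<bullet> b = 0 \<longrightarrow> f x = 0"
  shows "\<exists>g. real_analytic_at g p \<and> (\<forall>\<^sub>F x in nhds p. f x = ((x - p) \<bullet> b) * g x)"
proof -
  obtain r0 c where f0: "hasps f p r0 c" using f real_analytic_at_iff_hasps by blast
  obtain e where e: "0 < e" "\<And>x. inbox e (x - p) \<Longrightarrow> (x - p) \<bullet> b = 0 \<longrightarrow> f x = 0" 
    using eventually_nhds_box[OF 0] by metis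
  define r where "r = min e r0"
  have r: "0 < r" "r \<le> e" using e hasps_pos[OF f0] by (auto simp: r_def)
  have f: "hasps f p r c" unfolding r_def using hasps_min2[OF f0 e(1)] .
  then obtain M where M: "wbound (pw r) c M" by (auto simp: hasps_def)
  define d where "d \<alpha> = c (\<alpha> + unit_index b)" for \<alpha>
  have "wbound (pw r) (\<lambda>\<alpha>. 1 * c (\<alpha> + unit_index b)) (1 / r * M)"
    by (rule wbound_reindex[OF M]) (use r b in \<open>auto simp: mdegree_add inj_on_def\<close>)
  then have d: "wbound (pw r) d (1 / r * M)" unfolding d_def by simp
  have cd: "c = trunc b c + shift b d"
    by (auto simp: fun_eq_iff trunc_def shift_def d_def index_eq_add_unit[symmetric])
  have tr: "wbound (pw r) (trunc b c) M" using wbound_trunc[OF M] r by simp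
  have sh: "\<exists>N. wbound (pw r) (shift b d) N"
    using wbound_shift_gen[OF d _ b] pw_sub r by auto
  define g where "g x = psum d (x - p)" for x
  have "hasps g p r d" using r d by (auto simp: hasps_def g_def)
  moreover have "f x = ((x - p) \<bullet> b) * g x" if x: "inbox r (x - p)" for x
  proof -
    let ?h = "(x - p) - ((x - p) \<bullet> b) *\<^sub>R b"
    have "psum (trunc b c) (x - p) = psum c ?h" by (rule psum_trunc[OF b])
    also have "\<dots> = f (p + ?h)" using f inbox_project[OF b x] unfolding hasps_def by (metis add_diff_cancel_left')
    also have "\<dots> = 0"
    proof -
      have "(p + ?h) - p = ?h" by simp
      moreover have "?h \<bullet> b = 0" using b by (simp add: inner_diff_left)
      ultimately show ?thesis using e(2)[of "p + ?h"] inbox_mono[OF inbox_project[OF b x] r(2)] by metis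
    qed
    finally have "psum (trunc b c) (x - p) = 0" .
    moreover have "psum c (x - p) = psum (trunc b c) (x - p) + psum (shift b d) (x - p)"
      by (subst (1) cd) (use sh psum_add[OF tr _ x] r in auto)
    moreover have "psum (shift b d) (x - p) = ((x - p) \<bullet> b) * g x"
      unfolding g_def using psum_shift[OF d x _ b] r by simp
    ultimately show ?thesis using f x by (simp add: hasps_def)
  qed
  ultimately show ?thesis using hasps_analytic eventually_inbox[OF r(1), of p] 
    by (intro exI[of _ g] conjI) (auto elim: eventually_mono)
qed

section \<open>An anisotropic weight\<close>

text \<open>
  The weight described at the beginning; \<open>e\<close> is the direction of the variable \<open>s\<close>.
\<close>

definition fw :: "'a::euclidean_space \<Rightarrow> real \<Rightarrow> real \<Rightarrow> ('a \<Rightarrow> nat) \<Rightarrow> real" where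
  "fw e \<tau> \<rho> \<alpha> = \<tau> ^ \<alpha> e * \<rho> ^ (mdegree \<alpha> - \<alpha> e) / real (mdegree \<alpha> choose \<alpha> e)"

lemma fw_pos: "e \<in> Basis \<Longrightarrow> 0 < \<tau> \<Longrightarrow> 0 < \<rho> \<Longrightarrow> 0 < fw e \<tau> \<rho> \<alpha>"
  unfolding fw_def using le_mdegree[of e \<alpha>] by (auto intro!: divide_pos_pos simp: zero_less_binomial)

lemma binomial_add_le: "(m choose k) * (n choose l) \<le> (m + n) choose (k + l)"
proof -
  have "(m choose k) * (n choose (k + l - k)) \<le> (\<Sum>i\<le>k+l. (m choose i) * (n choose (k + l - i)))"
    by (rule member_le_sum) auto
  then show ?thesis by (simp add: vandermonde)
qed

lemma fw_sub:
  assumes e: "e \<in> Basis" and "0 < \<tau>" "0 < \<rho>"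
  shows "fw e \<tau> \<rho> (\<alpha> + \<beta>) \<le> fw e \<tau> \<rho> \<alpha> * fw e \<tau> \<rho> \<beta>"
proof -
  let ?m = "mdegree \<alpha>" and ?n = "mdegree \<beta>" and ?k = "\<alpha> e" and ?l = "\<beta> e"
  have le: "?k \<le> ?m" "?l \<le> ?n" using le_mdegree[OF e] by auto
  have num: "\<tau> ^ (?k + ?l) * \<rho> ^ (?m + ?n - (?k + ?l)) = (\<tau> ^ ?k * \<rho> ^ (?m - ?k)) * (\<tau> ^ ?l * \<rho> ^ (?n - ?l))"
  proof -
    have "?m + ?n - (?k + ?l) = (?m - ?k) + (?n - ?l)" using le by simp
    then show ?thesis by (simp add: power_add)
  qed
  have "real (?m choose ?k) * real (?n choose ?l) \<le> real ((?m + ?n) choose (?k + ?l))"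
    using binomial_add_le[of ?m ?k ?n ?l] by (metis of_nat_le_iff of_nat_mult)
  moreover have "0 < real (?m choose ?k) * real (?n choose ?l)" using le by (simp add: zero_less_binomial)
  ultimately have "(\<tau> ^ ?k * \<rho> ^ (?m - ?k)) * (\<tau> ^ ?l * \<rho> ^ (?n - ?l)) / real ((?m + ?n) choose (?k + ?l))
      \<le> (\<tau> ^ ?k * \<rho> ^ (?m - ?k)) * (\<tau> ^ ?l * \<rho> ^ (?n - ?l)) / (real (?m choose ?k) * real (?n choose ?l))"
    using assms le add_mono[OF le] by (intro divide_left_mono mult_pos_pos) (auto simp: zero_less_binomial)
  then show ?thesis by (simp add: fw_def mdegree_add num)
qed

lemma fw_unit: "e \<in> Basis \<Longrightarrow> fw e \<tau> \<rho> (unit_index e) = \<tau>"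
  by (simp add: fw_def)

lemma fw_le_pw:
  assumes e: "e \<in> Basis" and "0 < \<tau>" "\<tau> \<le> \<rho>"
  shows "fw e \<tau> \<rho> \<alpha> \<le> pw \<rho> \<alpha>"
proof -
  have le: "\<alpha> e \<le> mdegree \<alpha>" using le_mdegree[OF e] .
  then have "1 \<le> real (mdegree \<alpha> choose \<alpha> e)" 
    using zero_less_binomial[OF le] by linarith
  then have "fw e \<tau> \<rho> \<alpha> \<le> \<tau> ^ \<alpha> e * \<rho> ^ (mdegree \<alpha> - \<alpha> e)"
    unfolding fw_def using assms divide_left_mono[of 1 _ "\<tau> ^ \<alpha> e * \<rho> ^ (mdegree \<alpha> - \<alpha> e)"] by auto
  also have "\<dots> \<le> \<rho> ^ \<alpha> e * \<rho> ^ (mdegree \<alpha> - \<alpha> e)"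
    using assms by (intro mult_right_mono power_mono) auto
  also have "\<dots> = pw \<rho> \<alpha>" using le by (simp add: power_add[symmetric])
  finally show ?thesis .
qed

lemma pw_le_fw:
  assumes e: "e \<in> Basis" and "0 < \<tau>" "\<tau> \<le> \<rho>"
  shows "pw (\<tau> / 2) \<alpha> \<le> fw e \<tau> \<rho> \<alpha>"
proof -
  have le: "\<alpha> e \<le> mdegree \<alpha>" using le_mdegree[OF e] .
  have b: "real (mdegree \<alpha> choose \<alpha> e) \<le> 2 ^ mdegree \<alpha>"
    using binomial_le_pow2[of "mdegree \<alpha>" "\<alpha> e"] by (metis of_nat_le_iff of_nat_numeral of_nat_power)
  have "\<tau> ^ mdegree \<alpha> = \<tau> ^ \<alpha> e * \<tau> ^ (mdegree \<alpha> - \<alpha> e)" using le by (simp add: power_add[symmetric])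
  also have "\<dots> \<le> \<tau> ^ \<alpha> e * \<rho> ^ (mdegree \<alpha> - \<alpha> e)" using assms by (intro mult_left_mono power_mono) auto
  finally have "\<tau> ^ mdegree \<alpha> / 2 ^ mdegree \<alpha> \<le> \<tau> ^ \<alpha> e * \<rho> ^ (mdegree \<alpha> - \<alpha> e) / real (mdegree \<alpha> choose \<alpha> e)"
    using b assms le by (intro frac_le) (auto simp: zero_less_binomial)
  then show ?thesis by (simp add: fw_def power_divide)
qed

text \<open>
  Exchanging one power of an \<open>x\<close>-variable for one power of \<open>s\<close> multiplies the weight by
  \<open>k / (m + 1)\<close>, up to powers of \<open>\<tau>\<close> and \<open>\<rho>\<close>. This compensates the division by \<open>k\<close> in an integration
  and the factor, at most \<open>m + 1\<close>, of a differentiation.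
\<close>

lemma fw_step:
  assumes e: "e \<in> Basis" "b \<in> Basis" "b \<noteq> e" and "0 < \<tau>" "0 < \<rho>" and k: "\<alpha> e > 0"
  shows "real (mdegree \<alpha> - \<alpha> e + 1) * fw e \<tau> \<rho> \<alpha> = \<tau> / \<rho> * real (\<alpha> e) * fw e \<tau> \<rho> (\<alpha> - unit_index e + unit_index b)"
proof -
  define \<alpha>' where "\<alpha>' = \<alpha> - unit_index e + unit_index b"
  define n where "n = mdegree \<alpha>"
  obtain k where k: "\<alpha> e = Suc k" using assms(6) gr0_implies_Suc by blast
  have k': "\<alpha>' e = k" unfolding \<alpha>'_def using k e by simp
  have "mdegree \<alpha> = mdegree (\<alpha> - unit_index e) + 1"
    using arg_cong[OF index_eq_add_unit[of \<alpha> e], of mdegree] k e(1) by (simp add: mdegree_add)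
  then have n': "mdegree \<alpha>' = n" unfolding \<alpha>'_def n_def using e by (simp add: mdegree_add)
  have le: "Suc k \<le> n" unfolding n_def using le_mdegree[OF e(1), of \<alpha>] k by simp
  have "Suc k * (n choose Suc k) = (n - k) * (n choose k)"
    using binomial_absorption[of k n] binomial_absorb_comp[of n k] by simp
  then have bin: "real (Suc k) * real (n choose Suc k) = real (n - k) * real (n choose k)"
    by (metis of_nat_mult)
  have pos: "0 < real (n choose Suc k)" "0 < real (n choose k)" using le by (simp_all add: zero_less_binomial)
  have nk: "n - k = Suc (n - Suc k)" using le by simp
  have "real (n - k) / real (n choose Suc k) = real (Suc k) / real (n choose k)"
    using bin pos by (simp add: field_simps)
  then have "\<tau> ^ Suc k * \<rho> ^ (n - Suc k) * (real (n - k) / real (n choose Suc k)) 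
      = \<tau> ^ Suc k * \<rho> ^ (n - Suc k) * (real (Suc k) / real (n choose k))" by simp
  also have "\<dots> = \<tau> / \<rho> * real (Suc k) * (\<tau> ^ k * \<rho> ^ (n - k) / real (n choose k))"
    using assms(5) by (simp add: nk)
  finally show ?thesis 
    unfolding \<alpha>'_def[symmetric] fw_def k k' n' n_def[symmetric] using le by (simp add: nk mult_ac)
qed

lemma index_add_le_mdegree:
  assumes "e \<in> Basis" "b \<in> Basis" "b \<noteq> e" shows "\<alpha> b + \<alpha> e \<le> mdegree \<alpha>"
proof -
  have "\<alpha> b + \<alpha> e = (\<Sum>x\<in>{b, e}. \<alpha> x)" using assms by simp
  also have "\<dots> \<le> mdegree \<alpha>" unfolding mdegree_def using assms by (intro sum_mono2) auto
  finally show ?thesis .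
qed

lemma fw_step_le:
  assumes e: "e \<in> Basis" "b \<in> Basis" "b \<noteq> e" and "0 < \<tau>" "0 < \<rho>" and k: "\<alpha> e > 0"
  shows "real (\<alpha> b + 1) * fw e \<tau> \<rho> \<alpha> \<le> \<tau> / \<rho> * real (\<alpha> e) * fw e \<tau> \<rho> (\<alpha> - unit_index e + unit_index b)"
proof -
  have "real (\<alpha> b + 1) * fw e \<tau> \<rho> \<alpha> \<le> real (mdegree \<alpha> - \<alpha> e + 1) * fw e \<tau> \<rho> \<alpha>"
    using index_add_le_mdegree[OF e, of \<alpha>] fw_pos[OF e(1) assms(4,5), of \<alpha>] by (intro mult_right_mono) auto
  then show ?thesis using fw_step[where \<alpha> = \<alpha>, OF assms] by simp
qed

section \<open>The integration operator and its gain of derivatives\<close>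

text \<open>
  The inverse of \<open>s \<partial>\<^sub>s\<^sup>2 + 2 \<partial>\<^sub>s\<close> on power series without terms of degree \<open>0\<close> in \<open>s\<close>.
\<close>

definition Jop :: "'a \<Rightarrow> (('a \<Rightarrow> nat) \<Rightarrow> real) \<Rightarrow> ('a \<Rightarrow> nat) \<Rightarrow> real" where
  "Jop e z \<alpha> = (if \<alpha> e = 0 then 0 else z (\<alpha> - unit_index e) / (real (\<alpha> e) * (real (\<alpha> e) + 1)))"

lemma index_swap_units:
  assumes "(\<alpha>::'a \<Rightarrow> nat) e > 0" shows "\<alpha> + unit_index b - unit_index e = \<alpha> - unit_index e + unit_index b"
proof
  fix x show "(\<alpha> + unit_index b - unit_index e) x = (\<alpha> - unit_index e + unit_index b) x"
    using assms by (cases "x = e") (auto simp: unit_index_def)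
qed

lemma inj_on_swap_units: "inj_on (\<lambda>\<alpha>::'a \<Rightarrow> nat. \<alpha> - unit_index e + unit_index b) {\<alpha>. \<alpha> e > 0}"
proof (rule inj_onI)
  fix x y :: "'a \<Rightarrow> nat" 
  assume "x \<in> {\<alpha>. \<alpha> e > 0}" "y \<in> {\<alpha>. \<alpha> e > 0}" "x - unit_index e + unit_index b = y - unit_index e + unit_index b"
  then show "x = y" using index_eq_add_unit[of x e] index_eq_add_unit[of y e] by (metis add_right_cancel mem_Collect_eq)
qed

text \<open>
  Integration in \<open>s\<close> followed by differentiation in the direction \<open>b\<close>.
\<close>

definition trade :: "'a \<Rightarrow> 'a \<Rightarrow> (('a \<Rightarrow> nat) \<Rightarrow> real) \<Rightarrow> ('a \<Rightarrow> nat) \<Rightarrow> real" where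
  "trade e b z \<alpha> = (if \<alpha> e = 0 then 0 else real (\<alpha> b + 1) / real (\<alpha> e)) * z (\<alpha> - unit_index e + unit_index b)"

text \<open>
  This is why the binomial coefficient is in the weight: with a purely geometric weight
  the factor \<open>\<alpha> b + 1\<close> makes the operator unbounded.
\<close>

lemma wbound_trade:
  assumes z: "wbound (fw e \<tau> \<rho>) z M" and e: "e \<in> Basis" "b \<in> Basis" "b \<noteq> e" and \<tau>: "0 < \<tau>" "0 < \<rho>"
  shows "wbound (fw e \<tau> \<rho>) (trade e b z) (\<tau> / \<rho> * M)"
  unfolding trade_def[abs_def]
proof (rule wbound_reindex[OF z])
  fix \<alpha> :: "'a \<Rightarrow> nat" assume \<alpha>: "\<alpha> \<in> MI" "(if \<alpha> e = 0 then 0 else real (\<alpha> b + 1) / real (\<alpha> e)) \<noteq> 0"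
  then have k: "\<alpha> e > 0" by (auto split: if_splits)
  then show "\<alpha> - unit_index e + unit_index b \<in> MI \<and> \<bar>if \<alpha> e = 0 then 0 else real (\<alpha> b + 1) / real (\<alpha> e)\<bar> * fw e \<tau> \<rho> \<alpha>
      \<le> \<tau> / \<rho> * fw e \<tau> \<rho> (\<alpha> - unit_index e + unit_index b)"
    using \<alpha>(1) e divide_right_mono[OF fw_step_le[where \<alpha> = \<alpha>, OF e \<tau> k], of "real (\<alpha> e)"] by simp
next
  show "inj_on (\<lambda>\<alpha>. \<alpha> - unit_index e + unit_index b) {\<alpha> \<in> MI. (if \<alpha> e = 0 then 0 else real (\<alpha> b + 1) / real (\<alpha> e)) \<noteq> 0}"
    by (rule inj_on_subset[OF inj_on_swap_units]) auto
qed (use \<tau> fw_pos[OF e(1) \<tau>] in \<open>auto simp: less_imp_le\<close>)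

lemma abs_divide_le: "1 \<le> k \<Longrightarrow> \<bar>x / k\<bar> \<le> \<bar>x :: real\<bar>"
  by (simp add: divide_le_eq mult_le_cancel_left1)

lemma wbound_pderiv_Jop_time:
  assumes z: "wbound (fw e \<tau> \<rho>) z M" and e: "e \<in> Basis" "0 < \<tau>" "0 < \<rho>"
  shows "wbound (fw e \<tau> \<rho>) (pderiv e (Jop e z)) M"
proof (rule wbound_dominated[OF z])
  fix \<alpha> :: "'a \<Rightarrow> nat"
  have "pderiv e (Jop e z) \<alpha> = z \<alpha> / (real (\<alpha> e) + 2)" by (simp add: pderiv_def Jop_def add_ac)
  then show "\<bar>pderiv e (Jop e z) \<alpha>\<bar> \<le> \<bar>z \<alpha>\<bar>" using abs_divide_le[of "real (\<alpha> e) + 2"] by simp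
qed (use fw_pos[OF e] in \<open>auto simp: less_imp_le\<close>)

context
  fixes e b :: "'a::euclidean_space" and \<tau> \<rho> M :: real and z :: "('a \<Rightarrow> nat) \<Rightarrow> real"
  assumes z: "wbound (fw e \<tau> \<rho>) z M" and e: "e \<in> Basis" "b \<in> Basis" "b \<noteq> e" and \<tau>: "0 < \<tau>" "0 < \<rho>"
begin

lemma wbound_pderiv_Jop_space: "wbound (fw e \<tau> \<rho>) (pderiv b (Jop e z)) (\<tau> / \<rho> * M)"
proof (rule wbound_dominated[OF wbound_trade[OF z e \<tau>]])
  fix \<alpha> :: "'a \<Rightarrow> nat"
  have "pderiv b (Jop e z) \<alpha> = trade e b z \<alpha> / (real (\<alpha> e) + 1)"
    using e by (auto simp: pderiv_def Jop_def trade_def index_swap_units)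
  then show "\<bar>pderiv b (Jop e z) \<alpha>\<bar> \<le> \<bar>trade e b z \<alpha>\<bar>" using abs_divide_le[of "real (\<alpha> e) + 1"] by simp
qed (use fw_pos[OF e(1) \<tau>] in \<open>auto simp: less_imp_le\<close>)

text \<open>
  The integration in \<open>J\<close> is undone by the derivative in \<open>s\<close>, but the factor \<open>s\<close> together with the
  second division in \<open>J\<close> acts like another one.
\<close>

lemma wbound_shift_pderiv2_Jop_mixed:
  "wbound (fw e \<tau> \<rho>) (shift e (pderiv b (pderiv e (Jop e z)))) (\<tau> / \<rho> * M)"
proof (rule wbound_dominated[OF wbound_trade[OF z e \<tau>]])
  fix \<alpha> :: "'a \<Rightarrow> nat"
  show "\<bar>shift e (pderiv b (pderiv e (Jop e z))) \<alpha>\<bar> \<le> \<bar>trade e b z \<alpha>\<bar>"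
  proof (cases "\<alpha> e = 0")
    case False
    then have "shift e (pderiv b (pderiv e (Jop e z))) \<alpha> = trade e b z \<alpha> / ((real (\<alpha> e) + 1) / real (\<alpha> e))"
      using e by (simp add: pderiv_def Jop_def shift_def trade_def add.commute[of 1] Suc_le_eq of_nat_diff)
    moreover have "1 \<le> (real (\<alpha> e) + 1) / real (\<alpha> e)" using False by simp
    ultimately show ?thesis using abs_divide_le by (simp only:)
  qed (simp add: shift_def)
qed (use fw_pos[OF e(1) \<tau>] in \<open>auto simp: less_imp_le\<close>)

text \<open>
  Two derivatives in \<open>x\<close> are paid for by one power of \<open>s\<close> from \<open>J\<close> and one from the factor \<open>s\<close>.
\<close>

lemma wbound_shift_pderiv2_Jop_space:
  "wbound (fw e \<tau> \<rho>) (shift e (pderiv b (pderiv b (Jop e z)))) (\<tau> / \<rho> * (\<tau> / \<rho> * M))"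
proof (rule wbound_cong[OF wbound_trade[OF wbound_trade[OF z e \<tau>] e \<tau>]])
  fix \<alpha> :: "'a \<Rightarrow> nat"
  show "shift e (pderiv b (pderiv b (Jop e z))) \<alpha> = trade e b (trade e b z) \<alpha>"
  proof (cases "\<alpha> e < 2")
    case False
    have "\<alpha> - unit_index e + unit_index b + unit_index b - unit_index e =
        \<alpha> - unit_index e + unit_index b - unit_index e + unit_index b"
      using False e by (intro index_swap_units) simp
    moreover obtain k where "\<alpha> e = Suc (Suc k)" using False by (auto simp: numeral_2_eq_2 not_less Suc_le_eq dest!: less_imp_Suc_add)
    ultimately show ?thesis using e by (simp add: pderiv_def Jop_def shift_def trade_def field_simps)
  qed (use e in \<open>auto simp: pderiv_def Jop_def shift_def trade_def less_2_cases_iff\<close>)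
qed

end

lemma wbound_shift_fw:
  assumes "wbound (fw e \<tau> \<rho>) c M" "e \<in> Basis" "0 < \<tau>" "0 < \<rho>"
  shows "wbound (fw e \<tau> \<rho>) (shift e c) (\<tau> * M)"
  using wbound_shift_gen[OF assms(1) less_imp_le[OF fw_pos[OF assms(2-4)]] assms(2) fw_sub[OF assms(2-4)]] 
  by (simp add: fw_unit[OF assms(2)])

section \<open>Limits in the weighted spaces and fixed points\<close>

lemma wbound_limit:
  assumes "\<And>n. wbound wt (c n) M" "\<And>\<alpha>. \<alpha> \<in> MI \<Longrightarrow> (\<lambda>n. c n \<alpha>) \<longlonglongrightarrow> d \<alpha>"
  shows "wbound wt d M"
  unfolding wbound_def
proof (intro allI impI)
  fix F :: "('a \<Rightarrow> nat) set" assume F: "finite F" "F \<subseteq> MI"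
  have "(\<lambda>n. \<Sum>\<alpha>\<in>F. \<bar>c n \<alpha>\<bar> * wt \<alpha>) \<longlonglongrightarrow> (\<Sum>\<alpha>\<in>F. \<bar>d \<alpha>\<bar> * wt \<alpha>)"
    using F assms(2) by (intro tendsto_intros) auto
  then show "(\<Sum>\<alpha>\<in>F. \<bar>d \<alpha>\<bar> * wt \<alpha>) \<le> M"
    by (rule LIMSEQ_le_const2) (use wboundD[OF assms(1) F] in blast)
qed

lemma wbound_null:
  assumes "\<And>n::nat. wbound wt c (K / 2 ^ n)" shows "wbound wt c 0"
  unfolding wbound_def
proof (intro allI impI)
  fix F :: "('a \<Rightarrow> nat) set" assume F: "finite F" "F \<subseteq> MI"
  have "(\<lambda>n. K * (1 / 2) ^ n) \<longlonglongrightarrow> K * 0" by (intro tendsto_intros) simp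
  then have "(\<lambda>n. K / 2 ^ n) \<longlonglongrightarrow> 0" by (simp add: power_divide)
  then show "(\<Sum>\<alpha>\<in>F. \<bar>c \<alpha>\<bar> * wt \<alpha>) \<le> 0"
    by (rule LIMSEQ_le_const) (use wboundD[OF assms F] in blast)
qed

text \<open>
  Completeness of the weighted space, for sequences with geometrically decreasing steps.
\<close>

lemma wbound_complete:
  assumes d: "\<And>n. wbound wt (c (Suc n) - c n) (K / 2 ^ n)" and wt: "\<And>\<alpha>. \<alpha> \<in> MI \<Longrightarrow> 0 < wt \<alpha>"
  obtains z where "\<And>\<alpha>. \<alpha> \<in> MI \<Longrightarrow> (\<lambda>n. c n \<alpha>) \<longlonglongrightarrow> z \<alpha>" "\<And>n. wbound wt (z - c n) (2 * K / 2 ^ n)"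
proof -
  have K: "0 \<le> K" using wbound_nonneg[OF d[of 0]] by simp
  have conv: "convergent (\<lambda>n. c n \<alpha>)" if \<alpha>: "\<alpha> \<in> MI" for \<alpha>
  proof -
    have "summable (\<lambda>n. c (Suc n) \<alpha> - c n \<alpha>)"
    proof (rule summable_comparison_test)
      show "\<exists>N. \<forall>n\<ge>N. norm (c (Suc n) \<alpha> - c n \<alpha>) \<le> K / wt \<alpha> * (1 / 2) ^ n"
        using wbound_term[OF d \<alpha>] wt[OF \<alpha>] by (auto simp: field_simps power_divide)
      show "summable (\<lambda>n. K / wt \<alpha> * (1 / 2) ^ n)" by (intro summable_mult summable_geometric) simp
    qed
    then have "convergent (\<lambda>n. \<Sum>k<n. c (Suc k) \<alpha> - c k \<alpha>)" by (simp add: summable_iff_convergent)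
    moreover have "(\<lambda>n. \<Sum>k<n. c (Suc k) \<alpha> - c k \<alpha>) = (\<lambda>n. c n \<alpha> - c 0 \<alpha>)"
      by (rule ext) (rule sum_lessThan_telescope)
    ultimately have "convergent (\<lambda>n. c n \<alpha> - c 0 \<alpha>)" by simp
    then show ?thesis using convergent_add[OF _ convergent_const[of "c 0 \<alpha>"]] by fastforce
  qed
  define z where "z \<alpha> = lim (\<lambda>n. c n \<alpha>)" for \<alpha>
  have z: "(\<lambda>n. c n \<alpha>) \<longlonglongrightarrow> z \<alpha>" if "\<alpha> \<in> MI" for \<alpha>
    unfolding z_def using conv[OF that] by (simp add: convergent_LIMSEQ_iff)
  have part: "wbound wt (c (n + k) - c n) (2 * K / 2 ^ n - 2 * K / 2 ^ (n + k))" for n k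
  proof (induction k)
    case (Suc k)
    have "wbound wt ((c (Suc (n + k)) - c (n + k)) + (c (n + k) - c n)) (K / 2 ^ (n + k) + (2 * K / 2 ^ n - 2 * K / 2 ^ (n + k)))"
      using wt by (intro wbound_add[OF d Suc]) (auto simp: less_imp_le)
    moreover have "K / 2 ^ (n + k) + (2 * K / 2 ^ n - 2 * K / 2 ^ (n + k)) = 2 * K / 2 ^ n - 2 * K / 2 ^ (n + Suc k)"
      by (simp add: field_simps)
    moreover have "(c (Suc (n + k)) - c (n + k)) + (c (n + k) - c n) = c (n + Suc k) - c n"
      by (simp add: fun_eq_iff)
    ultimately show ?case by (simp only:)
  next
    case 0
    show ?case by (rule wbound_cong[OF wbound_mono[OF wbound_zero]]) (auto simp: zero_fun_def)
  qed
  have "wbound wt (z - c n) (2 * K / 2 ^ n)" for n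
  proof (rule wbound_limit)
    show "wbound wt (c (n + k) - c n) (2 * K / 2 ^ n)" for k
      by (rule wbound_mono[OF part]) (use K in simp)
    show "(\<lambda>k. (c (n + k) - c n) \<alpha>) \<longlonglongrightarrow> (z - c n) \<alpha>" if "\<alpha> \<in> MI" for \<alpha>
      using tendsto_diff[OF LIMSEQ_ignore_initial_segment[OF z[OF that], of n] tendsto_const[of "c n \<alpha>"]]
      by (simp add: add.commute)
  qed
  with z show ?thesis using that by blast
qed

definition lip_bound :: "'a::euclidean_space \<Rightarrow> real \<Rightarrow> real \<Rightarrow> nat
    \<Rightarrow> ((('a \<Rightarrow> nat) \<Rightarrow> real) \<Rightarrow> ('a \<Rightarrow> nat) \<Rightarrow> real) \<Rightarrow> real \<Rightarrow> real \<Rightarrow> bool" where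
  "lip_bound e \<tau> \<rho> j \<Phi> R C \<longleftrightarrow>
     (\<forall>z. wbound (fw e \<tau> \<rho>) z R \<longrightarrow> wbound (fw e \<tau> \<rho>) (\<Phi> z) C) \<and>
     (\<forall>z z' \<delta>. wbound (fw e \<tau> \<rho>) z R \<longrightarrow> wbound (fw e \<tau> \<rho>) z' R \<longrightarrow> wbound (fw e \<tau> \<rho>) (z - z') \<delta> \<longrightarrow>
        wbound (fw e \<tau> \<rho>) (\<Phi> z - \<Phi> z') (C * \<tau> ^ j * \<delta>))"

text \<open>
  On every ball \<open>\<Phi>\<close> is bounded, and Lipschitz with constant \<open>C \<tau>\<^sup>j\<close>. What matters is that \<open>C\<close> may depend on
  \<open>\<rho>\<close> (which is small) and the radius \<open>R\<close> but not on \<open>\<tau>\<close>: for \<open>j = 1\<close>, decreasing \<open>\<tau>\<close> makes \<open>\<Phi>\<close> a contraction.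
\<close>

definition tame :: "'a::euclidean_space \<Rightarrow> nat \<Rightarrow> ((('a \<Rightarrow> nat) \<Rightarrow> real) \<Rightarrow> ('a \<Rightarrow> nat) \<Rightarrow> real) \<Rightarrow> bool" where
  "tame e j \<Phi> \<longleftrightarrow> (\<exists>\<rho>0>0. \<forall>\<rho>. 0 < \<rho> \<and> \<rho> \<le> \<rho>0 \<longrightarrow>
     (\<forall>R. \<exists>C\<ge>0. \<forall>\<tau>. 0 < \<tau> \<and> \<tau> \<le> \<rho> \<longrightarrow> lip_bound e \<tau> \<rho> j \<Phi> R C))"

lemma tameE:
  assumes "tame e j \<Phi>"
  obtains \<rho>0 C where "0 < \<rho>0" "\<And>\<rho> R. 0 \<le> C \<rho> R"
    "\<And>\<rho> R \<tau>. 0 < \<tau> \<Longrightarrow> \<tau> \<le> \<rho> \<Longrightarrow> \<rho> \<le> \<rho>0 \<Longrightarrow> lip_bound e \<tau> \<rho> j \<Phi> R (C \<rho> R)"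
proof -
  obtain \<rho>0 where r: "0 < \<rho>0" and *: "\<And>\<rho> R. 0 < \<rho> \<Longrightarrow> \<rho> \<le> \<rho>0 \<Longrightarrow>
      \<exists>C\<ge>0. \<forall>\<tau>. 0 < \<tau> \<and> \<tau> \<le> \<rho> \<longrightarrow> lip_bound e \<tau> \<rho> j \<Phi> R C"
    using assms unfolding tame_def by blast
  have "\<exists>C\<ge>0. 0 < \<rho> \<and> \<rho> \<le> \<rho>0 \<longrightarrow> (\<forall>\<tau>. 0 < \<tau> \<and> \<tau> \<le> \<rho> \<longrightarrow> lip_bound e \<tau> \<rho> j \<Phi> R C)" for \<rho> R
    using *[of \<rho> R] by (cases "0 < \<rho> \<and> \<rho> \<le> \<rho>0") auto
  then obtain C where C: "\<And>\<rho> R. 0 \<le> C \<rho> R" 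
    "\<And>\<rho> R. 0 < \<rho> \<and> \<rho> \<le> \<rho>0 \<longrightarrow> (\<forall>\<tau>. 0 < \<tau> \<and> \<tau> \<le> \<rho> \<longrightarrow> lip_bound e \<tau> \<rho> j \<Phi> R (C \<rho> R))" by metis
  show ?thesis by (rule that[where C = C, OF r C(1)]) (use C(2) in auto)
qed

lemma tame_lipschitz_const:
  assumes e: "e \<in> Basis" and "tame e 1 \<Phi>" "0 < r"
  obtains \<rho> C where "0 < \<rho>" "\<rho> \<le> r" "\<And>R. 0 \<le> C R"
    "\<And>R \<tau> z. 0 < \<tau> \<Longrightarrow> \<tau> \<le> \<rho> \<Longrightarrow> wbound (fw e \<tau> \<rho>) z R \<Longrightarrow> wbound (fw e \<tau> \<rho>) (\<Phi> z) (C R)"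
    "\<And>R \<tau> z z' \<delta>. 0 < \<tau> \<Longrightarrow> \<tau> \<le> \<rho> \<Longrightarrow> wbound (fw e \<tau> \<rho>) z R \<Longrightarrow> wbound (fw e \<tau> \<rho>) z' R \<Longrightarrow>
      wbound (fw e \<tau> \<rho>) (z - z') \<delta> \<Longrightarrow> wbound (fw e \<tau> \<rho>) (\<Phi> z - \<Phi> z') (C R * \<tau> * \<delta>)"
proof -
  obtain \<rho>0 C where C: "0 < \<rho>0" "\<And>\<rho> R. 0 \<le> C \<rho> R"
    "\<And>\<rho> R \<tau>. 0 < \<tau> \<Longrightarrow> \<tau> \<le> \<rho> \<Longrightarrow> \<rho> \<le> \<rho>0 \<Longrightarrow> lip_bound e \<tau> \<rho> 1 \<Phi> R (C \<rho> R)"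
    using tameE[OF assms(2)] by metis
  show ?thesis
    by (rule that[of "min \<rho>0 r" "C (min \<rho>0 r)"]) 
       (use C(1,2) assms C(3)[of _ "min \<rho>0 r"] in \<open>auto simp: lip_bound_def\<close>)
qed

text \<open>
  Picard iteration from \<open>0\<close>.
\<close>

lemma tame_fixed_point:
  assumes e: "e \<in> Basis" and "tame e 1 \<Phi>"
  obtains \<tau> \<rho> z M where "0 < \<tau>" "\<tau> \<le> \<rho>" "wbound (fw e \<tau> \<rho>) z M" "\<And>\<alpha>. \<alpha> \<in> MI \<Longrightarrow> \<Phi> z \<alpha> = z \<alpha>"
proof -
  obtain \<rho> C where \<rho>: "0 < \<rho>" and C0: "\<And>R. 0 \<le> C R"
    and C1: "\<And>R \<tau> z. 0 < \<tau> \<Longrightarrow> \<tau> \<le> \<rho> \<Longrightarrow> wbound (fw e \<tau> \<rho>) z R \<Longrightarrow> wbound (fw e \<tau> \<rho>) (\<Phi> z) (C R)"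
    and C2: "\<And>R \<tau> z z' \<delta>. 0 < \<tau> \<Longrightarrow> \<tau> \<le> \<rho> \<Longrightarrow> wbound (fw e \<tau> \<rho>) z R \<Longrightarrow> wbound (fw e \<tau> \<rho>) z' R \<Longrightarrow>
      wbound (fw e \<tau> \<rho>) (z - z') \<delta> \<Longrightarrow> wbound (fw e \<tau> \<rho>) (\<Phi> z - \<Phi> z') (C R * \<tau> * \<delta>)"
    using tame_lipschitz_const[OF assms zero_less_one] by metis
  (* The ball of radius R contains the image of 0 with a margin of 1; with the \<tau> below, the
     Lipschitz constant on the ball is at most 1/2 and the image of the ball is within 1/2 of the image of 0. *)
  define R where "R = C 0 + 1"
  have R: "0 < R" using C0[of 0] by (simp add: R_def)
  define \<tau> where "\<tau> = min \<rho> (1 / (2 * (C R + 1) * (R + 1)))"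
  have pos: "0 < 2 * (C R + 1) * (R + 1)" using C0[of R] R by simp
  have \<tau>: "0 < \<tau>" "\<tau> \<le> \<rho>" "\<tau> \<le> 1 / (2 * (C R + 1) * (R + 1))" using \<rho> pos by (auto simp: \<tau>_def)
  let ?wt = "fw e \<tau> \<rho>"
  have wt: "0 < ?wt \<alpha>" for \<alpha> by (rule fw_pos[OF e \<tau>(1) \<rho>])
  have "\<tau> * (2 * (C R + 1) * (R + 1)) \<le> 1" using \<tau>(3) pos by (simp add: pos_le_divide_eq)
  moreover have "0 \<le> 2 * \<tau> * (R + 1)" using \<tau>(1) R by simp
  ultimately have "2 * (C R * \<tau>) * (R + 1) \<le> 1" by (simp add: algebra_simps)
  then have "2 * (C R * \<tau> * R) + 2 * (C R * \<tau>) \<le> 1" by (simp add: algebra_simps)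
  moreover have "0 \<le> C R * \<tau>" "0 \<le> C R * \<tau> * R" using C0[of R] \<tau>(1) R by auto
  ultimately have small: "C R * \<tau> * R \<le> 1 / 2" "C R * \<tau> \<le> 1 / 2" by linarith+
  have half: "wbound ?wt (\<Phi> z - \<Phi> z') (\<delta> / 2)" 
    if "wbound ?wt z R" "wbound ?wt z' R" "wbound ?wt (z - z') \<delta>" for z z' \<delta>
  proof (rule wbound_mono[OF C2[OF \<tau>(1,2) that]])
    show "C R * \<tau> * \<delta> \<le> \<delta> / 2" using mult_right_mono[OF small(2) wbound_nonneg[OF that(3)]] by simp
  qed
  have zR: "wbound ?wt 0 R" using wbound_mono[OF wbound_zero] R by (metis less_imp_le)
  have \<Phi>0: "wbound ?wt (\<Phi> 0) (C 0)" by (rule C1[OF \<tau>(1,2) wbound_zero])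
  have self: "wbound ?wt (\<Phi> z) R" if z: "wbound ?wt z R" for z
  proof -
    have "wbound ?wt (\<Phi> z - \<Phi> 0) (C R * \<tau> * R)" using C2[OF \<tau>(1,2) z zR] z by simp
    then have "wbound ?wt ((\<Phi> z - \<Phi> 0) + \<Phi> 0) (C R * \<tau> * R + C 0)"
      by (rule wbound_add[OF _ \<Phi>0]) (use wt in \<open>auto simp: less_imp_le\<close>)
    then show ?thesis using small(1) by (auto simp: R_def elim: wbound_mono)
  qed
  define zn where "zn n = (\<Phi> ^^ n) 0" for n
  have zS: "zn (Suc n) = \<Phi> (zn n)" for n by (simp add: zn_def)
  have znR: "wbound ?wt (zn n) R" for n 
  proof (induction n)
    case 0 show ?case unfolding zn_def funpow_0 by (rule zR)
  next
    case (Suc n) 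
    show ?case unfolding zS by (rule self[OF Suc])
  qed
  have d: "wbound ?wt (zn (Suc n) - zn n) (R / 2 ^ n)" for n
  proof (induction n)
    case 0 
    have "zn (Suc 0) - zn 0 = \<Phi> 0" by (simp add: zn_def fun_eq_iff)
    with self[OF zR] show ?case by simp
  next
    case (Suc n) 
    have "wbound ?wt (\<Phi> (zn (Suc n)) - \<Phi> (zn n)) (R / 2 ^ n / 2)" by (rule half[OF znR znR Suc])
    moreover have "R / 2 ^ n / 2 = R / 2 ^ Suc n" by simp
    ultimately show ?case by (simp only: zS)
  qed
  obtain z where z: "\<And>\<alpha>. \<alpha> \<in> MI \<Longrightarrow> (\<lambda>n. zn n \<alpha>) \<longlonglongrightarrow> z \<alpha>" "\<And>n. wbound ?wt (z - zn n) (2 * R / 2 ^ n)"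
    using wbound_complete[OF d wt] by blast
  have zR: "wbound ?wt z R" by (rule wbound_limit[OF znR z(1)])
  have "wbound ?wt (\<Phi> z - z) (2 * R / 2 ^ n)" for n
  proof -
    have "wbound ?wt (\<Phi> z - \<Phi> (zn n)) (2 * R / 2 ^ n / 2)" by (rule half[OF zR znR z(2)])
    moreover have "wbound ?wt (- (z - zn (Suc n))) (2 * R / 2 ^ Suc n)" by (rule wbound_uminus[OF z(2)])
    ultimately have "wbound ?wt ((\<Phi> z - \<Phi> (zn n)) + (- (z - zn (Suc n)))) (2 * R / 2 ^ n / 2 + 2 * R / 2 ^ Suc n)"
      by (rule wbound_add) (use wt in \<open>auto simp: less_imp_le\<close>)
    moreover have "(\<Phi> z - \<Phi> (zn n)) + (- (z - zn (Suc n))) = \<Phi> z - z" by (simp add: zS)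
    moreover have "2 * R / 2 ^ n / 2 + 2 * R / 2 ^ Suc n = 2 * R / 2 ^ n" by (simp add: field_simps)
    ultimately show ?thesis by (simp only:)
  qed
  then have "wbound ?wt (\<Phi> z - z) 0" by (rule wbound_null)
  then have "\<Phi> z \<alpha> = z \<alpha>" if "\<alpha> \<in> MI" for \<alpha> using wbound_zero_imp[OF _ that wt] by fastforce
  then show ?thesis using that[OF \<tau>(1,2) zR] by blast
qed

text \<open>
  Two convergent series have bounded norms for all small \<open>\<tau>\<close> at a fixed \<open>\<rho>\<close>. Taking \<open>\<tau>\<close> small with
  respect to these bounds, the contraction halves their distance over and over.
\<close>

lemma tame_fixed_point_unique:
  assumes e: "e \<in> Basis" and "tame e 1 \<Phi>"
    and z: "wbound (pw r) z M" "\<And>\<alpha>. \<alpha> \<in> MI \<Longrightarrow> \<Phi> z \<alpha> = z \<alpha>"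
    and z': "wbound (pw r) z' M'" "\<And>\<alpha>. \<alpha> \<in> MI \<Longrightarrow> \<Phi> z' \<alpha> = z' \<alpha>"
    and r: "0 < r" and \<alpha>: "\<alpha> \<in> MI"
  shows "z \<alpha> = z' \<alpha>"
proof -
  obtain \<rho> C where \<rho>: "0 < \<rho>" "\<rho> \<le> r" and C0: "\<And>R. 0 \<le> C R"
    and C2: "\<And>R \<tau> z z' \<delta>. 0 < \<tau> \<Longrightarrow> \<tau> \<le> \<rho> \<Longrightarrow> wbound (fw e \<tau> \<rho>) z R \<Longrightarrow> wbound (fw e \<tau> \<rho>) z' R \<Longrightarrow>
      wbound (fw e \<tau> \<rho>) (z - z') \<delta> \<Longrightarrow> wbound (fw e \<tau> \<rho>) (\<Phi> z - \<Phi> z') (C R * \<tau> * \<delta>)"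
    using tame_lipschitz_const[OF assms(1,2) r] by metis
  define R where "R = max M M'"
  define \<tau> where "\<tau> = min \<rho> (1 / (2 * (C R + 1)))"
  have pos: "0 < 2 * (C R + 1)" using C0[of R] by simp
  have \<tau>: "0 < \<tau>" "\<tau> \<le> \<rho>" "\<tau> \<le> 1 / (2 * (C R + 1))" using \<rho> pos by (auto simp: \<tau>_def)
  let ?wt = "fw e \<tau> \<rho>"
  have wt: "0 < ?wt \<alpha>" for \<alpha> by (rule fw_pos[OF e \<tau>(1) \<rho>(1)])
  have "\<tau> * (2 * (C R + 1)) \<le> 1" using \<tau>(3) pos by (simp add: pos_le_divide_eq)
  then have small: "C R * \<tau> \<le> 1 / 2" using \<tau>(1) by (simp add: algebra_simps)
  have R: "wbound ?wt c R" if "wbound (pw r) c N" "N \<le> R" for c N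
    using wbound_mono[OF wbound_weight_mono[OF wbound_pw_mono[OF that(1) less_imp_le[OF \<rho>(1)] \<rho>(2)] fw_le_pw[OF e \<tau>(1,2)]] that(2)] .
  have zR: "wbound ?wt z R" "wbound ?wt z' R" using R[OF z(1)] R[OF z'(1)] by (auto simp: R_def)
  have "wbound ?wt (z - z') (2 * R / 2 ^ n)" for n
  proof (induction n)
    case 0
    show ?case by (rule wbound_mono[OF wbound_diff[OF zR]]) (use wt in \<open>auto simp: less_imp_le\<close>)
  next
    case (Suc n)
    have "wbound ?wt (\<Phi> z - \<Phi> z') (C R * \<tau> * (2 * R / 2 ^ n))" by (rule C2[OF \<tau>(1,2) zR Suc])
    then have "wbound ?wt (z - z') (C R * \<tau> * (2 * R / 2 ^ n))" 
      by (rule wbound_cong) (use z z' in auto)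
    moreover have "C R * \<tau> * (2 * R / 2 ^ n) \<le> 2 * R / 2 ^ Suc n"
      using mult_right_mono[OF small wbound_nonneg[OF Suc]] by simp
    ultimately show ?case by (rule wbound_mono)
  qed
  then have "wbound ?wt (z - z') 0" by (rule wbound_null)
  then show ?thesis using wbound_zero_imp[OF _ \<alpha> wt] by fastforce
qed

section \<open>Tame operators\<close>

text \<open>
  The coefficients of a convergent power series.
\<close>

definition majorized :: "(('a::euclidean_space \<Rightarrow> nat) \<Rightarrow> real) \<Rightarrow> bool" where
  "majorized c \<longleftrightarrow> (\<exists>r>0. \<exists>M. wbound (pw r) c M)"

lemma hasps_majorized: "hasps f p r c \<Longrightarrow> majorized c"
  unfolding hasps_def majorized_def by blast

lemma hasps_dd_half: "hasps w p r c \<Longrightarrow> b \<in> Basis \<Longrightarrow> hasps (dd b w) p (r / 2) (pderiv b c)"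
  using hasps_dd[of w p r c b "r / 2"] hasps_pos[of w p r c] by simp

lemma hasps_psum: "0 < r \<Longrightarrow> wbound (pw r) c M \<Longrightarrow> hasps (\<lambda>x. psum c (x - p)) p r c"
  unfolding hasps_def by blast

lemma majorized_pderiv:
  assumes "majorized c" "b \<in> Basis" shows "majorized (pderiv b c)"
proof -
  obtain r M where r: "0 < r" "wbound (pw r) c M" using assms by (auto simp: majorized_def)
  show ?thesis using hasps_majorized[OF hasps_dd[OF hasps_psum[OF r, of 0] assms(2), of "r/2"]] r by simp
qed

lemma majorized_shift:
  assumes "majorized c" "b \<in> Basis" shows "majorized (shift b c)"
proof -
  obtain r M where r: "0 < r" "wbound (pw r) c M" using assms by (auto simp: majorized_def)
  show ?thesis using hasps_majorized[OF hasps_shift[OF hasps_psum[OF r, of 0] assms(2)]] by simp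
qed

lemma shift_diff: "shift b (c - d) = shift b c - shift b d"
  by (auto simp: shift_def fun_eq_iff)

lemma shift_add: "shift b (c + d) = shift b c + shift b d"
  by (auto simp: shift_def fun_eq_iff)

lemma pderiv_diff: "pderiv b (c - d) = pderiv b c - pderiv b d"
  by (auto simp: pderiv_def fun_eq_iff right_diff_distrib)

lemma pderiv_add: "pderiv b (c + d) = pderiv b c + pderiv b d"
  by (auto simp: pderiv_def fun_eq_iff distrib_left)

lemma Jop_diff: "Jop b (c - d) = Jop b c - Jop b d"
  by (auto simp: Jop_def fun_eq_iff diff_divide_distrib)

lemma lip_boundI:
  assumes "\<And>z. wbound (fw e \<tau> \<rho>) z R \<Longrightarrow> wbound (fw e \<tau> \<rho>) (\<Phi> z) C"
    and "\<And>z z' \<delta>. 0 \<le> \<delta> \<Longrightarrow> wbound (fw e \<tau> \<rho>) z R \<Longrightarrow> wbound (fw e \<tau> \<rho>) z' R \<Longrightarrow> wbound (fw e \<tau> \<rho>) (z - z') \<delta> \<Longrightarrow>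
        wbound (fw e \<tau> \<rho>) (\<Phi> z - \<Phi> z') (C * \<tau> ^ j * \<delta>)"
  shows "lip_bound e \<tau> \<rho> j \<Phi> R C"
  unfolding lip_bound_def using assms wbound_nonneg by metis

lemma lip_boundD1: "lip_bound e \<tau> \<rho> j \<Phi> R C \<Longrightarrow> wbound (fw e \<tau> \<rho>) z R \<Longrightarrow> wbound (fw e \<tau> \<rho>) (\<Phi> z) C"
  by (simp add: lip_bound_def)

lemma lip_boundD2: 
  "lip_bound e \<tau> \<rho> j \<Phi> R C \<Longrightarrow> wbound (fw e \<tau> \<rho>) z R \<Longrightarrow> wbound (fw e \<tau> \<rho>) z' R \<Longrightarrow> 
   wbound (fw e \<tau> \<rho>) (z - z') \<delta> \<Longrightarrow> wbound (fw e \<tau> \<rho>) (\<Phi> z - \<Phi> z') (C * \<tau> ^ j * \<delta>)"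
  by (simp add: lip_bound_def)

lemma tameI:
  assumes "0 < \<rho>0" "\<And>\<rho> R. 0 < \<rho> \<Longrightarrow> \<rho> \<le> \<rho>0 \<Longrightarrow> 0 \<le> C \<rho> R" 
    "\<And>\<rho> R \<tau>. 0 < \<tau> \<Longrightarrow> \<tau> \<le> \<rho> \<Longrightarrow> \<rho> \<le> \<rho>0 \<Longrightarrow> lip_bound e \<tau> \<rho> j \<Phi> R (C \<rho> R)"
  shows "tame e j \<Phi>"
  unfolding tame_def
proof (rule exI[of _ \<rho>0], intro conjI allI impI)
  fix \<rho> R assume "0 < \<rho> \<and> \<rho> \<le> \<rho>0"
  then show "\<exists>C\<ge>0. \<forall>\<tau>. 0 < \<tau> \<and> \<tau> \<le> \<rho> \<longrightarrow> lip_bound e \<tau> \<rho> j \<Phi> R C"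
    using assms(2,3) by (intro exI[of _ "C \<rho> R"]) auto
qed (rule assms)

context
  fixes e :: "'a::euclidean_space"
  assumes e: "e \<in> Basis"
begin

lemma fw_nonneg: "0 < \<tau> \<Longrightarrow> \<tau> \<le> \<rho> \<Longrightarrow> 0 \<le> fw e \<tau> \<rho> \<alpha>"
  using fw_pos[OF e, of \<tau> \<rho> \<alpha>] by linarith

lemma wbound_pw_fw:
  assumes "wbound (pw r) c M" "0 < \<tau>" "\<tau> \<le> \<rho>" "\<rho> \<le> r" shows "wbound (fw e \<tau> \<rho>) c M"
  by (rule wbound_weight_mono[OF wbound_pw_mono[OF assms(1)] fw_le_pw[OF e]]) (use assms in auto)

lemma wbound_conv_fw:
  assumes "wbound (fw e \<tau> \<rho>) c M" "wbound (fw e \<tau> \<rho>) d N" "0 < \<tau>" "\<tau> \<le> \<rho>"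
  shows "wbound (fw e \<tau> \<rho>) (conv c d) (M * N)"
  by (rule wbound_conv[OF assms(1,2) fw_nonneg[OF assms(3,4)] fw_sub[OF e]]) (use assms in auto)

lemma wbound_add_fw:
  assumes "wbound (fw e \<tau> \<rho>) c M" "wbound (fw e \<tau> \<rho>) d N" "0 < \<tau>" "\<tau> \<le> \<rho>"
  shows "wbound (fw e \<tau> \<rho>) (c + d) (M + N)"
  by (rule wbound_add[OF assms(1,2) fw_nonneg[OF assms(3,4)]])

lemma tame_affine:
  assumes \<kappa>: "majorized \<kappa>" and lin: "\<And>z z'. L (z - z') = L z - L z'"
    and L: "\<And>\<tau> \<rho> z N. 0 < \<tau> \<Longrightarrow> \<tau> \<le> \<rho> \<Longrightarrow> wbound (fw e \<tau> \<rho>) z N \<Longrightarrow> wbound (fw e \<tau> \<rho>) (L z) (K \<rho> * \<tau> ^ j * N)"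
    and K: "\<And>\<rho>. 0 < \<rho> \<Longrightarrow> 0 \<le> K \<rho>"
  shows "tame e j (\<lambda>z. \<kappa> + L z)"
proof -
  obtain r M where r: "0 < r" "wbound (pw r) \<kappa> M" using \<kappa> by (auto simp: majorized_def)
  have M: "0 \<le> M" using wbound_nonneg[OF r(2)] .
  show ?thesis
  proof (rule tameI[OF r(1), where C = "\<lambda>\<rho> R. M + K \<rho> * \<rho> ^ j * \<bar>R\<bar> + K \<rho>"])
    fix \<rho> R \<tau> :: real assume \<tau>: "0 < \<tau>" "\<tau> \<le> \<rho>" "\<rho> \<le> r"
    have \<rho>: "0 < \<rho>" using \<tau> by simp
    let ?C = "M + K \<rho> * \<rho> ^ j * \<bar>R\<bar> + K \<rho>"
    show "lip_bound e \<tau> \<rho> j (\<lambda>z. \<kappa> + L z) R ?C"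
    proof (rule lip_boundI)
      fix z assume z: "wbound (fw e \<tau> \<rho>) z R"
      have "K \<rho> * \<tau> ^ j * R \<le> K \<rho> * \<rho> ^ j * \<bar>R\<bar>"
        using K[OF \<rho>] \<tau> wbound_nonneg[OF z] by (intro mult_mono power_mono) auto
      then show "wbound (fw e \<tau> \<rho>) (\<kappa> + L z) ?C"
        using K[OF \<rho>] by (intro wbound_mono[OF wbound_add_fw[OF wbound_pw_fw[OF r(2) \<tau>] L[OF \<tau>(1,2) z] \<tau>(1,2)]]) simp
    next
      fix z z' \<delta> assume \<delta>: "0 \<le> \<delta>" "wbound (fw e \<tau> \<rho>) (z - z') \<delta>"
      have "K \<rho> * \<tau> ^ j * \<delta> \<le> ?C * \<tau> ^ j * \<delta>"
        using M K[OF \<rho>] \<delta> \<tau> by (intro mult_right_mono) auto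
      moreover have "(\<kappa> + L z) - (\<kappa> + L z') = L (z - z')" by (simp add: lin)
      ultimately show "wbound (fw e \<tau> \<rho>) ((\<kappa> + L z) - (\<kappa> + L z')) (?C * \<tau> ^ j * \<delta>)"
        using wbound_mono[OF L[OF \<tau>(1,2) \<delta>(2)]] by (simp only:)
    qed
  qed (use M K in auto)
qed

lemma tame_const: "majorized A \<Longrightarrow> tame e j (\<lambda>z. A)"
  using tame_affine[of A "\<lambda>z. 0" "\<lambda>_. 0"] by simp

lemma tame_add:
  assumes "tame e j \<Phi>" "tame e j \<Psi>" shows "tame e j (\<lambda>z. \<Phi> z + \<Psi> z)"
proof -
  obtain r1 C1 where 1: "0 < r1" "\<And>\<rho> R. 0 \<le> C1 \<rho> R"
    "\<And>\<rho> R \<tau>. 0 < \<tau> \<Longrightarrow> \<tau> \<le> \<rho> \<Longrightarrow> \<rho> \<le> r1 \<Longrightarrow> lip_bound e \<tau> \<rho> j \<Phi> R (C1 \<rho> R)" using tameE[OF assms(1)] by metis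
  obtain r2 C2 where 2: "0 < r2" "\<And>\<rho> R. 0 \<le> C2 \<rho> R"
    "\<And>\<rho> R \<tau>. 0 < \<tau> \<Longrightarrow> \<tau> \<le> \<rho> \<Longrightarrow> \<rho> \<le> r2 \<Longrightarrow> lip_bound e \<tau> \<rho> j \<Psi> R (C2 \<rho> R)" using tameE[OF assms(2)] by metis
  show ?thesis
  proof (rule tameI[of "min r1 r2" "\<lambda>\<rho> R. C1 \<rho> R + C2 \<rho> R"])
    fix \<rho> R \<tau> :: real assume \<tau>: "0 < \<tau>" "\<tau> \<le> \<rho>" "\<rho> \<le> min r1 r2"
    have L1: "lip_bound e \<tau> \<rho> j \<Phi> R (C1 \<rho> R)" and L2: "lip_bound e \<tau> \<rho> j \<Psi> R (C2 \<rho> R)"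
      using 1(3) 2(3) \<tau> by auto
    show "lip_bound e \<tau> \<rho> j (\<lambda>z. \<Phi> z + \<Psi> z) R (C1 \<rho> R + C2 \<rho> R)"
    proof (rule lip_boundI)
      fix z assume z: "wbound (fw e \<tau> \<rho>) z R"
      show "wbound (fw e \<tau> \<rho>) (\<Phi> z + \<Psi> z) (C1 \<rho> R + C2 \<rho> R)"
        by (rule wbound_add_fw[OF lip_boundD1[OF L1 z] lip_boundD1[OF L2 z] \<tau>(1,2)])
    next
      fix z z' \<delta> assume z: "wbound (fw e \<tau> \<rho>) z R" "wbound (fw e \<tau> \<rho>) z' R" "wbound (fw e \<tau> \<rho>) (z - z') \<delta>"
      have "\<Phi> z + \<Psi> z - (\<Phi> z' + \<Psi> z') = (\<Phi> z - \<Phi> z') + (\<Psi> z - \<Psi> z')" by simp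
      moreover have "(C1 \<rho> R + C2 \<rho> R) * \<tau> ^ j * \<delta> = C1 \<rho> R * \<tau> ^ j * \<delta> + C2 \<rho> R * \<tau> ^ j * \<delta>" by (simp add: distrib_right)
      ultimately show "wbound (fw e \<tau> \<rho>) (\<Phi> z + \<Psi> z - (\<Phi> z' + \<Psi> z')) ((C1 \<rho> R + C2 \<rho> R) * \<tau> ^ j * \<delta>)"
        using wbound_add_fw[OF lip_boundD2[OF L1 z] lip_boundD2[OF L2 z] \<tau>(1,2)] by (simp only:)
    qed
  qed (use 1 2 in auto)
qed

lemma tame_conv:
  assumes "tame e j \<Phi>" "tame e j \<Psi>" shows "tame e j (\<lambda>z. conv (\<Phi> z) (\<Psi> z))"
proof -
  obtain r1 C1 where 1: "0 < r1" "\<And>\<rho> R. 0 \<le> C1 \<rho> R"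
    "\<And>\<rho> R \<tau>. 0 < \<tau> \<Longrightarrow> \<tau> \<le> \<rho> \<Longrightarrow> \<rho> \<le> r1 \<Longrightarrow> lip_bound e \<tau> \<rho> j \<Phi> R (C1 \<rho> R)" using tameE[OF assms(1)] by metis
  obtain r2 C2 where 2: "0 < r2" "\<And>\<rho> R. 0 \<le> C2 \<rho> R"
    "\<And>\<rho> R \<tau>. 0 < \<tau> \<Longrightarrow> \<tau> \<le> \<rho> \<Longrightarrow> \<rho> \<le> r2 \<Longrightarrow> lip_bound e \<tau> \<rho> j \<Psi> R (C2 \<rho> R)" using tameE[OF assms(2)] by metis
  show ?thesis
  proof (rule tameI[of "min r1 r2" "\<lambda>\<rho> R. 2 * (C1 \<rho> R * C2 \<rho> R)"])
    fix \<rho> R \<tau> :: real assume \<tau>: "0 < \<tau>" "\<tau> \<le> \<rho>" "\<rho> \<le> min r1 r2"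
    have L1: "lip_bound e \<tau> \<rho> j \<Phi> R (C1 \<rho> R)" and L2: "lip_bound e \<tau> \<rho> j \<Psi> R (C2 \<rho> R)"
      using 1(3) 2(3) \<tau> by auto
    show "lip_bound e \<tau> \<rho> j (\<lambda>z. conv (\<Phi> z) (\<Psi> z)) R (2 * (C1 \<rho> R * C2 \<rho> R))"
    proof (rule lip_boundI)
      fix z assume z: "wbound (fw e \<tau> \<rho>) z R"
      show "wbound (fw e \<tau> \<rho>) (conv (\<Phi> z) (\<Psi> z)) (2 * (C1 \<rho> R * C2 \<rho> R))"
        by (rule wbound_mono[OF wbound_conv_fw[OF lip_boundD1[OF L1 z] lip_boundD1[OF L2 z] \<tau>(1,2)]])
           (use 1(2) 2(2) in simp)
    next
      fix z z' \<delta> assume z: "wbound (fw e \<tau> \<rho>) z R" "wbound (fw e \<tau> \<rho>) z' R" "wbound (fw e \<tau> \<rho>) (z - z') \<delta>"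
      have "conv (\<Phi> z) (\<Psi> z) - conv (\<Phi> z') (\<Psi> z') = conv (\<Phi> z - \<Phi> z') (\<Psi> z) + conv (\<Phi> z') (\<Psi> z - \<Psi> z')"
        by (simp add: conv_diff_left conv_diff_right)
      moreover have "2 * (C1 \<rho> R * C2 \<rho> R) * \<tau> ^ j * \<delta> = C1 \<rho> R * \<tau> ^ j * \<delta> * C2 \<rho> R + C1 \<rho> R * (C2 \<rho> R * \<tau> ^ j * \<delta>)" 
        by simp
      ultimately show "wbound (fw e \<tau> \<rho>) (conv (\<Phi> z) (\<Psi> z) - conv (\<Phi> z') (\<Psi> z')) (2 * (C1 \<rho> R * C2 \<rho> R) * \<tau> ^ j * \<delta>)"
        using wbound_add_fw[OF wbound_conv_fw[OF lip_boundD2[OF L1 z] lip_boundD1[OF L2 z(1)] \<tau>(1,2)]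
            wbound_conv_fw[OF lip_boundD1[OF L1 z(2)] lip_boundD2[OF L2 z] \<tau>(1,2)] \<tau>(1,2)] by (simp only:)
    qed
  qed (use 1 2 in auto)
qed

lemma tame_shift:
  assumes "tame e 0 \<Phi>" shows "tame e 1 (\<lambda>z. shift e (\<Phi> z))"
proof -
  obtain r1 C1 where 1: "0 < r1" "\<And>\<rho> R. 0 \<le> C1 \<rho> R"
    "\<And>\<rho> R \<tau>. 0 < \<tau> \<Longrightarrow> \<tau> \<le> \<rho> \<Longrightarrow> \<rho> \<le> r1 \<Longrightarrow> lip_bound e \<tau> \<rho> 0 \<Phi> R (C1 \<rho> R)" using tameE[OF assms(1)] by metis
  show ?thesis
  proof (rule tameI[of r1 "\<lambda>\<rho> R. (\<rho> + 1) * C1 \<rho> R"])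
    fix \<rho> R \<tau> :: real assume \<tau>: "0 < \<tau>" "\<tau> \<le> \<rho>" "\<rho> \<le> r1"
    have \<rho>: "0 < \<rho>" using \<tau> by simp
    have L1: "lip_bound e \<tau> \<rho> 0 \<Phi> R (C1 \<rho> R)" using 1(3) \<tau> by auto
    show "lip_bound e \<tau> \<rho> 1 (\<lambda>z. shift e (\<Phi> z)) R ((\<rho> + 1) * C1 \<rho> R)"
    proof (rule lip_boundI)
      fix z assume z: "wbound (fw e \<tau> \<rho>) z R"
      show "wbound (fw e \<tau> \<rho>) (shift e (\<Phi> z)) ((\<rho> + 1) * C1 \<rho> R)"
        by (rule wbound_mono[OF wbound_shift_fw[OF lip_boundD1[OF L1 z] e \<tau>(1) \<rho>]])
           (use 1(2) \<tau> in \<open>auto intro!: mult_right_mono\<close>)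
    next
      fix z z' \<delta> assume \<delta>: "0 \<le> \<delta>" 
        and z: "wbound (fw e \<tau> \<rho>) z R" "wbound (fw e \<tau> \<rho>) z' R" "wbound (fw e \<tau> \<rho>) (z - z') \<delta>"
      have "\<tau> * (C1 \<rho> R * \<tau> ^ 0 * \<delta>) = 1 * (C1 \<rho> R * \<tau> * \<delta>)" by simp
      also have "\<dots> \<le> (\<rho> + 1) * (C1 \<rho> R * \<tau> * \<delta>)" 
        using 1(2) \<tau> \<delta> by (intro mult_right_mono) auto
      finally have "\<tau> * (C1 \<rho> R * \<tau> ^ 0 * \<delta>) \<le> (\<rho> + 1) * C1 \<rho> R * \<tau> ^ 1 * \<delta>" by (simp add: mult.assoc)
      from wbound_mono[OF wbound_shift_fw[OF lip_boundD2[OF L1 z] e \<tau>(1) \<rho>] this]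
      show "wbound (fw e \<tau> \<rho>) (shift e (\<Phi> z) - shift e (\<Phi> z')) ((\<rho> + 1) * C1 \<rho> R * \<tau> ^ 1 * \<delta>)"
        by (simp only: shift_diff)
    qed
  qed (use 1 in auto)
qed

lemma tame_weaken:
  assumes "tame e 1 \<Phi>" shows "tame e 0 \<Phi>"
proof -
  obtain r1 C1 where 1: "0 < r1" "\<And>\<rho> R. 0 \<le> C1 \<rho> R"
    "\<And>\<rho> R \<tau>. 0 < \<tau> \<Longrightarrow> \<tau> \<le> \<rho> \<Longrightarrow> \<rho> \<le> r1 \<Longrightarrow> lip_bound e \<tau> \<rho> 1 \<Phi> R (C1 \<rho> R)" using tameE[OF assms(1)] by metis
  show ?thesis
  proof (rule tameI[of r1 "\<lambda>\<rho> R. (\<rho> + 1) * C1 \<rho> R"])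
    fix \<rho> R \<tau> :: real assume \<tau>: "0 < \<tau>" "\<tau> \<le> \<rho>" "\<rho> \<le> r1"
    have L1: "lip_bound e \<tau> \<rho> 1 \<Phi> R (C1 \<rho> R)" using 1(3) \<tau> by auto
    show "lip_bound e \<tau> \<rho> 0 \<Phi> R ((\<rho> + 1) * C1 \<rho> R)"
    proof (rule lip_boundI)
      fix z assume z: "wbound (fw e \<tau> \<rho>) z R"
      have "1 * C1 \<rho> R \<le> (\<rho> + 1) * C1 \<rho> R" using 1(2) \<tau> by (intro mult_right_mono) auto
      then show "wbound (fw e \<tau> \<rho>) (\<Phi> z) ((\<rho> + 1) * C1 \<rho> R)"
        using wbound_mono[OF lip_boundD1[OF L1 z]] by simp
    next
      fix z z' \<delta> assume \<delta>: "0 \<le> \<delta>" 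
        and z: "wbound (fw e \<tau> \<rho>) z R" "wbound (fw e \<tau> \<rho>) z' R" "wbound (fw e \<tau> \<rho>) (z - z') \<delta>"
      have "\<tau> * (C1 \<rho> R * \<delta>) \<le> (\<rho> + 1) * (C1 \<rho> R * \<delta>)"
        using 1(2) \<tau> \<delta> by (intro mult_right_mono) auto
      then have "C1 \<rho> R * \<tau> ^ 1 * \<delta> \<le> (\<rho> + 1) * C1 \<rho> R * \<tau> ^ 0 * \<delta>" by (simp add: mult_ac)
      from wbound_mono[OF lip_boundD2[OF L1 z] this]
      show "wbound (fw e \<tau> \<rho>) (\<Phi> z - \<Phi> z') ((\<rho> + 1) * C1 \<rho> R * \<tau> ^ 0 * \<delta>)" .
    qed
  qed (use 1 in auto)
qed

section \<open>Admissible differential operators\<close>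

text \<open>
  An operator on functions that acts on Taylor coefficients at \<open>p\<close> by some \<open>\<Theta>\<close> and that becomes
  tame once the unknown is written as \<open>c0 + J z\<close>. The rules below build the right-hand side of the
  equation from its derivatives; those that produce \<open>j = 1\<close> are the sources of smallness.
\<close>

definition adm :: "'a \<Rightarrow> nat \<Rightarrow> (('a \<Rightarrow> real) \<Rightarrow> 'a \<Rightarrow> real) \<Rightarrow> bool" where
  "adm p j \<Psi> \<longleftrightarrow> (\<exists>\<Theta>. (\<forall>w r c. hasps w p r c \<longrightarrow> (\<exists>r'. hasps (\<Psi> w) p r' (\<Theta> c))) \<and>
     (\<forall>c0. majorized c0 \<longrightarrow> tame e j (\<lambda>z. \<Theta> (c0 + Jop e z))))"

lemma adm_const: 
  assumes "real_analytic_at A p" shows "adm p j (\<lambda>w. A)"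
proof -
  obtain r a where a: "hasps A p r a" using assms real_analytic_at_iff_hasps by blast
  show ?thesis unfolding adm_def
    by (rule exI[of _ "\<lambda>c. a"]) (use a tame_const[OF hasps_majorized[OF a]] in blast)
qed

lemma adm_add:
  assumes "adm p j \<Psi>1" "adm p j \<Psi>2" shows "adm p j (\<lambda>w x. \<Psi>1 w x + \<Psi>2 w x)"
proof -
  from assms(1) obtain \<Theta>1 where 1: "\<forall>w r c. hasps w p r c \<longrightarrow> (\<exists>r'. hasps (\<Psi>1 w) p r' (\<Theta>1 c))"
    "\<forall>c0. majorized c0 \<longrightarrow> tame e j (\<lambda>z. \<Theta>1 (c0 + Jop e z))" unfolding adm_def by blast
  from assms(2) obtain \<Theta>2 where 2: "\<forall>w r c. hasps w p r c \<longrightarrow> (\<exists>r'. hasps (\<Psi>2 w) p r' (\<Theta>2 c))"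
    "\<forall>c0. majorized c0 \<longrightarrow> tame e j (\<lambda>z. \<Theta>2 (c0 + Jop e z))" unfolding adm_def by blast
  show ?thesis unfolding adm_def
  proof (intro exI[of _ "\<lambda>c. \<Theta>1 c + \<Theta>2 c"] conjI allI impI)
    fix w r c assume "hasps w p r c"
    then obtain r1 where 3: "hasps (\<Psi>1 w) p r1 (\<Theta>1 c)" using 1(1) by blast
    from \<open>hasps w p r c\<close> obtain r2 where 4: "hasps (\<Psi>2 w) p r2 (\<Theta>2 c)" using 2(1) by blast
    show "\<exists>r'. hasps (\<lambda>x. \<Psi>1 w x + \<Psi>2 w x) p r' (\<Theta>1 c + \<Theta>2 c)"
      using hasps_add[OF 3 4] by blast
  next
    fix c0 :: "('a \<Rightarrow> nat) \<Rightarrow> real" assume "majorized c0"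
    show "tame e j (\<lambda>z. \<Theta>1 (c0 + Jop e z) + \<Theta>2 (c0 + Jop e z))"
      by (rule tame_add[OF 1(2)[rule_format, OF \<open>majorized c0\<close>] 2(2)[rule_format, OF \<open>majorized c0\<close>]])
  qed
qed

lemma adm_mult:
  assumes "adm p j \<Psi>1" "adm p j \<Psi>2" shows "adm p j (\<lambda>w x. \<Psi>1 w x * \<Psi>2 w x)"
proof -
  from assms(1) obtain \<Theta>1 where 1: "\<forall>w r c. hasps w p r c \<longrightarrow> (\<exists>r'. hasps (\<Psi>1 w) p r' (\<Theta>1 c))"
    "\<forall>c0. majorized c0 \<longrightarrow> tame e j (\<lambda>z. \<Theta>1 (c0 + Jop e z))" unfolding adm_def by blast
  from assms(2) obtain \<Theta>2 where 2: "\<forall>w r c. hasps w p r c \<longrightarrow> (\<exists>r'. hasps (\<Psi>2 w) p r' (\<Theta>2 c))"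
    "\<forall>c0. majorized c0 \<longrightarrow> tame e j (\<lambda>z. \<Theta>2 (c0 + Jop e z))" unfolding adm_def by blast
  show ?thesis unfolding adm_def
  proof (intro exI[of _ "\<lambda>c. conv (\<Theta>1 c) (\<Theta>2 c)"] conjI allI impI)
    fix w r c assume "hasps w p r c"
    then obtain r1 where 3: "hasps (\<Psi>1 w) p r1 (\<Theta>1 c)" using 1(1) by blast
    from \<open>hasps w p r c\<close> obtain r2 where 4: "hasps (\<Psi>2 w) p r2 (\<Theta>2 c)" using 2(1) by blast
    show "\<exists>r'. hasps (\<lambda>x. \<Psi>1 w x * \<Psi>2 w x) p r' (conv (\<Theta>1 c) (\<Theta>2 c))"
      using hasps_mult[OF 3 4] by blast
  next
    fix c0 :: "('a \<Rightarrow> nat) \<Rightarrow> real" assume "majorized c0"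
    show "tame e j (\<lambda>z. conv (\<Theta>1 (c0 + Jop e z)) (\<Theta>2 (c0 + Jop e z)))"
      by (rule tame_conv[OF 1(2)[rule_format, OF \<open>majorized c0\<close>] 2(2)[rule_format, OF \<open>majorized c0\<close>]])
  qed
qed

lemma adm_cmult:
  "real_analytic_at A p \<Longrightarrow> adm p j \<Psi> \<Longrightarrow> adm p j (\<lambda>w x. A x * \<Psi> w x)"
  by (rule adm_mult[OF adm_const])

lemma adm_time_factor:
  assumes "adm p 0 \<Psi>" shows "adm p 1 (\<lambda>w x. ((x - p) \<bullet> e) * \<Psi> w x)"
proof -
  from assms(1) obtain \<Theta>1 where 1: "\<forall>w r c. hasps w p r c \<longrightarrow> (\<exists>r'. hasps (\<Psi> w) p r' (\<Theta>1 c))"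
    "\<forall>c0. majorized c0 \<longrightarrow> tame e 0 (\<lambda>z. \<Theta>1 (c0 + Jop e z))" unfolding adm_def by blast
  show ?thesis unfolding adm_def
  proof (intro exI[of _ "\<lambda>c. shift e (\<Theta>1 c)"] conjI allI impI)
    fix w r c assume "hasps w p r c"
    then obtain r1 where 3: "hasps (\<Psi> w) p r1 (\<Theta>1 c)" using 1(1) by blast
    show "\<exists>r'. hasps (\<lambda>x. ((x - p) \<bullet> e) * \<Psi> w x) p r' (shift e (\<Theta>1 c))"
      using hasps_shift[OF 3 e] by blast
  next
    fix c0 :: "('a \<Rightarrow> nat) \<Rightarrow> real" assume "majorized c0"
    show "tame e 1 (\<lambda>z. shift e (\<Theta>1 (c0 + Jop e z)))"
      by (rule tame_shift[OF 1(2)[rule_format, OF \<open>majorized c0\<close>]])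
  qed
qed

lemma adm_weaken: "adm p 1 \<Psi> \<Longrightarrow> adm p 0 \<Psi>"
  unfolding adm_def using tame_weaken by blast

lemma adm_sum:
  assumes "\<And>i. i \<in> I \<Longrightarrow> adm p j (\<Psi> i)" shows "adm p j (\<lambda>w x. \<Sum>i\<in>I. \<Psi> i w x)"
  using assms by (induction I rule: infinite_finite_induct) (auto intro: adm_add adm_const)

text \<open>
  A bare \<open>\<partial>\<^sub>s w\<close> is bounded but not small; in the equation it only occurs together with a factor \<open>s\<close>.
\<close>

lemma adm_dd_time: "adm p 0 (\<lambda>w. dd e w)"
  unfolding adm_def
proof (intro exI[of _ "pderiv e"] conjI allI impI)
  fix w r c assume "hasps w p r c"
  then show "\<exists>r'. hasps (dd e w) p r' (pderiv e c)" using hasps_dd_half e by blast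
next
  fix c0 :: "('a \<Rightarrow> nat) \<Rightarrow> real" assume "majorized c0"
  then show "tame e 0 (\<lambda>z. pderiv e (c0 + Jop e z))"
    unfolding pderiv_add by (rule tame_affine[where K = "\<lambda>_. 1", OF majorized_pderiv[OF _ e]])
      (use e in \<open>auto simp: Jop_diff pderiv_diff intro: wbound_pderiv_Jop_time\<close>)
qed

context
  fixes b :: 'a
  assumes b: "b \<in> Basis" "b \<noteq> e"
begin

lemma adm_dd_space: "adm p 1 (\<lambda>w. dd b w)"
  unfolding adm_def
proof (intro exI[of _ "pderiv b"] conjI allI impI)
  fix w r c assume "hasps w p r c"
  then show "\<exists>r'. hasps (dd b w) p r' (pderiv b c)" using hasps_dd_half b by blast
next
  fix c0 :: "('a \<Rightarrow> nat) \<Rightarrow> real" assume "majorized c0"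
  then show "tame e 1 (\<lambda>z. pderiv b (c0 + Jop e z))"
    unfolding pderiv_add 
  proof (rule tame_affine[where K = "\<lambda>\<rho>. 1 / \<rho>", OF majorized_pderiv[OF _ b(1)]])
    fix \<tau> \<rho> N :: real and z assume "0 < \<tau>" "\<tau> \<le> \<rho>" "wbound (fw e \<tau> \<rho>) z N"
    then show "wbound (fw e \<tau> \<rho>) (pderiv b (Jop e z)) (1 / \<rho> * \<tau> ^ 1 * N)"
      using wbound_pderiv_Jop_space[OF _ e b, of \<tau> \<rho> z N] by simp
  qed (auto simp: Jop_diff pderiv_diff)
qed

lemma adm_dd_mixed: "adm p 1 (\<lambda>w x. ((x - p) \<bullet> e) * dd b (dd e w) x)"
  unfolding adm_def
proof (intro exI[of _ "\<lambda>c. shift e (pderiv b (pderiv e c))"] conjI allI impI)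
  fix w r c assume "hasps w p r c"
  then show "\<exists>r'. hasps (\<lambda>x. ((x - p) \<bullet> e) * dd b (dd e w) x) p r' (shift e (pderiv b (pderiv e c)))" 
    using hasps_shift[OF hasps_dd_half[OF hasps_dd_half[OF _ e] b(1)] e] by blast
next
  fix c0 :: "('a \<Rightarrow> nat) \<Rightarrow> real" assume "majorized c0"
  then have c0: "majorized (shift e (pderiv b (pderiv e c0)))" using majorized_shift majorized_pderiv e b by blast
  show "tame e 1 (\<lambda>z. shift e (pderiv b (pderiv e (c0 + Jop e z))))"
    unfolding pderiv_add shift_add
  proof (rule tame_affine[where K = "\<lambda>\<rho>. 1 / \<rho>", OF c0])
    fix \<tau> \<rho> N :: real and z assume "0 < \<tau>" "\<tau> \<le> \<rho>" "wbound (fw e \<tau> \<rho>) z N"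
    then show "wbound (fw e \<tau> \<rho>) (shift e (pderiv b (pderiv e (Jop e z)))) (1 / \<rho> * \<tau> ^ 1 * N)"
      using wbound_shift_pderiv2_Jop_mixed[OF _ e b, of \<tau> \<rho> z N] by simp
  qed (auto simp: Jop_diff pderiv_diff shift_diff)
qed

lemma adm_dd_space2: "adm p 1 (\<lambda>w x. ((x - p) \<bullet> e) * dd b (dd b w) x)"
  unfolding adm_def
proof (intro exI[of _ "\<lambda>c. shift e (pderiv b (pderiv b c))"] conjI allI impI)
  fix w r c assume "hasps w p r c"
  then show "\<exists>r'. hasps (\<lambda>x. ((x - p) \<bullet> e) * dd b (dd b w) x) p r' (shift e (pderiv b (pderiv b c)))" 
    using hasps_shift[OF hasps_dd_half[OF hasps_dd_half[OF _ b(1)] b(1)] e] by blast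
next
  fix c0 :: "('a \<Rightarrow> nat) \<Rightarrow> real" assume "majorized c0"
  then have c0: "majorized (shift e (pderiv b (pderiv b c0)))" using majorized_shift majorized_pderiv e b by blast
  show "tame e 1 (\<lambda>z. shift e (pderiv b (pderiv b (c0 + Jop e z))))"
    unfolding pderiv_add shift_add
  proof (rule tame_affine[where K = "\<lambda>\<rho>. 1 / \<rho>", OF c0])
    fix \<tau> \<rho> N :: real and z assume \<tau>: "0 < \<tau>" "\<tau> \<le> \<rho>" and z: "wbound (fw e \<tau> \<rho>) z N"
    have "\<tau> / \<rho> * (\<tau> / \<rho>) \<le> \<tau> / \<rho> * 1" using \<tau> by (intro mult_left_mono) auto
    from mult_right_mono[OF this wbound_nonneg[OF z]]
    have "\<tau> / \<rho> * (\<tau> / \<rho> * N) \<le> 1 / \<rho> * \<tau> ^ 1 * N" by simp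
    from wbound_mono[OF wbound_shift_pderiv2_Jop_space[OF z e b \<tau>(1)] this] \<tau>
    show "wbound (fw e \<tau> \<rho>) (shift e (pderiv b (pderiv b (Jop e z)))) (1 / \<rho> * \<tau> ^ 1 * N)" by simp
  qed (auto simp: Jop_diff pderiv_diff shift_diff)
qed

end

end

section \<open>The Fuchsian equation\<close>

text \<open>
  Coefficients of \<open>s w\<^sub>s\<^sub>s + 2 w\<^sub>s\<close>.
\<close>

definition fuchs_coeff :: "'a \<Rightarrow> (('a \<Rightarrow> nat) \<Rightarrow> real) \<Rightarrow> ('a \<Rightarrow> nat) \<Rightarrow> real" where
  "fuchs_coeff e c \<alpha> = (real (\<alpha> e) + 1) * (real (\<alpha> e) + 2) * c (\<alpha> + unit_index e)"

definition fuchs_op :: "'a::euclidean_space \<Rightarrow> 'a \<Rightarrow> ('a \<Rightarrow> real) \<Rightarrow> 'a \<Rightarrow> real" where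
  "fuchs_op e p w x = ((x - p) \<bullet> e) * dd e (dd e w) x + 2 * dd e w x"

lemma hasps_fuchs_op:
  assumes w: "hasps w p r c" and e: "e \<in> Basis"
  shows "\<exists>r'. hasps (fuchs_op e p w) p r' (fuchs_coeff e c)"
proof -
  have "\<exists>r'. hasps (fuchs_op e p w) p r' (shift e (pderiv e (pderiv e c)) + (\<lambda>\<alpha>. 2 * pderiv e c \<alpha>))"
    using hasps_add[OF hasps_shift[OF hasps_dd_half[OF hasps_dd_half[OF w e] e] e] hasps_scale[OF hasps_dd_half[OF w e], of 2]]
    unfolding fuchs_op_def[abs_def] by blast
  moreover have "fuchs_coeff e c \<alpha> = (shift e (pderiv e (pderiv e c)) + (\<lambda>\<alpha>. 2 * pderiv e c \<alpha>)) \<alpha>" for \<alpha>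
  proof (cases "\<alpha> e = 0")
    case False
    then have "pderiv e (pderiv e c) (\<alpha> - unit_index e) = real (\<alpha> e) * pderiv e c \<alpha>"
      using index_eq_add_unit[of \<alpha> e] by (simp add: pderiv_def[of e "pderiv e c"])
    then show ?thesis using False by (simp add: fuchs_coeff_def shift_def pderiv_def algebra_simps)
  qed (simp add: fuchs_coeff_def shift_def pderiv_def)
  ultimately show ?thesis using hasps_cong_coeff by blast
qed

lemma trunc_add_Jop_fuchs_coeff: "trunc e c + Jop e (fuchs_coeff e c) = c"
proof
  fix \<alpha> :: "'a \<Rightarrow> nat"
  show "(trunc e c + Jop e (fuchs_coeff e c)) \<alpha> = c \<alpha>"
  proof (cases "\<alpha> e = 0")
    case False
    then have "\<alpha> - unit_index e + unit_index e = \<alpha>" using index_eq_add_unit[of \<alpha> e] by simp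
    then have "fuchs_coeff e c (\<alpha> - unit_index e) = real (\<alpha> e) * (real (\<alpha> e) + 1) * c \<alpha>"
      using False unfolding fuchs_coeff_def by (simp add: of_nat_diff Suc_le_eq)
    then show ?thesis using False by (simp add: trunc_def Jop_def)
  qed (simp add: trunc_def Jop_def)
qed

lemma fuchs_coeff_trunc_add_Jop: "fuchs_coeff e (trunc e c + Jop e z) = z"
proof
  fix \<alpha> :: "'a \<Rightarrow> nat"
  have "real (\<alpha> e) + 1 \<noteq> 0" "real (\<alpha> e) + 2 \<noteq> 0" by linarith+
  then show "fuchs_coeff e (trunc e c + Jop e z) \<alpha> = z \<alpha>"
    by (simp add: fuchs_coeff_def trunc_def Jop_def add_ac)
qed

lemma wbound_Jop:
  assumes z: "wbound (fw e \<tau> \<rho>) z M" and e: "e \<in> Basis" "0 < \<tau>" "0 < \<rho>"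
  shows "wbound (fw e \<tau> \<rho>) (Jop e z) (\<tau> * M)"
proof -
  have "wbound (fw e \<tau> \<rho>) (\<lambda>\<alpha>. z \<alpha> / ((real (\<alpha> e) + 1) * (real (\<alpha> e) + 2))) M"
  proof (rule wbound_dominated[OF z])
    fix \<alpha> :: "'a \<Rightarrow> nat"
    have "1 * 1 \<le> (real (\<alpha> e) + 1) * (real (\<alpha> e) + 2)" by (intro mult_mono) auto
    then show "\<bar>z \<alpha> / ((real (\<alpha> e) + 1) * (real (\<alpha> e) + 2))\<bar> \<le> \<bar>z \<alpha>\<bar>" by (intro abs_divide_le) simp
  qed (use fw_pos[OF e] in \<open>auto simp: less_imp_le\<close>)
  then have "wbound (fw e \<tau> \<rho>) (shift e (\<lambda>\<alpha>. z \<alpha> / ((real (\<alpha> e) + 1) * (real (\<alpha> e) + 2)))) (\<tau> * M)"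
    using wbound_shift_fw e by fastforce
  moreover have "shift e (\<lambda>\<alpha>. z \<alpha> / ((real (\<alpha> e) + 1) * (real (\<alpha> e) + 2))) = Jop e z"
    by (auto simp: fun_eq_iff shift_def Jop_def of_nat_diff Suc_le_eq)
  ultimately show ?thesis by simp
qed

text \<open>
  The coefficients of \<open>w0\<close> are truncated first, since \<open>w0\<close> may depend on \<open>s\<close> while only its values
  at \<open>s = 0\<close> are prescribed.
\<close>

theorem fuchs_existence:
  assumes e: "e \<in> Basis" and \<Psi>: "adm e p 1 \<Psi>" and w0: "real_analytic_at w0 p"
  shows "\<exists>w. real_analytic_at w p \<and> (\<forall>\<^sub>F x in nhds p. fuchs_op e p w x = \<Psi> w x) \<and>
    (\<forall>\<^sub>F x in nhds p. (x - p) \<bullet> e = 0 \<longrightarrow> w x = w0 x)"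
proof -
  obtain r0 c where c: "hasps w0 p r0 c" using w0 real_analytic_at_iff_hasps by blast
  obtain \<Theta> where \<Theta>: "\<And>w r c. hasps w p r c \<Longrightarrow> \<exists>r'. hasps (\<Psi> w) p r' (\<Theta> c)"
    "\<And>c0. majorized c0 \<Longrightarrow> tame e 1 (\<lambda>z. \<Theta> (c0 + Jop e z))" 
    using \<Psi> unfolding adm_def[OF e] by blast
  obtain M0 where M0: "0 < r0" "wbound (pw r0) c M0" using c by (auto simp: hasps_def)
  have tr: "wbound (pw r0) (trunc e c) M0" using wbound_trunc[OF M0(2)] M0(1) by simp
  then have "majorized (trunc e c)" using M0(1) by (auto simp: majorized_def)
  from tame_fixed_point[OF e \<Theta>(2)[OF this]]
  obtain \<tau> \<rho> z M where \<tau>: "0 < \<tau>" "\<tau> \<le> \<rho>" and z: "wbound (fw e \<tau> \<rho>) z M"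
    and fixz: "\<And>\<alpha>. \<alpha> \<in> MI \<Longrightarrow> \<Theta> (trunc e c + Jop e z) \<alpha> = z \<alpha>" by metis
  define r where "r = min r0 (\<tau> / 2)"
  have r: "0 < r" "r \<le> r0" "r \<le> \<tau> / 2" using M0(1) \<tau>(1) by (auto simp: r_def)
  have J: "wbound (pw r) (Jop e z) (\<tau> * M)"
    by (rule wbound_pw_mono[OF wbound_weight_mono[OF wbound_Jop[OF z e \<tau>(1)] pw_le_fw[OF e \<tau>]]]) (use \<tau> r in auto)
  have tr': "wbound (pw r) (trunc e c) M0" by (rule wbound_pw_mono[OF tr]) (use r in auto)
  define w where "w x = psum (trunc e c + Jop e z) (x - p)" for x
  have w: "hasps w p r (trunc e c + Jop e z)"
    unfolding w_def by (rule hasps_psum[OF r(1) wbound_add[OF tr' J]]) (use r in auto)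
  obtain r1 where r1: "hasps (\<Psi> w) p r1 (\<Theta> (trunc e c + Jop e z))" using \<Theta>(1)[OF w] by blast
  have 1: "hasps (\<Psi> w) p r1 z" by (rule hasps_cong_coeff[OF r1]) (simp add: fixz)
  obtain r2 where "hasps (fuchs_op e p w) p r2 (fuchs_coeff e (trunc e c + Jop e z))" 
    using hasps_fuchs_op[OF w e] by blast
  then have 2: "hasps (fuchs_op e p w) p r2 z" unfolding fuchs_coeff_trunc_add_Jop .
  have "\<forall>\<^sub>F x in nhds p. fuchs_op e p w x = \<Psi> w x"
    using hasps_imp_eventually[OF 1] hasps_imp_eventually[OF 2] by eventually_elim simp
  moreover have "\<forall>\<^sub>F x in nhds p. (x - p) \<bullet> e = 0 \<longrightarrow> w x = w0 x"
    using eventually_inbox[OF r(1), of p]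
  proof eventually_elim
    case (elim x)
    show ?case
    proof
      assume x: "(x - p) \<bullet> e = 0"
      have t: "trunc e (trunc e c + Jop e z) = trunc e c" by (auto simp: fun_eq_iff trunc_def Jop_def)
      have "w x = psum (trunc e (trunc e c + Jop e z)) (x - p)"
        unfolding w_def psum_trunc[OF e, of "trunc e c + Jop e z"] using x by simp
      also have "\<dots> = psum c (x - p)" unfolding t psum_trunc[OF e] using x by simp
      also have "\<dots> = w0 x" using c inbox_mono[OF elim r(2)] by (simp add: hasps_def)
      finally show "w x = w0 x" .
    qed
  qed
  ultimately show ?thesis using hasps_analytic[OF w] by blast
qed

lemma closure_positive_side:
  assumes "e \<in> Basis" shows "p \<in> closure {x. (x - p) \<bullet> e > 0}"
  unfolding closure_approachable
proof (intro allI impI)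
  fix d :: real assume d: "0 < d"
  show "\<exists>y\<in>{x. (x - p) \<bullet> e > 0}. dist y p < d"
    by (rule bexI[of _ "p + (d/2) *\<^sub>R e"]) (use assms d in \<open>auto simp: dist_norm\<close>)
qed

lemma normalized_coeffs:
  assumes "real_analytic_at w p"
  obtains r c where "hasps w p r c" "\<And>\<alpha>. \<alpha> \<notin> MI \<Longrightarrow> c \<alpha> = 0"
proof -
  obtain r c where c: "hasps w p r c" using assms real_analytic_at_iff_hasps by blast
  have "hasps w p r (\<lambda>\<alpha>. if \<alpha> \<in> MI then c \<alpha> else 0)" by (rule hasps_cong_coeff[OF c]) simp
  then show ?thesis using that by auto
qed

text \<open>
  The equation is assumed for \<open>s > 0\<close> only. By the identity theorem it still holds for the Taylor
  coefficients, where the contraction applies.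
\<close>

theorem fuchs_uniqueness:
  assumes e: "e \<in> Basis" and \<Psi>: "adm e p 1 \<Psi>" 
    and w1: "real_analytic_at w1 p" "\<forall>\<^sub>F x in nhds p. (x - p) \<bullet> e > 0 \<longrightarrow> fuchs_op e p w1 x = \<Psi> w1 x"
    and w2: "real_analytic_at w2 p" "\<forall>\<^sub>F x in nhds p. (x - p) \<bullet> e > 0 \<longrightarrow> fuchs_op e p w2 x = \<Psi> w2 x"
    and eq: "\<forall>\<^sub>F x in nhds p. (x - p) \<bullet> e = 0 \<longrightarrow> w1 x = w2 x"
  shows "\<forall>\<^sub>F x in nhds p. w1 x = w2 x"
proof -
  (* With coefficients that vanish off the multi-indices, equal restrictions to s = 0 give equal
     truncated families, and both solutions are fixed points of one and the same map. *)
  obtain r1 c1 where c1: "hasps w1 p r1 c1" "\<And>\<alpha>. \<alpha> \<notin> MI \<Longrightarrow> c1 \<alpha> = 0" using normalized_coeffs[OF w1(1)] by metis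
  obtain r2 c2 where c2: "hasps w2 p r2 c2" "\<And>\<alpha>. \<alpha> \<notin> MI \<Longrightarrow> c2 \<alpha> = 0" using normalized_coeffs[OF w2(1)] by metis
  obtain \<Theta> where \<Theta>: "\<And>w r c. hasps w p r c \<Longrightarrow> \<exists>r'. hasps (\<Psi> w) p r' (\<Theta> c)"
    "\<And>c0. majorized c0 \<Longrightarrow> tame e 1 (\<lambda>z. \<Theta> (c0 + Jop e z))" 
    using \<Psi> unfolding adm_def[OF e] by blast
  have op: "open {x. (x - p) \<bullet> e > 0}" by (intro open_Collect_less continuous_intros)
  have solves: "\<Theta> c \<alpha> = fuchs_coeff e c \<alpha>" 
    if w: "hasps w p r c" and eqn: "\<forall>\<^sub>F x in nhds p. (x - p) \<bullet> e > 0 \<longrightarrow> fuchs_op e p w x = \<Psi> w x" and \<alpha>: "\<alpha> \<in> MI" 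
    for w r c \<alpha>
  proof -
    obtain s1 where s1: "hasps (\<Psi> w) p s1 (\<Theta> c)" using \<Theta>(1)[OF w] by blast
    obtain s2 where s2: "hasps (fuchs_op e p w) p s2 (fuchs_coeff e c)" using hasps_fuchs_op[OF w e] by blast
    obtain d where d: "d > 0" "\<And>x. dist x p < d \<Longrightarrow> (x - p) \<bullet> e > 0 \<longrightarrow> fuchs_op e p w x = \<Psi> w x"
      using eqn unfolding eventually_nhds_metric by blast
    have "(\<Theta> c - fuchs_coeff e c) \<alpha> = 0"
      by (rule hasps_vanishing_coeffs[OF op closure_positive_side[OF e] hasps_diff[OF s1 s2] d(1) _ \<alpha> refl])
         (use d(2) in auto)
    then show ?thesis by simp
  qed
  have t: "trunc e c1 = trunc e c2"
  proof
    fix \<alpha> :: "'a \<Rightarrow> nat"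
    have h: "hasps (\<lambda>x. w1 x - w2 x) p (min r1 r2) (c1 - c2)" by (rule hasps_diff[OF c1(1) c2(1)])
    obtain s where s: "0 < s" "\<And>x. inbox s (x - p) \<Longrightarrow> (x - p) \<bullet> e = 0 \<longrightarrow> w1 x = w2 x"
      using eventually_nhds_box[OF eq] by metis
    define r where "r = min s (min r1 r2)"
    have h': "hasps (\<lambda>x. w1 x - w2 x) p r (c1 - c2)" unfolding r_def by (rule hasps_min2[OF h s(1)])
    have r: "0 < r" "r \<le> s" using hasps_pos[OF h'] by (auto simp: r_def)
    obtain N where "wbound (pw r) (c1 - c2) N" using h' by (auto simp: hasps_def)
    then have N: "wbound (pw r) (trunc e (c1 - c2)) N" using wbound_trunc r by force
    have z: "psum (trunc e (c1 - c2)) (x - p) = 0" if x: "inbox r (x - p)" for x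
    proof -
      let ?h = "(x - p) - ((x - p) \<bullet> e) *\<^sub>R e"
      have i: "inbox r ((p + ?h) - p)" using inbox_project[OF e x] by (simp only: add_diff_cancel_left')
      have "((p + ?h) - p) \<bullet> e = 0" using e by (simp add: inner_diff_left)
      then have "w1 (p + ?h) - w2 (p + ?h) = 0" using s(2)[OF inbox_mono[OF i r(2)]] by simp
      moreover have "w1 (p + ?h) - w2 (p + ?h) = psum (c1 - c2) ((p + ?h) - p)"
        using h' i unfolding hasps_def by blast
      ultimately show ?thesis unfolding psum_trunc[OF e] by (simp only: add_diff_cancel_left')
    qed
    obtain d where d: "0 < d" "\<And>x. dist x p < d \<Longrightarrow> inbox r (x - p)"
      using eventually_inbox[OF r(1), of p] unfolding eventually_nhds_metric by blast
    have "trunc e (c1 - c2) \<alpha> = 0" if "\<alpha> \<in> MI"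
      by (rule hasps_vanishing_coeffs[OF open_UNIV _ hasps_psum[OF r(1) N] d(1) _ that refl, of p])
         (use z d in auto)
    then show "trunc e c1 \<alpha> = trunc e c2 \<alpha>"
      using c1(2)[of \<alpha>] c2(2)[of \<alpha>] by (cases "\<alpha> \<in> MI") (auto simp: trunc_def split: if_splits)
  qed
  define \<Phi> where "\<Phi> z = \<Theta> (trunc e c1 + Jop e z)" for z
  define z1 where "z1 = fuchs_coeff e c1"
  define z2 where "z2 = fuchs_coeff e c2"
  have d1: "trunc e c1 + Jop e z1 = c1" unfolding z1_def by (rule trunc_add_Jop_fuchs_coeff)
  have d2: "trunc e c1 + Jop e z2 = c2" unfolding z2_def t by (rule trunc_add_Jop_fuchs_coeff)
  have f1: "\<Phi> z1 \<alpha> = z1 \<alpha>" if "\<alpha> \<in> MI" for \<alpha> 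
    unfolding \<Phi>_def d1 unfolding z1_def by (rule solves[OF c1(1) w1(2) that])
  have f2: "\<Phi> z2 \<alpha> = z2 \<alpha>" if "\<alpha> \<in> MI" for \<alpha> 
    unfolding \<Phi>_def d2 unfolding z2_def by (rule solves[OF c2(1) w2(2) that])
  obtain s1 M1 where s1: "0 < s1" "wbound (pw s1) z1 M1" 
    using hasps_fuchs_op[OF c1(1) e] by (auto simp: hasps_def z1_def)
  obtain s2 M2 where s2: "0 < s2" "wbound (pw s2) z2 M2" 
    using hasps_fuchs_op[OF c2(1) e] by (auto simp: hasps_def z2_def)
  have "majorized c1" by (rule hasps_majorized[OF c1(1)])
  then have "majorized (trunc e c1)" unfolding majorized_def using wbound_trunc[of "pw _" c1] by force
  then have tame: "tame e 1 \<Phi>" unfolding \<Phi>_def by (rule \<Theta>(2))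
  have m1: "wbound (pw (min s1 s2)) z1 M1" by (rule wbound_pw_mono[OF s1(2)]) (use s1 s2 in auto)
  have m2: "wbound (pw (min s1 s2)) z2 M2" by (rule wbound_pw_mono[OF s2(2)]) (use s1 s2 in auto)
  have zz: "z1 \<alpha> = z2 \<alpha>" if "\<alpha> \<in> MI" for \<alpha>
    by (rule tame_fixed_point_unique[OF e tame m1 f1 m2 f2 _ that]) (use s1 s2 in auto)
  have "c1 \<alpha> = c2 \<alpha>" if "\<alpha> \<in> MI" for \<alpha>
  proof -
    have "Jop e z1 \<alpha> = Jop e z2 \<alpha>" using zz[of "\<alpha> - unit_index e"] that by (simp add: Jop_def)
    then have "(trunc e c1 + Jop e z1) \<alpha> = (trunc e c1 + Jop e z2) \<alpha>" by simp
    then show ?thesis unfolding d1 d2 .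
  qed
  then have eq: "psum c1 h = psum c2 h" for h by (rule psum_cong)
  show ?thesis
    using hasps_imp_eventually[OF c1(1)] hasps_imp_eventually[OF c2(1)] by eventually_elim (simp add: eq)
qed

section \<open>Straightening the hypersurface\<close>

abbreviation et :: "real \<times> (real ^ 'n::finite)" where
  "et \<equiv> (1, 0)"

abbreviation ex :: "'n::finite \<Rightarrow> real \<times> (real ^ 'n)" where
  "ex i \<equiv> (0, axis i 1)"

lemma et_Basis [simp]: "et \<in> Basis"
  by (simp add: Basis_prod_def)

lemma axis_Basis [simp]: "(axis i 1 :: real ^ 'n::finite) \<in> Basis"
  by (simp add: axis_in_Basis_iff)

lemma ex_Basis [simp]: "ex i \<in> Basis"
  by (simp add: Basis_prod_def)

lemma ex_neq_et [simp]: "ex i \<noteq> et" "et \<noteq> ex i"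
  by auto

lemma Basis_cases:
  assumes "b \<in> (Basis :: (real \<times> (real ^ 'n::finite)) set)"
  obtains "b = et" | i where "b = ex i"
  using assms by (auto simp: Basis_prod_def Basis_vec_def)

lemma inner_et [simp]: "P \<bullet> et = fst P"
  by (cases P) simp

lemma inner_ex [simp]: "P \<bullet> ex i = snd P $ i"
  by (cases P) (simp add: cart_eq_inner_axis)

lemma deriv_shift_0: "deriv f a = deriv (\<lambda>s. f (a + s)) (0::real)" for f :: "real \<Rightarrow> real"
proof -
  have "(f has_field_derivative D) (at a) \<longleftrightarrow> ((\<lambda>s. f (a + s)) has_field_derivative D) (at 0)" for D
    using DERIV_shift[of f D 0 a] by (simp add: add.commute)
  then show ?thesis by (simp add: deriv_def)
qed

lemma partial_t_eq_dd: "partial_t u = dd et u"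
  by (auto simp: fun_eq_iff partial_t_def dd_def deriv_shift_0[of "\<lambda>s. u (s, _)"])

lemma partial_x_eq_dd: "partial_x i (\<lambda>y. u (t, y)) x = dd (ex i) u (t, x)"
  by (simp add: partial_x_def dd_def)

lemma partial_x_eq_dd': "partial_x i g = dd (axis i 1) g"
  by (simp add: fun_eq_iff partial_x_def dd_def)

lemma solves_wave_at_iff:
  "solves_wave_at f u t x \<longleftrightarrow> dd et (dd et u) (t, x) - (\<Sum>i\<in>UNIV. dd (ex i) (dd (ex i) u) (t, x))
     = f (t, x) (dd et u (t, x), \<chi> i. dd (ex i) u (t, x))"
proof -
  have "partial_x i (\<lambda>y. u (t, y)) = (\<lambda>y. dd (ex i) u (t, y))" for i
    by (rule ext) (rule partial_x_eq_dd)
  then show ?thesis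
    unfolding solves_wave_at_def laplacian_def grad_def partial_t_eq_dd by (simp add: partial_x_eq_dd)
qed

lemma eventually_dd_cong:
  assumes "\<forall>\<^sub>F x in nhds p. f x = g x" shows "\<forall>\<^sub>F x in nhds p. dd b f x = dd b g x"
proof -
  have "\<forall>\<^sub>F x in nhds p. \<forall>\<^sub>F y in nhds x. f y = g y" using assms by (simp add: eventually_eventually)
  then show ?thesis by eventually_elim (rule dd_cong_ev)
qed

lemma solves_wave_at_cong:
  assumes "\<forall>\<^sub>F p in nhds (t, x). u p = u' p"
  shows "solves_wave_at f u t x \<longleftrightarrow> solves_wave_at f u' t x"
proof -
  have "dd b u (t, x) = dd b u' (t, x)" "dd b (dd b u) (t, x) = dd b (dd b u') (t, x)" for b
    using dd_cong_ev[OF assms] dd_cong_ev[OF eventually_dd_cong[OF assms]] by auto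
  then show ?thesis unfolding solves_wave_at_iff by simp
qed

lemma eventually_nhds_cont:
  assumes "isCont g p" "\<forall>\<^sub>F y in nhds (g p). Q y" shows "\<forall>\<^sub>F x in nhds p. Q (g x)"
  using eventually_compose_filterlim[OF assms(2), of g "nhds p"] assms(1) 
  by (simp add: isCont_def tendsto_at_iff_tendsto_nhds)

lemma ra_snd:
  fixes P :: "real \<times> (real ^ 'n::finite)"
  assumes "real_analytic_at g (snd P)" shows "real_analytic_at (\<lambda>P. g (snd P)) P"
proof (rule ra_compose[where f = g and g = snd])
  fix b :: "real ^ 'n" assume "b \<in> Basis"
  then have "(0::real, b) \<in> Basis" by (simp add: Basis_prod_def)
  from ra_coord[OF this, of P] show "real_analytic_at (\<lambda>P. snd P \<bullet> b) P"
    by (simp add: inner_prod_def)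
qed (rule assms)

lemma ra_fst: "real_analytic_at (\<lambda>P. fst P) (P :: real \<times> (real ^ 'n::finite))"
  using ra_coord[of et P] by simp

lemma ra_pair:
  fixes P :: "'c::euclidean_space"
  assumes g: "real_analytic_at g (F P, G P)" and F: "real_analytic_at F P" 
    and G: "\<And>i. real_analytic_at (\<lambda>P. G P $ i) P"
  shows "real_analytic_at (\<lambda>P. g (F P, (G P :: real ^ 'n::finite))) P"
proof (rule ra_compose[where f = g and g = "\<lambda>P. (F P, G P)"])
  fix b :: "real \<times> (real ^ 'n)" assume "b \<in> Basis"
  then show "real_analytic_at (\<lambda>P. (F P, G P) \<bullet> b) P"
    by (cases rule: Basis_cases) (use F G in simp_all)
qed (rule g)

lemma ra_snd_nth: "real_analytic_at (\<lambda>P. snd P $ i) (P :: real \<times> (real ^ 'n::finite))"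
  using ra_coord[OF ex_Basis, of i P] by simp

text \<open>
  The coordinates \<open>(s, x)\<close> as functions of \<open>(t, x)\<close>; \<open>unflat\<close> is the inverse map.
\<close>

definition flat :: "((real ^ 'n) \<Rightarrow> real) \<Rightarrow> real \<times> (real ^ 'n) \<Rightarrow> real \<times> (real ^ 'n::finite)" where
  "flat \<psi> P = (fst P - \<psi> (snd P), snd P)"

definition unflat :: "((real ^ 'n) \<Rightarrow> real) \<Rightarrow> real \<times> (real ^ 'n) \<Rightarrow> real \<times> (real ^ 'n::finite)" where
  "unflat \<psi> P = (fst P + \<psi> (snd P), snd P)"

lemma flat_unflat [simp]: "flat \<psi> (unflat \<psi> P) = P" "unflat \<psi> (flat \<psi> P) = P"
  by (auto simp: flat_def unflat_def)

lemma ra_flat: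
  assumes "real_analytic_at \<psi> (snd P)" "real_analytic_at g (flat \<psi> P)"
  shows "real_analytic_at (\<lambda>P. g (flat \<psi> P)) P"
  unfolding flat_def
proof (rule ra_pair)
  show "real_analytic_at (\<lambda>P. fst P - \<psi> (snd P)) P" by (rule ra_diff[OF ra_fst ra_snd[OF assms(1)]])
  show "real_analytic_at g (fst P - \<psi> (snd P), snd P)" using assms(2) by (simp only: flat_def)
qed (rule ra_snd_nth)

lemma ra_unflat:
  assumes "real_analytic_at \<psi> (snd P)" "real_analytic_at g (unflat \<psi> P)"
  shows "real_analytic_at (\<lambda>P. g (unflat \<psi> P)) P"
  unfolding unflat_def
proof (rule ra_pair)
  show "real_analytic_at (\<lambda>P. fst P + \<psi> (snd P)) P" by (rule ra_add[OF ra_fst ra_snd[OF assms(1)]])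
  show "real_analytic_at g (fst P + \<psi> (snd P), snd P)" using assms(2) by (simp only: unflat_def)
qed (rule ra_snd_nth)

lemma isCont_flat: "real_analytic_at \<psi> (snd P) \<Longrightarrow> isCont (flat \<psi>) P"
  unfolding flat_def[abs_def] using ra_isCont[OF ra_snd[of \<psi> P]] by (intro continuous_intros)

lemma isCont_unflat: "real_analytic_at \<psi> (snd P) \<Longrightarrow> isCont (unflat \<psi>) P"
  unfolding unflat_def[abs_def] using ra_isCont[OF ra_snd[of \<psi> P]] by (intro continuous_intros)

text \<open>
  Stated for merely differentiable \<open>g\<close>, so that it applies to the logarithm.
\<close>

lemma dd_flat:
  assumes \<psi>: "real_analytic_at \<psi> (snd P)" and g: "(g has_derivative F) (at (flat \<psi> P))"
  shows "dd et (\<lambda>P. g (flat \<psi> P)) P = F et"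
    and "dd (ex i) (\<lambda>P. g (flat \<psi> P)) P = F (ex i) - dd (axis i 1) \<psi> (snd P) * F et"
proof -
  interpret F: bounded_linear F by (rule has_derivative_bounded_linear[OF g])
  obtain G where G: "(\<psi> has_derivative G) (at (snd P))" using ra_has_derivative[OF \<psi>] by blast
  interpret G: bounded_linear G by (rule has_derivative_bounded_linear[OF G])
  have "(snd has_derivative snd) (at P)" by (auto intro!: derivative_eq_intros)
  from has_derivative_compose[where g = \<psi>, OF this G]
  have "((\<lambda>P. \<psi> (snd P)) has_derivative (\<lambda>k. G (snd k))) (at P)" .
  then have "(flat \<psi> has_derivative (\<lambda>k. (fst k - G (snd k), snd k))) (at P)"
    unfolding flat_def[abs_def] by (auto intro!: derivative_eq_intros)
  from has_derivative_compose[OF this g]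
  have D: "((\<lambda>P. g (flat \<psi> P)) has_derivative (\<lambda>k. F (fst k - G (snd k), snd k))) (at P)" .
  show "dd et (\<lambda>P. g (flat \<psi> P)) P = F et"
    unfolding dd_eqI[OF D] by (simp add: G.zero)
  have "(- G (axis i 1), axis i 1) = ex i - G (axis i 1) *\<^sub>R et" by simp
  then have "F (- G (axis i 1), axis i 1) = F (ex i) - G (axis i 1) *\<^sub>R F et"
    by (simp only: F.diff F.scaleR)
  then show "dd (ex i) (\<lambda>P. g (flat \<psi> P)) P = F (ex i) - dd (axis i 1) \<psi> (snd P) * F et"
    unfolding dd_eqI[OF D] dd_eqI[OF G] by simp
qed

lemma ra_obtain_derivative:
  assumes "real_analytic_at f p" obtains F where "(f has_derivative F) (at p)" "\<And>b. F b = dd b f p"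
  by (rule that[OF ra_has_derivative[OF assms]]) (rule dd_eqI[OF ra_has_derivative[OF assms], symmetric])

lemma dd_flat_ra:
  assumes \<psi>: "real_analytic_at \<psi> (snd P)" and g: "real_analytic_at g (flat \<psi> P)"
  shows "dd et (\<lambda>P. g (flat \<psi> P)) P = dd et g (flat \<psi> P)"
    and "dd (ex i) (\<lambda>P. g (flat \<psi> P)) P = dd (ex i) g (flat \<psi> P) - dd (axis i 1) \<psi> (snd P) * dd et g (flat \<psi> P)"
proof -
  obtain F where F: "(g has_derivative F) (at (flat \<psi> P))" "\<And>b. F b = dd b g (flat \<psi> P)"
    by (rule ra_obtain_derivative[OF g]) blast
  show "dd et (\<lambda>P. g (flat \<psi> P)) P = dd et g (flat \<psi> P)"
    using dd_flat(1)[OF \<psi> F(1)] by (simp only: F(2))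
  show "dd (ex i) (\<lambda>P. g (flat \<psi> P)) P = dd (ex i) g (flat \<psi> P) - dd (axis i 1) \<psi> (snd P) * dd et g (flat \<psi> P)"
    using dd_flat(2)[OF \<psi> F(1)] by (simp only: F(2))
qed

lemma dd_add: 
  assumes "real_analytic_at f p" "real_analytic_at g p" 
  shows "dd b (\<lambda>x. f x + g x) p = dd b f p + dd b g p"
proof -
  obtain F where F: "(f has_derivative F) (at p)" "\<And>b. F b = dd b f p" 
    by (rule ra_obtain_derivative[OF assms(1)]) blast
  obtain G where G: "(g has_derivative G) (at p)" "\<And>b. G b = dd b g p" 
    by (rule ra_obtain_derivative[OF assms(2)]) blast
  show ?thesis using dd_eqI[OF has_derivative_add[OF F(1) G(1)], of b] by (simp only: F(2) G(2))
qed

lemma dd_diff: 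
  assumes "real_analytic_at f p" "real_analytic_at g p" 
  shows "dd b (\<lambda>x. f x - g x) p = dd b f p - dd b g p"
proof -
  obtain F where F: "(f has_derivative F) (at p)" "\<And>b. F b = dd b f p" 
    by (rule ra_obtain_derivative[OF assms(1)]) blast
  obtain G where G: "(g has_derivative G) (at p)" "\<And>b. G b = dd b g p" 
    by (rule ra_obtain_derivative[OF assms(2)]) blast
  show ?thesis using dd_eqI[OF has_derivative_diff[OF F(1) G(1)], of b] by (simp only: F(2) G(2))
qed

lemma dd_mult: 
  assumes "real_analytic_at f p" "real_analytic_at g p" 
  shows "dd b (\<lambda>x. f x * g x) p = f p * dd b g p + dd b f p * g p"
proof -
  obtain F where F: "(f has_derivative F) (at p)" "\<And>b. F b = dd b f p" 
    by (rule ra_obtain_derivative[OF assms(1)]) blast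
  obtain G where G: "(g has_derivative G) (at p)" "\<And>b. G b = dd b g p" 
    by (rule ra_obtain_derivative[OF assms(2)]) blast
  show ?thesis using dd_eqI[OF has_derivative_mult[OF F(1) G(1)], of b] F(2) G(2) by simp
qed

lemma dd_snd: "dd et (\<lambda>P. g (snd P)) P = 0" "dd (ex i) (\<lambda>P. g (snd P)) P = dd (axis i 1) g (snd P)"
  by (simp_all add: dd_def)

section \<open>The wave operator on logarithmically singular functions\<close>

definition log_singular :: "real \<Rightarrow> ((real ^ 'n) \<Rightarrow> real) \<Rightarrow> (real \<times> (real ^ 'n) \<Rightarrow> real) \<Rightarrow> real \<times> (real ^ 'n::finite) \<Rightarrow> real" where
  "log_singular a \<psi> v = (\<lambda>(t, x). - a * ln (t - \<psi> x) + v (t, x))"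

text \<open>
  The logarithm is differentiated once by hand. Its first derivatives are rational in \<open>s\<close>,
  so the second derivatives follow from the calculus of analytic functions.
\<close>

lemma log_singular_derivatives:
  fixes P :: "real \<times> (real ^ 'n::finite)" and a :: real
  assumes \<psi>: "real_analytic_at \<psi> (snd P)" and v: "real_analytic_at v (unflat \<psi> P)" and s: "fst P > 0"
  defines "w \<equiv> \<lambda>P. v (unflat \<psi> P)" and "u \<equiv> log_singular a \<psi> v" and "p \<equiv> unflat \<psi> P"
    and "\<psi>1 \<equiv> \<lambda>i. dd (axis i 1) \<psi> (snd P)" and "\<psi>2 \<equiv> \<lambda>i. dd (axis i 1) (dd (axis i 1) \<psi>) (snd P)"
  shows "dd et u p = - a / fst P + dd et w P"
    and "dd (ex i) u p = dd (ex i) w P - \<psi>1 i * (- a / fst P + dd et w P)"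
    and "dd et (dd et u) p = a / (fst P)\<^sup>2 + dd et (dd et w) P"
    and "dd (ex i) (dd (ex i) u) p = dd (ex i) (dd (ex i) w) P - \<psi>2 i * (- a / fst P + dd et w P)
       - 2 * \<psi>1 i * dd (ex i) (dd et w) P + (\<psi>1 i)\<^sup>2 * (a / (fst P)\<^sup>2 + dd et (dd et w) P)"
proof -
  define W where "W Q = - a / fst Q + dd et w Q" for Q :: "real \<times> (real ^ 'n)"
  define H where "H Q = dd (ex i) w Q - dd (axis i 1) \<psi> (snd Q) * W Q" for Q :: "real \<times> (real ^ 'n)"
  have u: "u = (\<lambda>q. (\<lambda>Q. - a * ln (fst Q) + w Q) (flat \<psi> q))"
    by (auto simp: u_def log_singular_def w_def fun_eq_iff flat_def unflat_def)
  have w: "real_analytic_at w P" unfolding w_def by (rule ra_unflat[OF \<psi> v])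
  have p: "flat \<psi> p = P" "snd p = snd P" unfolding p_def by (simp, simp add: unflat_def)
  have near: "\<forall>\<^sub>F q in nhds p. real_analytic_at \<psi> (snd q) \<and> real_analytic_at w (flat \<psi> q) \<and> fst (flat \<psi> q) > 0"
  proof (intro eventually_conj)
    show "\<forall>\<^sub>F q in nhds p. real_analytic_at \<psi> (snd q)"
      by (rule eventually_nhds_cont[where g = snd and Q = "real_analytic_at \<psi>"]) 
         (use ra_near[OF \<psi>] p in \<open>auto intro!: continuous_intros\<close>)
    have c: "isCont (flat \<psi>) p" by (rule isCont_flat) (use \<psi> p in simp)
    show "\<forall>\<^sub>F q in nhds p. real_analytic_at w (flat \<psi> q)"
      by (rule eventually_nhds_cont[OF c, where Q = "real_analytic_at w"]) (use ra_near[OF w] p in simp)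
    have "\<forall>\<^sub>F Q in nhds P. Q \<in> {Q. fst Q > 0}"
      by (rule eventually_nhds_in_open) (use s in \<open>auto intro!: open_Collect_less continuous_intros\<close>)
    then show "\<forall>\<^sub>F q in nhds p. fst (flat \<psi> q) > 0"
      using eventually_nhds_cont[OF c, of "\<lambda>Q. fst Q > 0"] p by simp
  qed
  have first: "dd et u q = W (flat \<psi> q) \<and> dd (ex i) u q = H (flat \<psi> q)"
    if q: "real_analytic_at \<psi> (snd q)" "real_analytic_at w (flat \<psi> q)" "fst (flat \<psi> q) > 0" for q i'
  proof -
    obtain F where F: "(w has_derivative F) (at (flat \<psi> q))" "\<And>b. F b = dd b w (flat \<psi> q)"
      by (rule ra_obtain_derivative[OF q(2)]) blast
    have D: "((\<lambda>Q. - a * ln (fst Q) + w Q) has_derivative (\<lambda>k. - a * (fst k / fst (flat \<psi> q)) + F k)) (at (flat \<psi> q))"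
      using q(3) by (auto intro!: derivative_eq_intros F(1) simp: divide_inverse)
    have "snd (flat \<psi> q) = snd q" by (simp add: flat_def)
    then show ?thesis unfolding u using dd_flat[OF q(1) D] F(2) by (simp add: W_def H_def)
  qed
  have et_near: "\<forall>\<^sub>F q in nhds p. dd et u q = W (flat \<psi> q)"
    using near by eventually_elim (use first in blast)
  have ex_near: "\<forall>\<^sub>F q in nhds p. dd (ex i) u q = H (flat \<psi> q)"
    using near by eventually_elim (use first in blast)
  show 1: "dd et u p = - a / fst P + dd et w P" 
    using eventually_nhds_x_imp_x[OF et_near] by (simp add: p W_def)
  show 2: "dd (ex i) u p = dd (ex i) w P - \<psi>1 i * (- a / fst P + dd et w P)"
    using eventually_nhds_x_imp_x[OF ex_near] by (simp add: p H_def W_def \<psi>1_def)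
  have inv: "real_analytic_at (\<lambda>Q. - a / fst Q) P"
    by (rule ra_divide[OF ra_const ra_fst]) (use s in simp)
  have W: "real_analytic_at W P" unfolding W_def using inv ra_dd[OF w et_Basis] by (rule ra_add)
  have \<psi>1: "real_analytic_at (\<lambda>Q. dd (axis i 1) \<psi> (snd Q)) P" by (rule ra_snd[OF ra_dd[OF \<psi> axis_Basis]])
  have H: "real_analytic_at H P" unfolding H_def
    using ra_dd[OF w ex_Basis] ra_mult[OF \<psi>1 W] by (rule ra_diff)
  have Dinv: "((\<lambda>Q. - a / fst Q) has_derivative (\<lambda>k. a * fst k / (fst P)\<^sup>2)) (at P)"
    using s by (auto intro!: derivative_eq_intros simp: fun_eq_iff field_simps power2_eq_square)
  have Wt: "dd et W P = a / (fst P)\<^sup>2 + dd et (dd et w) P"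
    unfolding W_def dd_add[OF inv ra_dd[OF w et_Basis]] dd_eqI[OF Dinv] by simp
  have Wx: "dd (ex i) W P = dd (ex i) (dd et w) P"
    unfolding W_def dd_add[OF inv ra_dd[OF w et_Basis]] dd_eqI[OF Dinv] by simp
  have Ht: "dd et H P = dd (ex i) (dd et w) P - \<psi>1 i * dd et W P"
    unfolding H_def dd_diff[OF ra_dd[OF w ex_Basis] ra_mult[OF \<psi>1 W]] dd_mult[OF \<psi>1 W] dd_snd
    using dd_commute[OF w et_Basis ex_Basis] by (simp add: \<psi>1_def)
  have Hx: "dd (ex i) H P = dd (ex i) (dd (ex i) w) P - (\<psi>1 i * dd (ex i) W P + \<psi>2 i * W P)"
    unfolding H_def dd_diff[OF ra_dd[OF w ex_Basis] ra_mult[OF \<psi>1 W]] dd_mult[OF \<psi>1 W] dd_snd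
    by (simp add: \<psi>1_def \<psi>2_def)
  have \<psi>1i: "dd (axis i 1) \<psi> (snd P) = \<psi>1 i" by (simp add: \<psi>1_def)
  have Wp: "W P = - a / fst P + dd et w P" by (simp add: W_def)
  have \<psi>p: "real_analytic_at \<psi> (snd p)" using \<psi> p by simp
  show "dd et (dd et u) p = a / (fst P)\<^sup>2 + dd et (dd et w) P"
    using dd_cong_ev[OF et_near, of et] dd_flat_ra(1)[OF \<psi>p, of W] W p Wt by simp
  show "dd (ex i) (dd (ex i) u) p = dd (ex i) (dd (ex i) w) P - \<psi>2 i * (- a / fst P + dd et w P)
       - 2 * \<psi>1 i * dd (ex i) (dd et w) P + (\<psi>1 i)\<^sup>2 * (a / (fst P)\<^sup>2 + dd et (dd et w) P)"
    unfolding dd_cong_ev[OF ex_near, of "ex i"] dd_flat_ra(2)[OF \<psi>p H[folded p(1)]] p Hx Ht Wx Wt Wp \<psi>1i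
    by (simp add: algebra_simps power2_eq_square)
qed

section \<open>Reduction to a Fuchsian equation\<close>

lemma index_of_degree_1:
  assumes "\<alpha> \<in> MI" "mdegree \<alpha> = 1" shows "\<exists>b\<in>Basis. \<alpha> = unit_index b"
proof -
  obtain b \<beta> where b: "b \<in> Basis" and \<alpha>: "\<alpha> = \<beta> + unit_index b" and "mdegree \<beta> = 0"
    by (rule index_degree_SucE[of \<alpha> 0]) (use assms in auto)
  moreover have "\<beta> \<in> MI" using assms(1) unfolding \<alpha> by (simp only: add_in_MI_iff)
  ultimately show ?thesis by (metis add_0 mdegree_eq_0_iff)
qed

lemma index_of_degree_2:
  assumes "\<alpha> \<in> MI" "mdegree \<alpha> = 2" shows "\<exists>b\<in>Basis. \<exists>b'\<in>Basis. \<alpha> = unit_index b + unit_index b'"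
proof -
  obtain b \<beta> where b: "b \<in> Basis" and \<alpha>: "\<alpha> = \<beta> + unit_index b" and "mdegree \<beta> = 1"
    by (rule index_degree_SucE[of \<alpha> 1]) (use assms in auto)
  moreover have "\<beta> \<in> MI" using assms(1) unfolding \<alpha> by (simp only: add_in_MI_iff)
  ultimately show ?thesis using index_of_degree_1 by metis
qed

text \<open>
  A monomial of degree \<open>2\<close> is a product of two coordinates. In this form the quadratic part can be
  polarised term by term.
\<close>

lemma analytic_form_degree_2:
  fixes g :: "'a::euclidean_space \<Rightarrow> 'b::euclidean_space \<Rightarrow> real"
  assumes "analytic_form_on U 2 g"
  obtains c :: "('b \<Rightarrow> nat) \<Rightarrow> 'a \<Rightarrow> real" and B B' :: "('b \<Rightarrow> nat) \<Rightarrow> 'b" where "\<And>\<alpha>. \<alpha> \<in> {\<alpha>\<in>MI. mdegree \<alpha> = 2} \<Longrightarrow> B \<alpha> \<in> Basis \<and> B' \<alpha> \<in> Basis"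
    "\<And>\<alpha> p. \<alpha> \<in> {\<alpha>\<in>MI. mdegree \<alpha> = 2} \<Longrightarrow> p \<in> U \<Longrightarrow> real_analytic_at (c \<alpha>) p"
    "\<And>p \<zeta>. p \<in> U \<Longrightarrow> g p \<zeta> = (\<Sum>\<alpha>\<in>{\<alpha>\<in>MI. mdegree \<alpha> = 2}. c \<alpha> p * ((\<zeta> \<bullet> B \<alpha>) * (\<zeta> \<bullet> B' \<alpha>)))"
proof -
  obtain c where c: "\<And>\<alpha>. \<alpha> \<in> {\<alpha>\<in>MI. mdegree \<alpha> = 2} \<Longrightarrow> c \<alpha> real_analytic_on U"
    "\<And>p \<zeta>. p \<in> U \<Longrightarrow> g p \<zeta> = (\<Sum>\<alpha>\<in>{\<alpha>\<in>MI. mdegree \<alpha> = 2}. c \<alpha> p * monomial \<alpha> \<zeta>)"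
    using assms unfolding analytic_form_on_def by blast
  obtain B B' :: "('b \<Rightarrow> nat) \<Rightarrow> 'b" where B: "\<And>\<alpha>. \<alpha> \<in> {\<alpha>\<in>MI. mdegree \<alpha> = 2} \<Longrightarrow> B \<alpha> \<in> Basis \<and> B' \<alpha> \<in> Basis \<and> \<alpha> = unit_index (B \<alpha>) + unit_index (B' \<alpha>)"
    using index_of_degree_2 by (metis (mono_tags, lifting) mem_Collect_eq)
  have "monomial \<alpha> \<zeta> = (\<zeta> \<bullet> B \<alpha>) * (\<zeta> \<bullet> B' \<alpha>)" if "\<alpha> \<in> {\<alpha>\<in>MI. mdegree \<alpha> = 2}" for \<alpha> \<zeta>
    using B[OF that] monomial_add[of "unit_index (B \<alpha>)" "unit_index (B' \<alpha>)" \<zeta>] monomial_unit_index by metis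
  then have "g p \<zeta> = (\<Sum>\<alpha>\<in>{\<alpha>\<in>MI. mdegree \<alpha> = 2}. c \<alpha> p * ((\<zeta> \<bullet> B \<alpha>) * (\<zeta> \<bullet> B' \<alpha>)))" if "p \<in> U" for p \<zeta>
    using c(2)[OF that, of \<zeta>] by (metis (no_types, lifting) sum.cong)
  then show ?thesis using that[of B B' c] B c(1) unfolding real_analytic_on_def by blast
qed

lemma analytic_form_degree_1:
  fixes g :: "'a::euclidean_space \<Rightarrow> 'b::euclidean_space \<Rightarrow> real"
  assumes "analytic_form_on U 1 g"
  obtains c :: "('b \<Rightarrow> nat) \<Rightarrow> 'a \<Rightarrow> real" and B :: "('b \<Rightarrow> nat) \<Rightarrow> 'b" where "\<And>\<alpha>. \<alpha> \<in> {\<alpha>\<in>MI. mdegree \<alpha> = 1} \<Longrightarrow> B \<alpha> \<in> Basis"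
    "\<And>\<alpha> p. \<alpha> \<in> {\<alpha>\<in>MI. mdegree \<alpha> = 1} \<Longrightarrow> p \<in> U \<Longrightarrow> real_analytic_at (c \<alpha>) p"
    "\<And>p \<zeta>. p \<in> U \<Longrightarrow> g p \<zeta> = (\<Sum>\<alpha>\<in>{\<alpha>\<in>MI. mdegree \<alpha> = 1}. c \<alpha> p * (\<zeta> \<bullet> B \<alpha>))"
proof -
  obtain c where c: "\<And>\<alpha>. \<alpha> \<in> {\<alpha>\<in>MI. mdegree \<alpha> = 1} \<Longrightarrow> c \<alpha> real_analytic_on U"
    "\<And>p \<zeta>. p \<in> U \<Longrightarrow> g p \<zeta> = (\<Sum>\<alpha>\<in>{\<alpha>\<in>MI. mdegree \<alpha> = 1}. c \<alpha> p * monomial \<alpha> \<zeta>)"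
    using assms unfolding analytic_form_on_def by blast
  obtain B :: "('b \<Rightarrow> nat) \<Rightarrow> 'b" where B: "\<And>\<alpha>. \<alpha> \<in> {\<alpha>\<in>MI. mdegree \<alpha> = 1} \<Longrightarrow> B \<alpha> \<in> Basis \<and> \<alpha> = unit_index (B \<alpha>)"
    using index_of_degree_1 by (metis (mono_tags, lifting) mem_Collect_eq)
  have "monomial \<alpha> \<zeta> = \<zeta> \<bullet> B \<alpha>" if "\<alpha> \<in> {\<alpha>\<in>MI. mdegree \<alpha> = 1}" for \<alpha> \<zeta>
    using B[OF that] monomial_unit_index by metis
  then have "g p \<zeta> = (\<Sum>\<alpha>\<in>{\<alpha>\<in>MI. mdegree \<alpha> = 1}. c \<alpha> p * (\<zeta> \<bullet> B \<alpha>))" if "p \<in> U" for p \<zeta>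
    using c(2)[OF that, of \<zeta>] by (metis (no_types, lifting) sum.cong)
  then show ?thesis using that[of B c] B c(1) unfolding real_analytic_on_def by blast
qed

lemma analytic_form_degree_0:
  fixes g :: "'a::euclidean_space \<Rightarrow> 'b::euclidean_space \<Rightarrow> real"
  assumes "analytic_form_on U 0 g"
  obtains c where "\<And>p. p \<in> U \<Longrightarrow> real_analytic_at c p" "\<And>p \<zeta>. p \<in> U \<Longrightarrow> g p \<zeta> = c p"
proof -
  have 0: "{\<alpha> :: 'b \<Rightarrow> nat. \<alpha> \<in> MI \<and> mdegree \<alpha> = 0} = {0}" by (auto simp: mdegree_eq_0_iff)
  obtain c where c: "\<And>\<alpha>. \<alpha> \<in> {0 :: 'b \<Rightarrow> nat} \<Longrightarrow> c \<alpha> real_analytic_on U"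
    "\<And>p \<zeta>. p \<in> U \<Longrightarrow> g p \<zeta> = (\<Sum>\<alpha>\<in>{0}. c \<alpha> p * monomial \<alpha> \<zeta>)"
    using assms unfolding analytic_form_on_def 0 by blast
  have "g p \<zeta> = c 0 p" if "p \<in> U" for p \<zeta>
    using c(2)[OF that, of \<zeta>] by (simp only: sum.insert finite.emptyI empty_iff not_False_eq_True sum.empty monomial_zero)
  then show ?thesis using that[of "c 0"] c(1) unfolding real_analytic_on_def by blast
qed

text \<open>
  The cancellation of the double pole. \<open>\<Phi>\<close> stands for \<open>f2(-1, \<nabla>\<psi>)\<close>, \<open>S1\<close> for \<open>\<Delta>w\<close>, \<open>S2\<close> for
  \<open>\<nabla>\<psi> \<bullet> \<nabla>w\<^sub>s\<close>, and \<open>T\<close>, \<open>N\<close>, \<open>dn\<close>, \<open>dh\<close>, \<open>c\<close> for the other parts of the right-hand side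
  of the wave equation.
\<close>

lemma fuchsian_form_of_wave_equation:
  fixes s q a :: real
  assumes "s \<noteq> 0" "q \<noteq> 0" "a \<noteq> 0" and "a * \<Phi> - q = s * \<phi>"
  shows "q * (a / s\<^sup>2 + wtt) - S1 + lap * (- a / s + wt) + 2 * S2
       = (a / s)\<^sup>2 * \<Phi> + (a / s) * (- 2 * wt * \<Phi> + T) + N + (a / s) * dn + dh + c
     \<longleftrightarrow> s * wtt + 2 * wt = 1 / q * (a * lap + a * \<phi> + a * dn + s * c + s * S1 - 2 * s * S2
         + s * (- (lap + 2 * \<phi>) * wt + N + dh) + a * T)" (is "?L = ?R \<longleftrightarrow> ?l = 1 / q * ?K")
proof -
  have \<Phi>: "\<Phi> = (q + s * \<phi>) / a" using assms by (simp add: field_simps)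
  have "(a / s)\<^sup>2 * \<Phi> = a * q / s\<^sup>2 + a * \<phi> / s"
    unfolding \<Phi> using assms by (simp add: field_simps power2_eq_square)
  moreover have "(a / s) * (- 2 * wt * \<Phi> + T) = - 2 * wt * q / s - 2 * wt * \<phi> + a * T / s"
    unfolding \<Phi> using assms by (simp add: field_simps)
  ultimately have "s * (?L - ?R) = s * (q * (a / s\<^sup>2 + wtt) - S1 + lap * (- a / s + wt) + 2 * S2
    - (a * q / s\<^sup>2 + a * \<phi> / s + (- 2 * wt * q / s - 2 * wt * \<phi> + a * T / s) + N + (a / s) * dn + dh + c))" by simp
  also have "\<dots> = q * ?l - ?K"
    using assms(1) by (simp add: field_simps power2_eq_square)
  finally have "s * (?L - ?R) = q * ?l - ?K" .
  then have "?L = ?R \<longleftrightarrow> q * ?l = ?K" using assms(1) by (metis eq_iff_diff_eq_0 mult_eq_0_iff)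
  then show ?thesis using assms(2) by (simp add: field_simps)
qed

text \<open>
  \<open>(-1, \<nabla>\<psi>)\<close>, a conormal of the hypersurface \<open>t = \<psi>(x)\<close>.
\<close>

definition conormal :: "(real ^ 'n \<Rightarrow> real) \<Rightarrow> real ^ 'n \<Rightarrow> real \<times> (real ^ 'n::finite)" where
  "conormal \<psi> x = (- 1, \<chi> i. dd (axis i 1) \<psi> x)"

text \<open>
  The symbol of the wave operator at the conormal; the hypersurface is characteristic where it
  vanishes.
\<close>

definition minkowski :: "(real ^ 'n \<Rightarrow> real) \<Rightarrow> real ^ 'n::finite \<Rightarrow> real" where
  "minkowski \<psi> x = 1 - (\<Sum>i\<in>UNIV. (dd (axis i 1) \<psi> x)\<^sup>2)"

text \<open>
  The hypotheses, with \<open>f\<close> written out in coordinates of its argument.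
\<close>

locale singular_wave =
  fixes U :: "(real \<times> (real ^ 'n::finite)) set" and D :: "(real ^ 'n) set"
    and f :: "real \<times> (real ^ 'n) \<Rightarrow> real \<times> (real ^ 'n) \<Rightarrow> real"
    and \<psi> :: "real ^ 'n \<Rightarrow> real" and a :: real
    and I2 :: "'i set" and c2 :: "'i \<Rightarrow> real \<times> (real ^ 'n) \<Rightarrow> real" and B B' :: "'i \<Rightarrow> real \<times> (real ^ 'n)"
    and I1 :: "'j set" and c1 :: "'j \<Rightarrow> real \<times> (real ^ 'n) \<Rightarrow> real" and C :: "'j \<Rightarrow> real \<times> (real ^ 'n)"
    and c0 :: "real \<times> (real ^ 'n) \<Rightarrow> real"
  assumes open_U: "open U" and open_D: "open D" and a: "a \<noteq> 0"
    and \<psi>: "\<And>x. x \<in> D \<Longrightarrow> real_analytic_at \<psi> x"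
    and B: "\<And>i. i \<in> I2 \<Longrightarrow> B i \<in> Basis" "\<And>i. i \<in> I2 \<Longrightarrow> B' i \<in> Basis"
    and C: "\<And>i. i \<in> I1 \<Longrightarrow> C i \<in> Basis"
    and c2: "\<And>i p. i \<in> I2 \<Longrightarrow> p \<in> U \<Longrightarrow> real_analytic_at (c2 i) p"
    and c1: "\<And>i p. i \<in> I1 \<Longrightarrow> p \<in> U \<Longrightarrow> real_analytic_at (c1 i) p"
    and c0: "\<And>p. p \<in> U \<Longrightarrow> real_analytic_at c0 p"
    and f: "\<And>p \<zeta>. p \<in> U \<Longrightarrow> f p \<zeta> = (\<Sum>i\<in>I2. c2 i p * ((\<zeta> \<bullet> B i) * (\<zeta> \<bullet> B' i))) + (\<Sum>i\<in>I1. c1 i p * (\<zeta> \<bullet> C i)) + c0 p"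
    and char: "\<And>x. x \<in> D \<Longrightarrow> (\<psi> x, x) \<in> U \<Longrightarrow> minkowski \<psi> x \<noteq> 0 \<and>
       minkowski \<psi> x = a * (\<Sum>i\<in>I2. c2 i (\<psi> x, x) * ((conormal \<psi> x \<bullet> B i) * (conormal \<psi> x \<bullet> B' i)))"
begin

abbreviation nu :: "real ^ 'n \<Rightarrow> real \<times> (real ^ 'n)" where
  "nu \<equiv> conormal \<psi>"

abbreviation q :: "real ^ 'n \<Rightarrow> real" where
  "q \<equiv> minkowski \<psi>"

definition lap :: "real ^ 'n \<Rightarrow> real" where
  "lap x = (\<Sum>i\<in>UNIV. dd (axis i 1) (dd (axis i 1) \<psi>) x)"

definition symb :: "real \<times> (real ^ 'n) \<Rightarrow> real" where
  "symb P = (\<Sum>i\<in>I2. c2 i (unflat \<psi> P) * ((nu (snd P) \<bullet> B i) * (nu (snd P) \<bullet> B' i)))"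

text \<open>
  \<open>theta\<close> lists the components of \<open>(0, \<nabla>w)\<close>, and \<open>eta\<close> those of the regular part of the gradient of
  \<open>u\<close>: that gradient is \<open>(a/s) nu + eta\<close> with \<open>eta = theta - w\<^sub>s nu\<close>.
\<close>

definition theta :: "real \<times> (real ^ 'n) \<Rightarrow> (real \<times> (real ^ 'n) \<Rightarrow> real) \<Rightarrow> real \<times> (real ^ 'n) \<Rightarrow> real" where
  "theta b w P = (if b = et then 0 else dd b w P)"

definition eta :: "real \<times> (real ^ 'n) \<Rightarrow> (real \<times> (real ^ 'n) \<Rightarrow> real) \<Rightarrow> real \<times> (real ^ 'n) \<Rightarrow> real" where
  "eta b w P = theta b w P + (- (nu (snd P) \<bullet> b)) * dd et w P"

text \<open>
  The operator \<open>\<Psi>\<close> described at the beginning, arranged in pieces to which the rules for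
  \<open>adm\<close> apply.
\<close>

definition fuchs_rhs :: "(real \<times> (real ^ 'n) \<Rightarrow> real) \<Rightarrow> (real \<times> (real ^ 'n) \<Rightarrow> real) \<Rightarrow> real \<times> (real ^ 'n) \<Rightarrow> real" where
  "fuchs_rhs \<phi> w P = 1 / q (snd P) *
    ((a * lap (snd P) + a * \<phi> P + a * (\<Sum>j\<in>I1. c1 j (unflat \<psi> P) * (nu (snd P) \<bullet> C j)) + fst P * c0 (unflat \<psi> P))
     + (\<Sum>i\<in>UNIV. fst P * dd (ex i) (dd (ex i) w) P)
     + (\<Sum>i\<in>UNIV. (- 2 * dd (axis i 1) \<psi> (snd P)) * (fst P * dd (ex i) (dd et w) P))
     + fst P * ((- (lap (snd P) + 2 * \<phi> P)) * dd et w P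
         + (\<Sum>i\<in>I2. c2 i (unflat \<psi> P) * (eta (B i) w P * eta (B' i) w P))
         + (\<Sum>j\<in>I1. c1 j (unflat \<psi> P) * eta (C j) w P))
     + (\<Sum>i\<in>I2. (a * c2 i (unflat \<psi> P) * (nu (snd P) \<bullet> B i)) * theta (B' i) w P
                + (a * c2 i (unflat \<psi> P) * (nu (snd P) \<bullet> B' i)) * theta (B i) w P))"

text \<open>
  The double pole leaves the remainder \<open>a symb - q\<close>, which vanishes at \<open>s = 0\<close>; \<open>\<phi>\<close> is its
  quotient by \<open>s\<close>.
\<close>

lemma solves_wave_at_iff_fuchs:
  assumes P: "fst P > 0" "snd P \<in> D" "unflat \<psi> P \<in> U" "q (snd P) \<noteq> 0"
    and v: "real_analytic_at v (unflat \<psi> P)" and \<phi>: "a * symb P - q (snd P) = fst P * \<phi> P"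
  shows "solves_wave_at f (log_singular a \<psi> v) (fst (unflat \<psi> P)) (snd P) \<longleftrightarrow>
    fuchs_op et (0, x0) (\<lambda>P. v (unflat \<psi> P)) P = fuchs_rhs \<phi> (\<lambda>P. v (unflat \<psi> P)) P"
proof -
  define w where "w = (\<lambda>P. v (unflat \<psi> P))"
  define p where "p = unflat \<psi> P"
  define s where "s = fst P"
  define \<psi>1 where "\<psi>1 i = dd (axis i 1) \<psi> (snd P)" for i
  define \<psi>2 where "\<psi>2 i = dd (axis i 1) (dd (axis i 1) \<psi>) (snd P)" for i
  define u where "u = log_singular a \<psi> v"
  define wt where "wt = dd et w P"
  define wtt where "wtt = dd et (dd et w) P"
  define \<zeta> where "\<zeta> = (dd et u p, \<chi> i. dd (ex i) u p)"
  have s: "s > 0" using P by (simp add: s_def)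
  note L = log_singular_derivatives[OF \<psi>[OF P(2)] v P(1), where a = a]
  have ut: "dd et u p = - a / s + wt" 
    using L(1) by (simp add: u_def p_def s_def wt_def w_def)
  have ux: "dd (ex i) u p = dd (ex i) w P - \<psi>1 i * (- a / s + wt)" for i
    using L(2)[of i] by (simp add: u_def p_def s_def wt_def w_def \<psi>1_def)
  have utt: "dd et (dd et u) p = a / s\<^sup>2 + wtt" 
    using L(3) by (simp add: u_def p_def s_def wtt_def w_def)
  have uxx: "dd (ex i) (dd (ex i) u) p = dd (ex i) (dd (ex i) w) P - \<psi>2 i * (- a / s + wt)
       - 2 * \<psi>1 i * dd (ex i) (dd et w) P + (\<psi>1 i)\<^sup>2 * (a / s\<^sup>2 + wtt)" for i
    using L(4)[of i] by (simp add: u_def p_def s_def wt_def wtt_def w_def \<psi>1_def \<psi>2_def)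
  have nu: "nu (snd P) = (- 1, \<chi> i. \<psi>1 i)" by (simp add: conormal_def \<psi>1_def)
  have \<zeta>: "\<zeta> \<bullet> b = a / s * (nu (snd P) \<bullet> b) + eta b w P" if "b \<in> Basis" for b
    using that
  proof (cases rule: Basis_cases)
    case 1
    then show ?thesis by (simp add: \<zeta>_def ut eta_def theta_def nu wt_def)
  next
    case (2 i)
    then show ?thesis by (simp add: \<zeta>_def ux eta_def theta_def nu wt_def algebra_simps)
  qed
  define S1 where "S1 = (\<Sum>i\<in>UNIV. dd (ex i) (dd (ex i) w) P)"
  define S2 where "S2 = (\<Sum>i\<in>UNIV. \<psi>1 i * dd (ex i) (dd et w) P)"
  define T where "T = (\<Sum>i\<in>I2. c2 i p * ((nu (snd P) \<bullet> B i) * theta (B' i) w P + (nu (snd P) \<bullet> B' i) * theta (B i) w P))"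
  define N where "N = (\<Sum>i\<in>I2. c2 i p * (eta (B i) w P * eta (B' i) w P))"
  define dn where "dn = (\<Sum>j\<in>I1. c1 j p * (nu (snd P) \<bullet> C j))"
  define dh where "dh = (\<Sum>j\<in>I1. c1 j p * eta (C j) w P)"
  have "(\<Sum>i\<in>UNIV. dd (ex i) (dd (ex i) u) p) = S1 - lap (snd P) * (- a / s + wt) - 2 * S2 
      + (\<Sum>i\<in>UNIV. (\<psi>1 i)\<^sup>2) * (a / s\<^sup>2 + wtt)"
    unfolding uxx S1_def S2_def lap_def \<psi>2_def[symmetric] sum_distrib_left sum_distrib_right
    by (simp add: sum.distrib sum_subtractf mult_ac)
  moreover have "(\<Sum>i\<in>UNIV. (\<psi>1 i)\<^sup>2) = 1 - q (snd P)" by (simp add: minkowski_def \<psi>1_def)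
  ultimately have uxx_sum: "(\<Sum>i\<in>UNIV. dd (ex i) (dd (ex i) u) p) = S1 - lap (snd P) * (- a / s + wt) - 2 * S2 
      + (1 - q (snd P)) * (a / s\<^sup>2 + wtt)" by (simp only:)
  have alg: "K - X = Q * K - S + L + 2 * S'" if "X = S - L - 2 * S' + (1 - Q) * K" for X S L S' Q K :: real
    using that by (simp add: algebra_simps)
  have lhs: "dd et (dd et u) p - (\<Sum>i\<in>UNIV. dd (ex i) (dd (ex i) u) p)
      = q (snd P) * (a / s\<^sup>2 + wtt) - S1 + lap (snd P) * (- a / s + wt) + 2 * S2"
    unfolding utt by (rule alg[OF uxx_sum])
  have "(\<Sum>i\<in>I2. c2 i p * ((\<zeta> \<bullet> B i) * (\<zeta> \<bullet> B' i)))
      = (\<Sum>i\<in>I2. (a / s)\<^sup>2 * (c2 i p * ((nu (snd P) \<bullet> B i) * (nu (snd P) \<bullet> B' i)))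
         + ((a / s) * (- 2 * wt * (c2 i p * ((nu (snd P) \<bullet> B i) * (nu (snd P) \<bullet> B' i)))) 
           + (a / s) * (c2 i p * ((nu (snd P) \<bullet> B i) * theta (B' i) w P + (nu (snd P) \<bullet> B' i) * theta (B i) w P)))
         + c2 i p * (eta (B i) w P * eta (B' i) w P))"
  proof (rule sum.cong[OF refl])
    fix i assume i: "i \<in> I2"
    define x y X Y where "x = nu (snd P) \<bullet> B i" "y = nu (snd P) \<bullet> B' i" "X = theta (B i) w P" "Y = theta (B' i) w P"
    have e: "eta (B i) w P = X - wt * x" "eta (B' i) w P = Y - wt * y"
      by (simp_all add: eta_def x_y_X_Y_def wt_def)
    show "c2 i p * ((\<zeta> \<bullet> B i) * (\<zeta> \<bullet> B' i)) = (a / s)\<^sup>2 * (c2 i p * ((nu (snd P) \<bullet> B i) * (nu (snd P) \<bullet> B' i)))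
         + ((a / s) * (- 2 * wt * (c2 i p * ((nu (snd P) \<bullet> B i) * (nu (snd P) \<bullet> B' i)))) 
           + (a / s) * (c2 i p * ((nu (snd P) \<bullet> B i) * theta (B' i) w P + (nu (snd P) \<bullet> B' i) * theta (B i) w P)))
         + c2 i p * (eta (B i) w P * eta (B' i) w P)"
      unfolding \<zeta>[OF B(1)[OF i]] \<zeta>[OF B(2)[OF i]] e x_y_X_Y_def[symmetric]
      by (simp only: power2_eq_square) (simp add: algebra_simps)
  qed
  also have "\<dots> = (a / s)\<^sup>2 * symb P + (a / s) * (- 2 * wt * symb P + T) + N"
    unfolding sum.distrib sum_distrib_left[symmetric] symb_def T_def N_def p_def by (simp only: distrib_left)
  finally have quad: "(\<Sum>i\<in>I2. c2 i p * ((\<zeta> \<bullet> B i) * (\<zeta> \<bullet> B' i))) = (a / s)\<^sup>2 * symb P + (a / s) * (- 2 * wt * symb P + T) + N" .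
  have "(\<Sum>j\<in>I1. c1 j p * (\<zeta> \<bullet> C j)) = (\<Sum>j\<in>I1. (a / s) * (c1 j p * (nu (snd P) \<bullet> C j)) + c1 j p * eta (C j) w P)"
    by (rule sum.cong) (simp_all add: \<zeta> C algebra_simps)
  also have "\<dots> = (a / s) * dn + dh"
    unfolding dn_def dh_def sum.distrib sum_distrib_left[symmetric] ..
  finally have rhs: "f p \<zeta> = (a / s)\<^sup>2 * symb P + (a / s) * (- 2 * wt * symb P + T) + N + (a / s) * dn + dh + c0 p"
    using f[of p \<zeta>] P(3) quad by (simp add: p_def)
  have "p = (fst p, snd P)" by (simp add: p_def unflat_def)
  then have "solves_wave_at f u (fst p) (snd P) \<longleftrightarrow> dd et (dd et u) p - (\<Sum>i\<in>UNIV. dd (ex i) (dd (ex i) u) p) = f p \<zeta>"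
    unfolding solves_wave_at_iff \<zeta>_def by simp
  also have "\<dots> \<longleftrightarrow> s * wtt + 2 * wt = 1 / q (snd P) * (a * lap (snd P) + a * \<phi> P + a * dn + s * c0 p + s * S1 - 2 * s * S2
         + s * (- (lap (snd P) + 2 * \<phi> P) * wt + N + dh) + a * T)"
    unfolding lhs rhs using s P(4) a \<phi> unfolding s_def[symmetric] by (intro fuchsian_form_of_wave_equation) auto
  also have "s * wtt + 2 * wt = fuchs_op et (0, x0) w P"
    by (simp add: fuchs_op_def s_def wt_def wtt_def)
  also have "1 / q (snd P) * (a * lap (snd P) + a * \<phi> P + a * dn + s * c0 p + s * S1 - 2 * s * S2
         + s * (- (lap (snd P) + 2 * \<phi> P) * wt + N + dh) + a * T) = fuchs_rhs \<phi> w P"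
  proof -
    have 1: "(\<Sum>i\<in>UNIV. fst P * dd (ex i) (dd (ex i) w) P) = s * S1" by (simp add: S1_def s_def sum_distrib_left)
    have 2: "(\<Sum>i\<in>UNIV. (- 2 * dd (axis i 1) \<psi> (snd P)) * (fst P * dd (ex i) (dd et w) P)) = - 2 * s * S2" 
      by (simp add: S2_def s_def \<psi>1_def sum_distrib_left mult_ac sum_negf)
    have 3: "(\<Sum>i\<in>I2. (a * c2 i (unflat \<psi> P) * (nu (snd P) \<bullet> B i)) * theta (B' i) w P
                + (a * c2 i (unflat \<psi> P) * (nu (snd P) \<bullet> B' i)) * theta (B i) w P) = a * T"
      by (simp add: T_def p_def sum_distrib_left distrib_left mult_ac)
    show ?thesis
      unfolding fuchs_rhs_def 1 2 3 
      unfolding p_def[symmetric] unfolding N_def[symmetric] dn_def[symmetric] dh_def[symmetric]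
        wt_def[symmetric] s_def[symmetric] by simp
  qed
  finally show ?thesis unfolding u_def p_def w_def .
qed

lemma nu_analytic:
  assumes "x0 \<in> D" "b \<in> Basis" shows "real_analytic_at (\<lambda>P. nu (snd P) \<bullet> b) (s :: real, x0)"
  using assms(2)
proof (cases rule: Basis_cases)
  case 1
  then show ?thesis by (simp add: conormal_def)
next
  case (2 i)
  have "real_analytic_at (\<lambda>P. dd (axis i 1) \<psi> (snd P)) (s, x0)"
    by (rule ra_snd[where g = "dd (axis i 1) \<psi>"]) (simp add: ra_dd[OF \<psi>[OF assms(1)]])
  then show ?thesis unfolding 2 by (simp add: conormal_def)
qed

lemma q_analytic: 
  assumes "x0 \<in> D" shows "real_analytic_at q x0"
  unfolding minkowski_def[abs_def] power2_eq_square 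
  by (intro ra_diff ra_const ra_sum ra_mult ra_dd \<psi> assms axis_Basis)

lemma lap_analytic: 
  assumes "x0 \<in> D" shows "real_analytic_at lap x0"
  unfolding lap_def[abs_def] by (intro ra_sum ra_dd \<psi> assms axis_Basis)

lemma unflat_analytic:
  assumes "x0 \<in> D" "real_analytic_at g (\<psi> x0, x0)" shows "real_analytic_at (\<lambda>P. g (unflat \<psi> P)) (0, x0)"
  by (rule ra_unflat) (use assms \<psi> in \<open>auto simp: unflat_def\<close>)

text \<open>
  The hypothesis on \<open>\<psi>\<close> says that the left-hand side vanishes at \<open>s = 0\<close>.
\<close>

lemma symb_remainder:
  assumes x0: "x0 \<in> D" "(\<psi> x0, x0) \<in> U"
  obtains \<phi> where "real_analytic_at \<phi> (0, x0)" "\<forall>\<^sub>F P in nhds (0, x0). a * symb P - q (snd P) = fst P * \<phi> P"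
proof -
  have R: "real_analytic_at (\<lambda>P. a * symb P - q (snd P)) (0, x0)"
    unfolding symb_def 
    by (intro ra_diff ra_mult ra_const ra_sum ra_snd unflat_analytic nu_analytic c2 B)
       (use x0 q_analytic in auto)
  have ev: "\<forall>\<^sub>F P in nhds ((0::real), x0). snd P \<in> D \<and> unflat \<psi> (0, snd P) \<in> U"
  proof (rule eventually_conj)
    have s: "isCont (snd :: real \<times> (real ^ 'n) \<Rightarrow> _) (0, x0)" by (intro continuous_intros)
    show "\<forall>\<^sub>F P in nhds ((0::real), x0). snd P \<in> D"
      by (rule eventually_nhds_cont[OF s, where Q = "\<lambda>x. x \<in> D"]) (use eventually_nhds_in_open[OF open_D x0(1)] in simp)
    have "\<forall>\<^sub>F P in nhds ((0::real), x0). unflat \<psi> P \<in> U"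
      by (rule eventually_nhds_cont[OF isCont_unflat, where Q = "\<lambda>x. x \<in> U"]) 
         (use \<psi>[OF x0(1)] eventually_nhds_in_open[OF open_U x0(2)] in \<open>auto simp: unflat_def\<close>)
    moreover have "isCont (\<lambda>P::real \<times> (real ^ 'n). (0::real, snd P)) (0, x0)" by (intro continuous_intros)
    ultimately show "\<forall>\<^sub>F P in nhds ((0::real), x0). unflat \<psi> (0, snd P) \<in> U"
      by (intro eventually_nhds_cont[where g = "\<lambda>P. (0, snd P)" and Q = "\<lambda>P. unflat \<psi> P \<in> U"]) auto
  qed
  have "\<forall>\<^sub>F P in nhds (0, x0). (P - (0, x0)) \<bullet> et = 0 \<longrightarrow> a * symb P - q (snd P) = 0"
    using ev
  proof eventually_elim
    case (elim P)
    then show ?case using char[of "snd P"] by (cases P) (auto simp: symb_def unflat_def)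
  qed
  from ra_divide_coord[OF R et_Basis this] show ?thesis using that by auto
qed

lemma fuchs_rhs_admissible:
  assumes x0: "x0 \<in> D" "(\<psi> x0, x0) \<in> U" and \<phi>: "real_analytic_at \<phi> (0, x0)"
  shows "adm et (0, x0) 1 (fuchs_rhs \<phi>)"
proof -
  let ?P = "(0::real, x0)"
  note X = unflat_analytic[OF x0(1)]
  note S = ra_snd[where P = ?P, simplified]
  note N = nu_analytic[OF x0(1)]
  have s: "(P - ?P) \<bullet> et = fst P" for P by simp
  note tf = adm_time_factor[OF et_Basis, where p = ?P, unfolded s]
  note mixed = adm_dd_mixed[OF et_Basis ex_Basis ex_neq_et(1), where p = ?P, unfolded s]
  note space2 = adm_dd_space2[OF et_Basis ex_Basis ex_neq_et(1), where p = ?P, unfolded s]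
  note dt = adm_dd_time[OF et_Basis, where p = ?P]
  have th: "adm et ?P 1 (theta b)" if "b \<in> Basis" for b
  proof (cases "b = et")
    case True
    then have "theta b = (\<lambda>w P. 0)" by (simp add: theta_def fun_eq_iff)
    then show ?thesis using adm_const[OF et_Basis ra_const, of ?P 1 0] by (simp only:)
  next
    case False
    then have "theta b = (\<lambda>w. dd b w)" by (simp add: theta_def fun_eq_iff)
    then show ?thesis using adm_dd_space[OF et_Basis that False, of ?P] by (simp only:)
  qed
  have et: "adm et ?P 0 (eta b)" if "b \<in> Basis" for b
    unfolding eta_def[abs_def]
    by (intro adm_add[OF et_Basis] adm_weaken[OF et_Basis] th adm_cmult[OF et_Basis] dt ra_uminus N that)
  have A: "adm et ?P 1 (\<lambda>w P. a * lap (snd P) + a * \<phi> P + a * (\<Sum>j\<in>I1. c1 j (unflat \<psi> P) * (nu (snd P) \<bullet> C j)) + fst P * c0 (unflat \<psi> P))"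
    by (rule adm_const[OF et_Basis], intro ra_add ra_mult ra_const ra_sum ra_fst X N S lap_analytic \<phi> c1 c0 C x0)
  have q: "real_analytic_at (\<lambda>P. 1 / q (snd P)) ?P"
    by (rule ra_divide[OF ra_const S[OF q_analytic[OF x0(1)]]]) (use char[OF x0, THEN conjunct1] in simp)
  show ?thesis
    unfolding fuchs_rhs_def[abs_def]
  proof (rule adm_cmult[OF et_Basis q], rule adm_add[OF et_Basis], rule adm_add[OF et_Basis],
      rule adm_add[OF et_Basis], rule adm_add[OF et_Basis])
    show "adm et ?P 1 (\<lambda>w P. \<Sum>i\<in>UNIV. fst P * dd (ex i) (dd (ex i) w) P)"
      by (rule adm_sum[OF et_Basis], rule space2)
    show "adm et ?P 1 (\<lambda>w P. \<Sum>i\<in>UNIV. (- 2 * dd (axis i 1) \<psi> (snd P)) * (fst P * dd (ex i) (dd et w) P))"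
      by (rule adm_sum[OF et_Basis], rule adm_cmult[OF et_Basis _ mixed], rule ra_mult[OF ra_const S[OF ra_dd[OF \<psi>[OF x0(1)] axis_Basis]]])
    show "adm et ?P 1 (\<lambda>w P. fst P * ((- (lap (snd P) + 2 * \<phi> P)) * dd et w P
         + (\<Sum>i\<in>I2. c2 i (unflat \<psi> P) * (eta (B i) w P * eta (B' i) w P))
         + (\<Sum>j\<in>I1. c1 j (unflat \<psi> P) * eta (C j) w P)))"
    proof (rule tf, intro adm_add[OF et_Basis])
      show "adm et ?P 0 (\<lambda>w P. (- (lap (snd P) + 2 * \<phi> P)) * dd et w P)"
        by (rule adm_cmult[OF et_Basis _ dt], intro ra_uminus ra_add ra_mult ra_const S lap_analytic \<phi> x0)
      show "adm et ?P 0 (\<lambda>w P. \<Sum>i\<in>I2. c2 i (unflat \<psi> P) * (eta (B i) w P * eta (B' i) w P))"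
        by (rule adm_sum[OF et_Basis], rule adm_cmult[OF et_Basis], rule X, rule c2, assumption, rule x0,
            rule adm_mult[OF et_Basis], rule et, rule B, assumption, rule et, rule B)
      show "adm et ?P 0 (\<lambda>w P. \<Sum>j\<in>I1. c1 j (unflat \<psi> P) * eta (C j) w P)"
        by (rule adm_sum[OF et_Basis], rule adm_cmult[OF et_Basis], rule X, rule c1, assumption, rule x0,
            rule et, rule C)
    qed
    show "adm et ?P 1 (\<lambda>w P. \<Sum>i\<in>I2. (a * c2 i (unflat \<psi> P) * (nu (snd P) \<bullet> B i)) * theta (B' i) w P
                + (a * c2 i (unflat \<psi> P) * (nu (snd P) \<bullet> B' i)) * theta (B i) w P)"
      by (rule adm_sum[OF et_Basis], intro adm_add[OF et_Basis] adm_cmult[OF et_Basis] th ra_mult ra_const X N c2 B x0)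
  qed (rule A)
qed

end

section \<open>Local existence and uniqueness\<close>

lemma open_eventually: 
  fixes S :: "'a::topological_space set"
  assumes "\<And>p. p \<in> S \<Longrightarrow> \<forall>\<^sub>F q in nhds p. q \<in> S" shows "open S"
proof (rule iffD2[OF open_subopen], rule ballI)
  fix p assume "p \<in> S"
  from assms[OF this] obtain T where "open T" "p \<in> T" "\<forall>x\<in>T. x \<in> S" unfolding eventually_nhds by blast
  then show "\<exists>T. open T \<and> p \<in> T \<and> T \<subseteq> S" by (intro exI[of _ T]) auto
qed

context singular_wave
begin

abbreviation solves_above :: "(real \<times> (real ^ 'n) \<Rightarrow> real) \<Rightarrow> real \<times> (real ^ 'n) \<Rightarrow> bool" where
  "solves_above v p \<equiv> fst p > \<psi> (snd p) \<longrightarrow> solves_wave_at f (log_singular a \<psi> v) (fst p) (snd p)"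

abbreviation local_solution ::
    "(real \<times> (real ^ 'n) \<Rightarrow> real) \<Rightarrow> (real \<times> (real ^ 'n) \<Rightarrow> real) \<Rightarrow> real \<times> (real ^ 'n) \<Rightarrow> bool" where
  "local_solution v0 v p \<equiv> real_analytic_at v p \<and> solves_above v p \<and> (fst p = \<psi> (snd p) \<longrightarrow> v p = v0 p)"

text \<open>
  Near \<open>x0\<close> the wave equation for \<open>u\<close> is the Fuchsian equation with right-hand side \<open>\<Psi>\<close> for \<open>w\<close>.
\<close>

abbreviation reduces_to ::
    "real ^ 'n \<Rightarrow> ((real \<times> (real ^ 'n) \<Rightarrow> real) \<Rightarrow> real \<times> (real ^ 'n) \<Rightarrow> real) \<Rightarrow> bool" where
  "reduces_to x0 \<Psi> \<equiv> \<forall>v. real_analytic_at v (\<psi> x0, x0) \<longrightarrow> (\<forall>\<^sub>F P in nhds (0, x0). fst P > 0 \<longrightarrow>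
     (solves_wave_at f (log_singular a \<psi> v) (fst (unflat \<psi> P)) (snd (unflat \<psi> P)) \<longleftrightarrow>
      fuchs_op et (0, x0) (\<lambda>P. v (unflat \<psi> P)) P = \<Psi> (\<lambda>P. v (unflat \<psi> P)) P))"

lemma eventually_nhds_unflat_iff:
  assumes "x0 \<in> D"
  shows "(\<forall>\<^sub>F p in nhds (\<psi> x0, x0). Q p) \<longleftrightarrow> (\<forall>\<^sub>F P in nhds (0, x0). Q (unflat \<psi> P))"
proof
  have u: "unflat \<psi> (0, x0) = (\<psi> x0, x0)" and f: "flat \<psi> (\<psi> x0, x0) = (0, x0)" by (simp_all add: unflat_def flat_def)
  have cu: "isCont (unflat \<psi>) (0, x0)" by (rule isCont_unflat) (simp add: \<psi>[OF assms])
  have cf: "isCont (flat \<psi>) (\<psi> x0, x0)" by (rule isCont_flat) (simp add: \<psi>[OF assms])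
  show "\<forall>\<^sub>F P in nhds (0, x0). Q (unflat \<psi> P)" if "\<forall>\<^sub>F p in nhds (\<psi> x0, x0). Q p"
    by (rule eventually_nhds_cont[OF cu]) (simp add: u that)
  show "\<forall>\<^sub>F p in nhds (\<psi> x0, x0). Q p" if "\<forall>\<^sub>F P in nhds (0, x0). Q (unflat \<psi> P)"
    using eventually_nhds_cont[OF cf, where Q = "\<lambda>P. Q (unflat \<psi> P)"] that by (simp add: f)
qed

lemma equivalent_fuchsian_equation:
  assumes x0: "x0 \<in> D" "(\<psi> x0, x0) \<in> U"
  obtains \<Psi> where "adm et (0, x0) 1 \<Psi>" "reduces_to x0 \<Psi>"
proof -
  obtain \<phi> where \<phi>: "real_analytic_at \<phi> (0, x0)" 
    "\<forall>\<^sub>F P in nhds (0, x0). a * symb P - q (snd P) = fst P * \<phi> P"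
    using symb_remainder[OF x0] .
  have snd_cont: "isCont (snd :: real \<times> (real ^ 'n) \<Rightarrow> _) (0, x0)" by (intro continuous_intros)
  have D: "\<forall>\<^sub>F P in nhds ((0::real), x0). snd P \<in> D"
    by (rule eventually_nhds_cont[OF snd_cont, where Q = "\<lambda>x. x \<in> D"]) 
       (use eventually_nhds_in_open[OF open_D x0(1)] in simp)
  have "\<forall>\<^sub>F x in nhds x0. q x \<noteq> 0"
    using continuous_at_avoid[OF ra_isCont[OF q_analytic[OF x0(1)]], of 0] char[OF x0, THEN conjunct1]
    by (auto simp: eventually_nhds_metric dist_commute)
  then have q: "\<forall>\<^sub>F P in nhds ((0::real), x0). q (snd P) \<noteq> 0"
    using eventually_nhds_cont[OF snd_cont, where Q = "\<lambda>x. q x \<noteq> 0"] by simp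
  have "\<forall>\<^sub>F p in nhds (\<psi> x0, x0). p \<in> U" using open_U x0(2) by (rule eventually_nhds_in_open)
  then have U: "\<forall>\<^sub>F P in nhds (0, x0). unflat \<psi> P \<in> U" by (simp add: eventually_nhds_unflat_iff[OF x0(1)])
  show ?thesis
  proof (rule that[OF fuchs_rhs_admissible[OF x0 \<phi>(1)]], intro allI impI)
    fix v assume "real_analytic_at v (\<psi> x0, x0)"
    then have "\<forall>\<^sub>F p in nhds (\<psi> x0, x0). real_analytic_at v p" by (rule ra_near)
    then have "\<forall>\<^sub>F P in nhds (0, x0). real_analytic_at v (unflat \<psi> P)" 
      by (simp add: eventually_nhds_unflat_iff[OF x0(1)])
    then show "\<forall>\<^sub>F P in nhds (0, x0). fst P > 0 \<longrightarrow>
       (solves_wave_at f (log_singular a \<psi> v) (fst (unflat \<psi> P)) (snd (unflat \<psi> P)) \<longleftrightarrow>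
        fuchs_op et (0, x0) (\<lambda>P. v (unflat \<psi> P)) P = fuchs_rhs \<phi> (\<lambda>P. v (unflat \<psi> P)) P)"
      using \<phi>(2) D q U
    proof eventually_elim
      case (elim P)
      have "snd (unflat \<psi> P) = snd P" by (simp add: unflat_def)
      then show ?case using solves_wave_at_iff_fuchs[of P v \<phi> x0] elim by simp
    qed
  qed
qed

lemma local_existence:
  assumes x0: "x0 \<in> D" "(\<psi> x0, x0) \<in> U" and v0: "real_analytic_at (\<lambda>x. v0 (\<psi> x, x)) x0"
  shows "\<exists>v. \<forall>\<^sub>F p in nhds (\<psi> x0, x0). local_solution v0 v p"
proof -
  obtain \<Psi> where adm: "adm et (0, x0) 1 \<Psi>" and \<Psi>: "reduces_to x0 \<Psi>"
    using equivalent_fuchsian_equation[OF x0] by blast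
  have "real_analytic_at (\<lambda>P. v0 (\<psi> (snd P), snd P)) ((0::real), x0)"
    by (rule ra_snd[where g = "\<lambda>x. v0 (\<psi> x, x)"]) (simp add: v0)
  from fuchs_existence[OF et_Basis adm this]
  obtain w where w: "real_analytic_at w (0, x0)" "\<forall>\<^sub>F P in nhds (0, x0). fuchs_op et (0, x0) w P = \<Psi> w P"
    "\<forall>\<^sub>F P in nhds (0, x0). (P - (0, x0)) \<bullet> et = 0 \<longrightarrow> w P = v0 (\<psi> (snd P), snd P)" by blast
  define v where "v p = w (flat \<psi> p)" for p
  have vw: "(\<lambda>P. v (unflat \<psi> P)) = w" by (simp add: v_def)
  have v: "real_analytic_at v (\<psi> x0, x0)"
    unfolding v_def by (rule ra_flat) (use \<psi>[OF x0(1)] w(1) in \<open>auto simp: flat_def\<close>)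
  have "\<forall>\<^sub>F p in nhds (\<psi> x0, x0).
    solves_above v p \<and>
    (fst p = \<psi> (snd p) \<longrightarrow> v p = v0 p)"
  proof (rule iffD2[OF eventually_nhds_unflat_iff[OF x0(1)]])
    show "\<forall>\<^sub>F P in nhds (0, x0).
      solves_above v (unflat \<psi> P) \<and>
      (fst (unflat \<psi> P) = \<psi> (snd (unflat \<psi> P)) \<longrightarrow> v (unflat \<psi> P) = v0 (unflat \<psi> P))"
    using \<Psi>[rule_format, OF v] w(2,3) unfolding vw
  proof eventually_elim
    case (elim P)
    have 1: "\<psi> (snd (unflat \<psi> P)) < fst (unflat \<psi> P) \<longleftrightarrow> fst P > 0" 
      "fst (unflat \<psi> P) = \<psi> (snd (unflat \<psi> P)) \<longleftrightarrow> fst P = 0" by (auto simp: unflat_def)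
    have 2: "v (unflat \<psi> P) = v0 (unflat \<psi> P)" if "fst P = 0"
      using elim that fun_cong[OF vw, of P] by (auto simp: unflat_def)
    show ?case unfolding 1 using elim 2 by blast
  qed
  qed
  with ra_near[OF v] have "\<forall>\<^sub>F p in nhds (\<psi> x0, x0). local_solution v0 v p" by eventually_elim blast
  then show ?thesis by blast
qed

lemma local_uniqueness:
  assumes x0: "x0 \<in> D" "(\<psi> x0, x0) \<in> U"
    and v1: "real_analytic_at v1 (\<psi> x0, x0)" 
      "\<forall>\<^sub>F p in nhds (\<psi> x0, x0). solves_above v1 p"
    and v2: "real_analytic_at v2 (\<psi> x0, x0)" 
      "\<forall>\<^sub>F p in nhds (\<psi> x0, x0). solves_above v2 p"
    and eq: "\<forall>\<^sub>F p in nhds (\<psi> x0, x0). fst p = \<psi> (snd p) \<longrightarrow> v1 p = v2 p"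
  shows "\<forall>\<^sub>F p in nhds (\<psi> x0, x0). v1 p = v2 p"
proof -
  obtain \<Psi> where adm: "adm et (0, x0) 1 \<Psi>" and \<Psi>: "reduces_to x0 \<Psi>"
    using equivalent_fuchsian_equation[OF x0] by blast
  have w: "real_analytic_at (\<lambda>P. v (unflat \<psi> P)) (0, x0)" if "real_analytic_at v (\<psi> x0, x0)" for v
    by (rule unflat_analytic[OF x0(1) that])
  have eqn: "\<forall>\<^sub>F P in nhds (0, x0). (P - (0, x0)) \<bullet> et > 0 \<longrightarrow> 
      fuchs_op et (0, x0) (\<lambda>P. v (unflat \<psi> P)) P = \<Psi> (\<lambda>P. v (unflat \<psi> P)) P"
    if v: "real_analytic_at v (\<psi> x0, x0)" 
      "\<forall>\<^sub>F p in nhds (\<psi> x0, x0). solves_above v p" for v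
    using \<Psi>[rule_format, OF v(1)] v(2)[unfolded eventually_nhds_unflat_iff[OF x0(1)]]
  proof eventually_elim
    case (elim P)
    have h: "(P - (0, x0)) \<bullet> et = fst P" "\<psi> (snd (unflat \<psi> P)) < fst (unflat \<psi> P) \<longleftrightarrow> fst P > 0" 
      by (auto simp: unflat_def)
    show ?case unfolding h(1) using elim unfolding h(2) by blast
  qed
  have "\<forall>\<^sub>F P in nhds (0, x0). (P - (0, x0)) \<bullet> et = 0 \<longrightarrow> v1 (unflat \<psi> P) = v2 (unflat \<psi> P)"
    using eq[unfolded eventually_nhds_unflat_iff[OF x0(1)]] by eventually_elim (auto simp: unflat_def)
  from fuchs_uniqueness[OF et_Basis adm w[OF v1(1)] eqn[OF v1] w[OF v2(1)] eqn[OF v2] this]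
  show ?thesis unfolding eventually_nhds_unflat_iff[OF x0(1)] .
qed

section \<open>Gluing\<close>

definition tube :: "real ^ 'n \<Rightarrow> real \<Rightarrow> (real \<times> (real ^ 'n)) set" where
  "tube x \<delta> = {p. \<bar>fst (flat \<psi> p)\<bar> < \<delta> \<and> snd p \<in> ball x \<delta>}"

lemma open_tube:
  assumes "ball x \<delta> \<subseteq> D" shows "open (tube x \<delta>)"
proof (rule open_eventually)
  fix p assume p: "p \<in> tube x \<delta>"
  have "isCont (flat \<psi>) p" by (rule isCont_flat) (use \<psi> p assms in \<open>auto simp: tube_def\<close>)
  then have "\<forall>\<^sub>F q in nhds p. flat \<psi> q \<in> {P. \<bar>fst P\<bar> < \<delta>}"
    by (rule eventually_nhds_cont[where Q = "\<lambda>P. P \<in> {P. \<bar>fst P\<bar> < \<delta>}"])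
       (rule eventually_nhds_in_open, use p in \<open>auto simp: tube_def intro!: open_Collect_less continuous_intros\<close>)
  moreover have "\<forall>\<^sub>F q in nhds p. snd q \<in> ball x \<delta>"
    by (rule eventually_nhds_cont[where g = snd and Q = "\<lambda>y. y \<in> ball x \<delta>"])
       (use p eventually_nhds_in_open[OF open_ball, of "snd p" x \<delta>] in \<open>auto simp: tube_def intro!: continuous_intros\<close>)
  ultimately show "\<forall>\<^sub>F q in nhds p. q \<in> tube x \<delta>"
    by eventually_elim (auto simp: tube_def)
qed

lemma obtain_tube:
  assumes x0: "x0 \<in> D" and Q: "\<forall>\<^sub>F p in nhds (\<psi> x0, x0). Q p"
  obtains \<delta> where "\<delta> > 0" "ball x0 \<delta> \<subseteq> D" "\<And>p. p \<in> tube x0 \<delta> \<Longrightarrow> Q p"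
proof -
  obtain d where d: "d > 0" "\<And>P. dist P (0, x0) < d \<Longrightarrow> Q (unflat \<psi> P)"
    using iffD1[OF eventually_nhds_unflat_iff[OF x0] Q] unfolding eventually_nhds_metric by auto
  obtain d' where d': "d' > 0" "ball x0 d' \<subseteq> D" using open_D x0 by (auto simp: open_contains_ball)
  define \<delta> where "\<delta> = min (d / 2) d'"
  have "Q p" if p: "p \<in> tube x0 \<delta>" for p
  proof -
    have "dist (flat \<psi> p) (0, x0) = norm (fst (flat \<psi> p), snd p - x0)"
      by (simp add: dist_norm flat_def)
    also have "\<dots> \<le> \<bar>fst (flat \<psi> p)\<bar> + norm (snd p - x0)"
      using norm_Pair_le[of "fst (flat \<psi> p)" "snd p - x0"] by simp
    also have "\<dots> < d" using p by (auto simp: tube_def \<delta>_def dist_norm norm_minus_commute)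
    finally show ?thesis using d(2)[of "flat \<psi> p"] by simp
  qed
  moreover have "\<delta> > 0" "ball x0 \<delta> \<subseteq> D" using d d' by (auto simp: \<delta>_def)
  ultimately show ?thesis using that by blast
qed

text \<open>
  In the coordinates \<open>(s, x)\<close> the overlap is a neighbourhood of \<open>(0, x)\<close> for each of its points \<open>(s, x)\<close>,
  and a convex box containing both lies in it. The solutions agree near \<open>(0, x)\<close> by local
  uniqueness, hence everywhere on the box.
\<close>

lemma tube_overlap:
  assumes x1: "ball x1 \<delta>1 \<subseteq> D" "tube x1 \<delta>1 \<subseteq> U" and x2: "ball x2 \<delta>2 \<subseteq> D" "tube x2 \<delta>2 \<subseteq> U"
    and v1: "\<And>p. p \<in> tube x1 \<delta>1 \<Longrightarrow> local_solution v0 v1 p"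
    and v2: "\<And>p. p \<in> tube x2 \<delta>2 \<Longrightarrow> local_solution v0 v2 p"
    and p: "p \<in> tube x1 \<delta>1" "p \<in> tube x2 \<delta>2"
  shows "v1 p = v2 p"
proof -
  define m where "m = min \<delta>1 \<delta>2"
  define S where "S = {- m<..<m} \<times> (ball x1 \<delta>1 \<inter> ball x2 \<delta>2)"
  define C where "C = unflat \<psi> ` S"
  have sub: "C \<subseteq> tube x1 \<delta>1 \<inter> tube x2 \<delta>2"
    by (auto simp: C_def S_def tube_def m_def) (auto simp: unflat_def)
  have "connected S" unfolding S_def 
    by (intro convex_connected convex_Times convex_Int convex_ball convex_real_interval)
  moreover have "continuous_on S (unflat \<psi>)"
    by (intro continuous_at_imp_continuous_on ballI isCont_unflat \<psi>) (use x1 in \<open>auto simp: S_def\<close>)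
  ultimately have C: "connected C" unfolding C_def using connected_continuous_image by blast
  have "flat \<psi> p \<in> S" using p by (cases p) (auto simp: S_def tube_def m_def flat_def)
  then have pC: "p \<in> C" unfolding C_def by (metis flat_unflat(2) image_eqI)
  let ?x = "snd p" and ?p = "(\<psi> (snd p), snd p)"
  have m: "0 < m" using p by (auto simp: tube_def m_def)
  then have "(0, ?x) \<in> S" using p by (auto simp: S_def tube_def)
  moreover have "unflat \<psi> (0, ?x) = ?p" by (simp add: unflat_def)
  ultimately have p'C: "?p \<in> C" unfolding C_def by (metis image_eqI)
  have N: "\<forall>\<^sub>F q in nhds ?p. q \<in> tube x1 \<delta>1 \<inter> tube x2 \<delta>2"
    by (rule eventually_nhds_in_open[OF open_Int[OF open_tube[OF x1(1)] open_tube[OF x2(1)]]]) (use sub p'C in blast)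
  have "\<forall>\<^sub>F q in nhds ?p. v1 q = v2 q"
  proof (rule local_uniqueness)
    show "?x \<in> D" using p x1 by (auto simp: tube_def)
    show "?p \<in> U" using sub p'C x1 by blast
    show "real_analytic_at v1 ?p" "real_analytic_at v2 ?p" using sub p'C v1 v2 by blast+
    show "\<forall>\<^sub>F q in nhds ?p. solves_above v1 q"
      using N by eventually_elim (use v1 in blast)
    show "\<forall>\<^sub>F q in nhds ?p. solves_above v2 q"
      using N by eventually_elim (use v2 in blast)
    show "\<forall>\<^sub>F q in nhds ?p. fst q = \<psi> (snd q) \<longrightarrow> v1 q = v2 q"
      using N by eventually_elim (use v1 v2 in force)
  qed
  then have "\<forall>\<^sub>F q in nhds ?p. v1 q - v2 q = 0" by simp
  from ra_identity_connected[OF C _ p'C this pC]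
  have "v1 p - v2 p = 0" using sub v1 v2 by (blast intro: ra_diff)
  then show ?thesis by simp
qed

lemma global_existence:
  assumes v0: "\<And>x. x \<in> D \<Longrightarrow> (\<psi> x, x) \<in> U \<Longrightarrow> real_analytic_at (\<lambda>x. v0 (\<psi> x, x)) x"
  shows "\<exists>\<Omega> v. open \<Omega> \<and> hypersurface U D \<psi> \<subseteq> \<Omega> \<and> \<Omega> \<subseteq> U \<inter> (UNIV \<times> D) \<and> (\<forall>p\<in>\<Omega>. local_solution v0 v p)"
proof -
  define E where "E = {x\<in>D. (\<psi> x, x) \<in> U}"
  have "\<exists>v \<delta>. \<delta> > 0 \<and> ball x \<delta> \<subseteq> D \<and> tube x \<delta> \<subseteq> U \<and> (\<forall>p\<in>tube x \<delta>. local_solution v0 v p)" if "x \<in> E" for x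
  proof -
    have x: "x \<in> D" "(\<psi> x, x) \<in> U" using that by (auto simp: E_def)
    obtain v where "\<forall>\<^sub>F p in nhds (\<psi> x, x). local_solution v0 v p"
      using local_existence[OF x v0[OF x]] by blast
    then have "\<forall>\<^sub>F p in nhds (\<psi> x, x). local_solution v0 v p \<and> p \<in> U"
      using eventually_nhds_in_open[OF open_U x(2)] by (rule eventually_conj)
    from obtain_tube[OF x(1) this] show ?thesis by (metis subsetI)
  qed
  then obtain V \<delta> where V: "\<And>x. x \<in> E \<Longrightarrow> \<delta> x > 0 \<and> ball x (\<delta> x) \<subseteq> D \<and> tube x (\<delta> x) \<subseteq> U"
     "\<And>x p. x \<in> E \<Longrightarrow> p \<in> tube x (\<delta> x) \<Longrightarrow> local_solution v0 (V x) p" by metis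
  define \<Omega> where "\<Omega> = (\<Union>x\<in>E. tube x (\<delta> x))"
  define v where "v p = V (SOME x. x \<in> E \<and> p \<in> tube x (\<delta> x)) p" for p
  have v: "v p = V x p" if x: "x \<in> E" "p \<in> tube x (\<delta> x)" for x p
  proof -
    define y where "y = (SOME x. x \<in> E \<and> p \<in> tube x (\<delta> x))"
    have y: "y \<in> E" "p \<in> tube y (\<delta> y)" using someI[of "\<lambda>x. x \<in> E \<and> p \<in> tube x (\<delta> x)" x] x by (auto simp: y_def)
    have "V y p = V x p"
      by (rule tube_overlap[of y "\<delta> y" x "\<delta> x" "V y" v0 "V x" p])
         (use V(1)[OF y(1)] V(1)[OF x(1)] V(2)[OF y(1)] V(2)[OF x(1)] x y in \<open>blast+\<close>)
    then show ?thesis by (simp add: v_def y_def)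
  qed
  have "local_solution v0 v p" if p: "p \<in> \<Omega>" for p
  proof -
    obtain x where x: "x \<in> E" "p \<in> tube x (\<delta> x)" using p by (auto simp: \<Omega>_def)
    have ev: "\<forall>\<^sub>F q in nhds p. q \<in> tube x (\<delta> x)" 
      using V(1)[OF x(1)] x(2) by (intro eventually_nhds_in_open open_tube) auto
    have g: "local_solution v0 (V x) p" by (rule V(2)[OF x])
    have e: "\<forall>\<^sub>F q in nhds p. V x q = v q" using ev by eventually_elim (rule v[OF x(1), symmetric])
    have 1: "real_analytic_at v p" using g ra_cong[OF _ e] by blast
    have "\<forall>\<^sub>F q in nhds (fst p, snd p). log_singular a \<psi> (V x) q = log_singular a \<psi> v q" 
      using e unfolding prod.collapse by eventually_elim (simp add: log_singular_def case_prod_unfold)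
    from solves_wave_at_cong[OF this] g v[OF x] 1 show ?thesis by simp
  qed
  moreover have "open \<Omega>" unfolding \<Omega>_def using V(1) open_tube by blast
  moreover have "hypersurface U D \<psi> \<subseteq> \<Omega>"
  proof
    fix p assume "p \<in> hypersurface U D \<psi>"
    then obtain x where x: "x \<in> E" "p = (\<psi> x, x)" by (auto simp: hypersurface_def E_def)
    then show "p \<in> \<Omega>" using V(1)[OF x(1)] unfolding \<Omega>_def 
      by (intro UN_I[of x]) (auto simp: tube_def flat_def)
  qed
  moreover have "\<Omega> \<subseteq> U \<inter> (UNIV \<times> D)"
  proof
    fix p assume "p \<in> \<Omega>"
    then obtain x where x: "x \<in> E" "p \<in> tube x (\<delta> x)" by (auto simp: \<Omega>_def)
    then have "snd p \<in> D" "p \<in> U" using V(1)[OF x(1)] by (auto simp: tube_def)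
    then show "p \<in> U \<inter> (UNIV \<times> D)" by (cases p) auto
  qed
  ultimately show ?thesis by blast
qed

end

theorem theorem2p1:
  fixes U :: "(real \<times> (real ^ 'n::finite)) set"
    and D :: "(real ^ 'n) set"
    and f f2 f1 f0 :: "real \<times> (real ^ 'n) \<Rightarrow> real \<times> (real ^ 'n) \<Rightarrow> real"
    and \<psi> :: "real ^ 'n \<Rightarrow> real"
    and a :: real
    and v0 :: "real \<times> (real ^ 'n) \<Rightarrow> real"
  assumes "open U"
    and "analytic_form_on U 2 f2"
    and "analytic_form_on U 1 f1"
    and "analytic_form_on U 0 f0"
    and "\<And>p \<zeta>. p \<in> U \<Longrightarrow> f p \<zeta> = f2 p \<zeta> + f1 p \<zeta> + f0 p \<zeta>"
    and "open D"
    and "\<psi> real_analytic_on D"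
    and "a \<noteq> 0"
    and "\<And>x. x \<in> D \<Longrightarrow> (\<psi> x, x) \<in> U \<Longrightarrow>
           0 \<noteq> 1 - (norm (grad \<psi> x))\<^sup>2 \<and>
           1 - (norm (grad \<psi> x))\<^sup>2 = a * f2 (\<psi> x, x) (- 1, grad \<psi> x)"
    and "analytic_on_hypersurface U D \<psi> v0"
  shows "(\<exists>\<Omega> v. regular_part U D f \<psi> a v0 \<Omega> v) \<and>
         (\<forall>\<Omega>1 v1 \<Omega>2 v2.
            regular_part U D f \<psi> a v0 \<Omega>1 v1 \<longrightarrow> regular_part U D f \<psi> a v0 \<Omega>2 v2 \<longrightarrow>
            (\<exists>W. open W \<and> hypersurface U D \<psi> \<subseteq> W \<and> W \<subseteq> \<Omega>1 \<inter> \<Omega>2 \<and> (\<forall>p\<in>W. v1 p = v2 p)))"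
proof -
  let ?I2 = "{\<alpha> :: real \<times> (real ^ 'n) \<Rightarrow> nat. \<alpha> \<in> MI \<and> mdegree \<alpha> = 2}"
  let ?I1 = "{\<alpha> :: real \<times> (real ^ 'n) \<Rightarrow> nat. \<alpha> \<in> MI \<and> mdegree \<alpha> = 1}"
  obtain c2 B B' where f2: "\<And>\<alpha>. \<alpha> \<in> ?I2 \<Longrightarrow> B \<alpha> \<in> Basis \<and> B' \<alpha> \<in> Basis"
    "\<And>\<alpha> p. \<alpha> \<in> ?I2 \<Longrightarrow> p \<in> U \<Longrightarrow> real_analytic_at (c2 \<alpha>) p"
    "\<And>p \<zeta>. p \<in> U \<Longrightarrow> f2 p \<zeta> = (\<Sum>\<alpha>\<in>?I2. c2 \<alpha> p * ((\<zeta> \<bullet> B \<alpha>) * (\<zeta> \<bullet> B' \<alpha>)))"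
    by (rule analytic_form_degree_2[OF assms(2)]) blast
  obtain c1 C where f1: "\<And>\<alpha>. \<alpha> \<in> ?I1 \<Longrightarrow> C \<alpha> \<in> Basis"
    "\<And>\<alpha> p. \<alpha> \<in> ?I1 \<Longrightarrow> p \<in> U \<Longrightarrow> real_analytic_at (c1 \<alpha>) p"
    "\<And>p \<zeta>. p \<in> U \<Longrightarrow> f1 p \<zeta> = (\<Sum>\<alpha>\<in>?I1. c1 \<alpha> p * (\<zeta> \<bullet> C \<alpha>))"
    by (rule analytic_form_degree_1[OF assms(3)]) blast
  obtain c0 where f0: "\<And>p. p \<in> U \<Longrightarrow> real_analytic_at c0 p" "\<And>p \<zeta>. p \<in> U \<Longrightarrow> f0 p \<zeta> = c0 p"
    by (rule analytic_form_degree_0[OF assms(4)]) blast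
  have grad: "grad \<psi> x = (\<chi> i. dd (axis i 1) \<psi> x)" for x
    by (simp add: grad_def partial_x_eq_dd')
  have q: "1 - (norm (grad \<psi> x))\<^sup>2 = minkowski \<psi> x" for x
    by (simp add: minkowski_def grad power2_norm_eq_inner inner_vec_def) (simp add: power2_eq_square)
  interpret singular_wave U D f \<psi> a ?I2 c2 B B' ?I1 c1 C c0
  proof (unfold_locales)
    show "open U" "open D" "a \<noteq> 0" using assms by auto
    show "real_analytic_at \<psi> x" if "x \<in> D" for x using assms(7) that by (simp add: real_analytic_on_def)
    show "f p \<zeta> = (\<Sum>i\<in>?I2. c2 i p * ((\<zeta> \<bullet> B i) * (\<zeta> \<bullet> B' i))) + (\<Sum>i\<in>?I1. c1 i p * (\<zeta> \<bullet> C i)) + c0 p" if "p \<in> U" for p \<zeta>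
      using assms(5) f2(3) f1(3) f0(2) that by simp
    show "minkowski \<psi> x \<noteq> 0 \<and> minkowski \<psi> x = 
        a * (\<Sum>i\<in>?I2. c2 i (\<psi> x, x) * ((conormal \<psi> x \<bullet> B i) * (conormal \<psi> x \<bullet> B' i)))"
      if "x \<in> D" "(\<psi> x, x) \<in> U" for x
    proof -
      have "(- 1, grad \<psi> x) = conormal \<psi> x" by (simp add: grad conormal_def)
      then show ?thesis using assms(9)[OF that] unfolding q f2(3)[OF that(2)] by auto
    qed
  qed (use f2 f1 f0 in auto)
  have reg: "regular_part U D f \<psi> a v0 \<Omega> v \<longleftrightarrow> 
     open \<Omega> \<and> hypersurface U D \<psi> \<subseteq> \<Omega> \<and> \<Omega> \<subseteq> U \<inter> (UNIV \<times> D) \<and> (\<forall>p\<in>\<Omega>. real_analytic_at v p) \<and>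
     (\<forall>p\<in>\<Omega>. solves_above v p) \<and> 
     (\<forall>p\<in>hypersurface U D \<psi>. v p = v0 p)" for \<Omega> v
    unfolding regular_part_def log_singular_def real_analytic_on_def by (auto simp: case_prod_unfold)
  show ?thesis
  proof (intro conjI allI impI)
    have "real_analytic_at (\<lambda>x. v0 (\<psi> x, x)) x" if "x \<in> D" "(\<psi> x, x) \<in> U" for x
      using assms(10) that by (simp add: analytic_on_hypersurface_def real_analytic_on_def)
    from global_existence[OF this]
    obtain \<Omega> v where "open \<Omega>" "hypersurface U D \<psi> \<subseteq> \<Omega>" "\<Omega> \<subseteq> U \<inter> (UNIV \<times> D)" 
      and v: "\<And>p. p \<in> \<Omega> \<Longrightarrow> local_solution v0 v p" by blast
    moreover have "v p = v0 p" if "p \<in> hypersurface U D \<psi>" for p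
    proof -
      have "p \<in> \<Omega>" "fst p = \<psi> (snd p)" using that \<open>hypersurface U D \<psi> \<subseteq> \<Omega>\<close> by (auto simp: hypersurface_def)
      then show ?thesis using v by blast
    qed
    ultimately have "regular_part U D f \<psi> a v0 \<Omega> v" unfolding reg by blast
    then show "\<exists>\<Omega> v. regular_part U D f \<psi> a v0 \<Omega> v" by blast
  next
    fix \<Omega>1 v1 \<Omega>2 v2
    assume R: "regular_part U D f \<psi> a v0 \<Omega>1 v1" "regular_part U D f \<psi> a v0 \<Omega>2 v2"
    define W where "W = {p \<in> \<Omega>1 \<inter> \<Omega>2. \<forall>\<^sub>F q in nhds p. v1 q = v2 q}"
    have \<Omega>: "open (\<Omega>1 \<inter> \<Omega>2)" "hypersurface U D \<psi> \<subseteq> \<Omega>1 \<inter> \<Omega>2" "\<Omega>1 \<subseteq> UNIV \<times> D" "\<Omega>1 \<subseteq> U" using R unfolding reg by auto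
    have near: "\<forall>\<^sub>F q in nhds p. q \<in> \<Omega>1 \<inter> \<Omega>2" if "p \<in> \<Omega>1 \<inter> \<Omega>2" for p
      by (rule eventually_nhds_in_open[OF \<Omega>(1) that])
    have "open W"
    proof (rule open_eventually)
      fix p assume "p \<in> W"
      then have "p \<in> \<Omega>1 \<inter> \<Omega>2" "\<forall>\<^sub>F q in nhds p. \<forall>\<^sub>F r in nhds q. v1 r = v2 r" 
        by (auto simp: W_def eventually_eventually)
      from near[OF this(1)] this(2) show "\<forall>\<^sub>F q in nhds p. q \<in> W" by eventually_elim (simp add: W_def)
    qed
    moreover have "hypersurface U D \<psi> \<subseteq> W"
    proof
      fix p assume p: "p \<in> hypersurface U D \<psi>"
      then obtain x where x: "p = (\<psi> x, x)" "x \<in> D" "(\<psi> x, x) \<in> U" by (auto simp: hypersurface_def)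
      have N: "\<forall>\<^sub>F q in nhds (\<psi> x, x). q \<in> \<Omega>1 \<inter> \<Omega>2" using near p \<Omega>(2) x(1) by blast
      have "\<forall>\<^sub>F q in nhds (\<psi> x, x). v1 q = v2 q"
      proof (rule local_uniqueness[OF x(2,3)])
        show "real_analytic_at v1 (\<psi> x, x)" "real_analytic_at v2 (\<psi> x, x)"
          using R p \<Omega>(2) x(1) unfolding reg by blast+
        show "\<forall>\<^sub>F q in nhds (\<psi> x, x). solves_above v1 q"
          using N by eventually_elim (use R(1)[unfolded reg] in blast)
        show "\<forall>\<^sub>F q in nhds (\<psi> x, x). solves_above v2 q"
          using N by eventually_elim (use R(2)[unfolded reg] in blast)
        show "\<forall>\<^sub>F q in nhds (\<psi> x, x). fst q = \<psi> (snd q) \<longrightarrow> v1 q = v2 q"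
          using N
        proof eventually_elim
          case (elim q)
          show ?case
          proof
            assume "fst q = \<psi> (snd q)"
            then have "q \<in> hypersurface U D \<psi>" using elim \<Omega>(3,4) by (cases q) (auto simp: hypersurface_def)
            then show "v1 q = v2 q" using R unfolding reg by metis
          qed
        qed
      qed
      then show "p \<in> W" using p \<Omega>(2) x(1) by (auto simp: W_def)
    qed
    moreover have "\<forall>p\<in>W. v1 p = v2 p" using eventually_nhds_x_imp_x by (auto simp: W_def)
    moreover have "W \<subseteq> \<Omega>1 \<inter> \<Omega>2" by (auto simp: W_def)
    ultimately show "\<exists>W. open W \<and> hypersurface U D \<psi> \<subseteq> W \<and> W \<subseteq> \<Omega>1 \<inter> \<Omega>2 \<and> (\<forall>p\<in>W. v1 p = v2 p)" by blast
  qed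
qed

end
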